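(* Fix $\epsilon>0$ and let $(\delta,\rho)\in(0,1)\times(0,1/2)$. Consider a sequence of problem sizes $(k,n,N)$ growing proportionally, i.e. $n\to\infty$ with $\frac{n}{N}\to\delta$ and $\frac{k}{n}\to\rho$, and for each $(k,n,N)$ let $A$ be an $n\times N$ random matrix drawn from the Gaussian ensemble. If $\rho<(1-\epsilon)\rho_S^{FL}(\delta)$, then $$\mathrm{Prob}\big(\mathrm{StrongEquiv}(A,\ell^1)\big)\to 1\quad\text{as } n\to\infty.$$ (That is, the function $\rho_S^{FL}(\delta)$ bounds a region of strong equivalence for $\ell^1$-minimization.)
   Context: Gaussian ensemble: the entries of the $n\times N$ matrix $A$ are i.i.d. normal $\mathcal{N}(0,n^{-1})$ (mean $0$, variance $1/n$). $\mathrm{StrongEquiv}(A,\ell^1)$ is the event that for every $k$-sparse vector $x\in\mathbb{R}^N$ (at most $k$ nonzero entries), $\ell^1$-minimization exactly recovers $x$ from $y=Ax$, i.e. $x$ is the unique solution of $\min_{z\in\mathbb{R}^N}\|z\|_1$ subject to $Az=y$. A function $\rho_S(\delta)$ bounds a region of strong equivalence for $\ell^1$-minimization if, for each fixed $\epsilon>0$ and $(\delta,\rho)\in(0,1)\times(0,1/2)$, when $(k,n,N)$ is a sequence of problem sizes with $n\to\infty$, $\frac{n}{N}\to\delta$ and $\frac{k}{n}\to\rho$, and for each $(k,n,N)$ the $n\times N$ matrix $A$ is drawn from the Gaussian ensemble, whenever $0<\rho<(1-\epsilon)\rho_S(\delta)$ one has $\mathrm{Prob}(\mathrm{StrongEquiv}(A,\ell^1))\to1$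 as $n\to\infty$. Let $H(p):=p\log(1/p)+(1-p)\log(1/(1-p))$ (natural logarithm, with $0\log(1/0)=0$), and $$\psi_{min}(\lambda,\rho):=H(\rho)+\tfrac12\left[(1-\rho)\log\lambda+1-\rho+\rho\log\rho-\lambda\right],$$ $$\psi_{max}(\lambda,\rho):=\tfrac12\left[(1+\rho)\log\lambda+1+\rho-\rho\log\rho-\lambda\right].$$ Define $\lambda^{min}(\delta,\rho)$ as the solution $\lambda$ of $\delta\psi_{min}(\lambda,\rho)+H(\rho\delta)=0$ with $\lambda\le 1-\rho$, and $\lambda^{max}(\delta,\rho)$ as the solution $\lambda$ of $\delta\psi_{max}(\lambda,\rho)+H(\rho\delta)=0$ with $\lambda\ge 1+\rho$. Define $$\mathcal{L}(\delta,\rho):=1-\lambda^{min}(\delta,\rho),\qquad \mathcal{U}(\delta,\rho):=\min_{\nu\in[\rho,1]}\lambda^{max}(\delta,\nu)-1,$$ $$\mu^{FL}(\delta,\rho):=\frac{1+\sqrt2}{4}\left(\frac{1+\mathcal{U}(\delta,2\rho)}{1-\mathcal{L}(\delta,2\rho)}-1\right),$$ and let $\rho_S^{FL}(\delta)$ be the solution $\rho\in(0,1/2)$ of $\mu^{FL}(\delta,\rho)=1$. *)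

theory Defs
  imports "HOL-Probability.Probability" "Jordan_Normal_Form.Matrix"
begin

text \<open>Problem sizes vary along a sequence, so vectors and matrices are those of
  \<^theory>\<open>Jordan_Normal_Form.Matrix\<close>, whose dimensions are carried by the terms.\<close>

definition l1_norm :: "real Matrix.vec \<Rightarrow> real" where
  "l1_norm x = (\<Sum>i<dim_vec x. \<bar>vec_index x i\<bar>)"

definition sparse :: "nat \<Rightarrow> real Matrix.vec \<Rightarrow> bool" where
  "sparse k x \<longleftrightarrow> card {i. i < dim_vec x \<and> vec_index x i \<noteq> 0} \<le> k"

definition l1_solutions :: "real mat \<Rightarrow> real Matrix.vec \<Rightarrow> real Matrix.vec set" where
  "l1_solutions A y =
     {z \<in> carrier_vec (dim_col A). A *\<^sub>v z = y \<and>
        (\<forall>z' \<in> carrier_vec (dim_col A). A *\<^sub>v z' = y \<longrightarrow> l1_norm z \<le> l1_norm z')}"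

definition strong_equiv :: "nat \<Rightarrow> real mat \<Rightarrow> bool" where
  "strong_equiv k A \<longleftrightarrow>
     (\<forall>x \<in> carrier_vec (dim_col A). sparse k x \<longrightarrow> l1_solutions A (A *\<^sub>v x) = {x})"

text \<open>\<^const>\<open>normal_density\<close> takes the standard deviation, so variance \<open>1/n\<close> is \<open>1 / sqrt n\<close>.\<close>

definition gaussian_ensemble :: "'w measure \<Rightarrow> nat \<Rightarrow> nat \<Rightarrow> ('w \<Rightarrow> real mat) \<Rightarrow> bool" where
  "gaussian_ensemble M n N A \<longleftrightarrow>
     prob_space M \<and>
     (\<forall>w \<in> space M. A w \<in> carrier_mat n N) \<and>
     prob_space.indep_vars M (\<lambda>_. borel) (\<lambda>ij w. index_mat (A w) ij) ({..<n} \<times> {..<N}) \<and>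
     (\<forall>ij \<in> {..<n} \<times> {..<N}.
        distributed M lborel (\<lambda>w. index_mat (A w) ij) (normal_density 0 (1 / sqrt (real n))))"

text \<open>The convention \<open>0 log (1/0) = 0\<close> holds automatically.\<close>

definition H :: "real \<Rightarrow> real" where
  "H p = p * ln (1 / p) + (1 - p) * ln (1 / (1 - p))"

definition psi_min :: "real \<Rightarrow> real \<Rightarrow> real" where
  "psi_min l \<rho> = H \<rho> + 1 / 2 * ((1 - \<rho>) * ln l + 1 - \<rho> + \<rho> * ln \<rho> - l)"

definition psi_max :: "real \<Rightarrow> real \<Rightarrow> real" where
  "psi_max l \<rho> = 1 / 2 * ((1 + \<rho>) * ln l + 1 + \<rho> - \<rho> * ln \<rho> - l)"

text \<open>The solution below is unique: on \<open>0 < l \<le> 1 - \<rho>\<close> the function \<open>psi_min\<close> increases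
  in \<open>l\<close>, from minus infinity to a positive value. The condition \<open>0 < l\<close>, implicit in the
  occurrence of \<open>log l\<close>, is needed because \<^const>\<open>ln\<close> is total. Likewise \<open>psi_max\<close>
  decreases on \<open>l \<ge> 1 + \<rho>\<close>, from a positive value to minus infinity.\<close>

definition lambda_min :: "real \<Rightarrow> real \<Rightarrow> real" where
  "lambda_min \<delta> \<rho> = (THE l. 0 < l \<and> l \<le> 1 - \<rho> \<and> \<delta> * psi_min l \<rho> + H (\<rho> * \<delta>) = 0)"

definition lambda_max :: "real \<Rightarrow> real \<Rightarrow> real" where
  "lambda_max \<delta> \<rho> = (THE l. 1 + \<rho> \<le> l \<and> \<delta> * psi_max l \<rho> + H (\<rho> * \<delta>) = 0)"

definition L_bound :: "real \<Rightarrow> real \<Rightarrow> real" where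
  "L_bound \<delta> \<rho> = 1 - lambda_min \<delta> \<rho>"

text \<open>\<^const>\<open>Min\<close> is for finite sets only; \<^const>\<open>Least\<close> is the minimum of the compact set
  \<open>lambda_max \<delta> ` {\<rho>..1}\<close>.\<close>

definition U_bound :: "real \<Rightarrow> real \<Rightarrow> real" where
  "U_bound \<delta> \<rho> = (LEAST l. l \<in> lambda_max \<delta> ` {\<rho>..1}) - 1"

definition mu_FL :: "real \<Rightarrow> real \<Rightarrow> real" where
  "mu_FL \<delta> \<rho> =
     (1 + sqrt 2) / 4 * ((1 + U_bound \<delta> (2 * \<rho>)) / (1 - L_bound \<delta> (2 * \<rho>)) - 1)"

text \<open>Unique for \<open>0 < \<delta> < 1\<close>: \<open>mu_FL \<delta>\<close> is continuous and strictly increasing on \<open>(0, 1/2)\<close>,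
  from \<open>0\<close> to infinity.\<close>

definition rho_S_FL :: "real \<Rightarrow> real" where
  "rho_S_FL \<delta> = (THE \<rho>. 0 < \<rho> \<and> \<rho> < 1 / 2 \<and> mu_FL \<delta> \<rho> = 1)"

end

theory Submission
  imports Defs "HOL-Real_Asymp.Real_Asymp"
begin

text \<open>Suppose that \<open>l |x|^2 \<le> |A x|^2 \<le> u |x|^2\<close> for all \<open>2 k\<close>-sparse \<open>x\<close>, where
  \<open>(1 + sqrt 2) / 4 * (u / l - 1) < 1\<close>. By the argument of Foucart and Lai every nonzero kernel vector
  of \<open>A\<close> then has less \<open>l1\<close> mass on any \<open>k\<close> coordinates than on the others, which is equivalent to
  strong equivalence. For \<open>\<rho>\<close> below \<open>rho_S_FL \<delta>\<close> there are such \<open>l\<close> and \<open>u\<close> with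
  \<open>l < lambda_min \<delta> (2 \<rho>)\<close> and \<open>lambda_max \<delta> \<nu> < u\<close> for some \<open>\<nu> \<in> {2 \<rho>..1}\<close>. A union bound over the
  \<open>N choose K\<close> column sets, with \<open>K = 2 k\<close> for the lower and \<open>K\<close> about \<open>\<nu> n\<close> for the upper inequality,
  reduces the claim to large deviation bounds for the extreme singular values of an \<open>n \<times> K\<close> Gaussian
  matrix with exponents at most \<open>n * psi_min l (2 \<rho>)\<close> and \<open>n * psi_max u \<nu>\<close>.

  The latter are obtained without the eigenvalue densities of Wishart matrices. Bounding the length of
  \<open>G x\<close> uniformly in \<open>x\<close> is replaced by testing \<open>G\<close> on one additional independent Gaussian vector, which
  is correlated with the extremal \<open>x\<close> with probability not too small; Chernoff's method and rotation
  invariance then give bounds with optimal exponents.\<close>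

section \<open>Restricted isometries and the null space property\<close>

text \<open>Testing \<open>G\<close> on one additional Gaussian is not free: the test succeeds with
  probability of about \<open>exp (- t / 2)\<close>, where \<open>t\<close> is itself of order
  \<open>n\<close>. This loss enters the exponent, and the Chernoff parameters are optimised with it
  included. Comparing the optimum with \<open>psi_min\<close> and \<open>psi_max\<close> is then a
  matter of calculus. The minimum over \<nu> in \<open>U_bound\<close> arises because a vector on
  \<open>2 * k\<close> columns is also a vector on any larger column set. Enlarging the sets changes
  both their number and the exponent, and the best trade-off may be taken. Two uncountable
  quantifiers threaten measurability. The one over \<open>x\<close> in the singular value bounds is
  hidden behind a dominating function \<open>p\<close>; the one in \<open>strong_equiv\<close> is
  removed by compactness, since failure of the null space property is a closed condition on the
  entries. The definite descriptions \<open>lambda_min\<close>, \<open>lambda_max\<close> and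
  \<open>rho_S_FL\<close> have to be shown to denote something, hence the monotonicity results. The
  factor \<open>1 - \<epsilon>\<close> makes \<rho> lie strictly below
  \<open>rho_S_FL \<delta>\<close>; this is what leaves room for \<open>l\<close> and
  \<open>u\<close> with negative exponents.\<close>

definition rip_bounds :: "real \<Rightarrow> real \<Rightarrow> nat \<Rightarrow> 'i set \<Rightarrow> 'j set \<Rightarrow> ('i \<Rightarrow> 'j \<Rightarrow> real) \<Rightarrow> bool" where
  "rip_bounds \<alpha> \<beta> K I V a \<longleftrightarrow>
     (\<forall>T\<subseteq>V. card T \<le> K \<longrightarrow> (\<forall>x. \<alpha> * (\<Sum>j\<in>T. (x j)\<^sup>2) \<le> (\<Sum>i\<in>I. (\<Sum>j\<in>T. a i j * x j)\<^sup>2) \<and>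
        (\<Sum>i\<in>I. (\<Sum>j\<in>T. a i j * x j)\<^sup>2) \<le> \<beta> * (\<Sum>j\<in>T. (x j)\<^sup>2)))"

text \<open>Polarisation: once both parts are normalised, their sum and their difference have
  squared length 2 and live on at most \<open>2 * k\<close> coordinates. Both images have squared
  length between \<open>2 * \<alpha>\<close> and \<open>2 * \<beta>\<close>, and these two squared
  lengths differ by four times the normalised inner product.\<close>

lemma rip_bilinear_bound:
  fixes a :: "'i \<Rightarrow> 'j \<Rightarrow> real"
  assumes rip: "rip_bounds \<alpha> \<beta> (2 * k) I V a"
    and V: "finite V" "U \<subseteq> V" "W \<subseteq> V" "U \<inter> W = {}" and card: "card U \<le> k" "card W \<le> k"
  shows "\<bar>\<Sum>i\<in>I. (\<Sum>j\<in>U. a i j * x j) * (\<Sum>j\<in>W. a i j * x j)\<bar>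
           \<le> (\<beta> - \<alpha>) / 2 * L2_set x U * L2_set x W"
proof (cases "L2_set x U = 0 \<or> L2_set x W = 0")
  case True
  have fin: "finite U" "finite W" using V by (auto intro: finite_subset)
  have "(\<forall>j\<in>U. x j = 0) \<or> (\<forall>j\<in>W. x j = 0)"
    using True fin by (auto simp: L2_set_eq_0_iff)
  then show ?thesis using True by auto
next
  case False
  define u where "u = L2_set x U"
  define w where "w = L2_set x W"
  have pos: "u > 0" "w > 0" using False by (auto simp: u_def w_def less_le)
  have fin: "finite U" "finite W" using V by (auto intro: finite_subset)
  define y where "y \<sigma> j = (if j \<in> U then x j / u else \<sigma> * x j / w)" for \<sigma> :: real and j
  have disj: "j \<notin> U" if "j \<in> W" for j using V that by auto
  have S: "(\<Sum>j\<in>U \<union> W. a i j * y \<sigma> j) = (\<Sum>j\<in>U. a i j * x j) / u + \<sigma> * (\<Sum>j\<in>W. a i j * x j) / w" for i \<sigma>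
    using fin V(4) disj
    by (simp add: sum.union_disjoint y_def sum_divide_distrib sum_distrib_left mult_ac)
  have Q: "(\<Sum>j\<in>U \<union> W. (y \<sigma> j)\<^sup>2) = 2" if "\<sigma>\<^sup>2 = 1" for \<sigma>
  proof -
    have "(\<Sum>j\<in>U \<union> W. (y \<sigma> j)\<^sup>2) = (\<Sum>j\<in>U. (x j)\<^sup>2) / u\<^sup>2 + (\<Sum>j\<in>W. (x j)\<^sup>2) / w\<^sup>2"
      using fin V(4) disj that
      by (simp add: sum.union_disjoint y_def sum_divide_distrib power_divide power_mult_distrib)
    also have "(\<Sum>j\<in>U. (x j)\<^sup>2) = u\<^sup>2" unfolding u_def L2_set_def by (simp add: sum_nonneg)
    also have "(\<Sum>j\<in>W. (x j)\<^sup>2) = w\<^sup>2" unfolding w_def L2_set_def by (simp add: sum_nonneg)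
    finally show ?thesis using pos by simp
  qed
  have "card (U \<union> W) \<le> 2 * k" using card card_Un_le[of U W] by linarith
  then have b: "\<alpha> * 2 \<le> (\<Sum>i\<in>I. (\<Sum>j\<in>U \<union> W. a i j * y \<sigma> j)\<^sup>2)"
      "(\<Sum>i\<in>I. (\<Sum>j\<in>U \<union> W. a i j * y \<sigma> j)\<^sup>2) \<le> \<beta> * 2" if "\<sigma>\<^sup>2 = 1" for \<sigma>
    using rip[unfolded rip_bounds_def, rule_format, of "U \<union> W" "y \<sigma>"] V(2,3) unfolding Q[OF that] by auto
  define B where "B = (\<Sum>i\<in>I. (\<Sum>j\<in>U. a i j * x j) * (\<Sum>j\<in>W. a i j * x j))"
  have "(\<Sum>i\<in>I. (\<Sum>j\<in>U \<union> W. a i j * y 1 j)\<^sup>2) - (\<Sum>i\<in>I. (\<Sum>j\<in>U \<union> W. a i j * y (-1) j)\<^sup>2)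
      = (\<Sum>i\<in>I. 4 / (u * w) * ((\<Sum>j\<in>U. a i j * x j) * (\<Sum>j\<in>W. a i j * x j)))"
    unfolding sum_subtractf[symmetric] S using pos
    by (intro sum.cong refl) (simp add: power2_eq_square field_simps)
  also have "\<dots> = 4 / (u * w) * B" by (simp add: B_def sum_distrib_left)
  finally have "\<bar>4 / (u * w) * B\<bar> \<le> 2 * (\<beta> - \<alpha>)" using b[of 1] b[of "-1"] by simp
  then have "4 / (u * w) * \<bar>B\<bar> \<le> 2 * (\<beta> - \<alpha>)" using pos by (simp add: abs_mult)
  then have "\<bar>B\<bar> \<le> (\<beta> - \<alpha>) / 2 * u * w" using pos by (simp add: field_simps)
  then show ?thesis by (simp add: B_def u_def w_def)
qed

text \<open>Repeatedly taking a maximum lets blocks of decreasing magnitude be peeled off without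
  sorting the coordinates.\<close>

lemma ex_largest_subset:
  fixes f :: "'a \<Rightarrow> real"
  assumes "finite C" "k \<le> card C"
  obtains T where "T \<subseteq> C" "card T = k" "\<And>i j. i \<in> T \<Longrightarrow> j \<in> C - T \<Longrightarrow> f j \<le> f i"
proof -
  have "\<exists>T\<subseteq>C. card T = k \<and> (\<forall>i\<in>T. \<forall>j\<in>C - T. f j \<le> f i)" using assms(2)
  proof (induction k)
    case (Suc k)
    then obtain T where T: "T \<subseteq> C" "card T = k" "\<forall>i\<in>T. \<forall>j\<in>C - T. f j \<le> f i" by auto
    have finT: "finite T" using T(1) assms(1) by (auto intro: finite_subset)
    have "C - T \<noteq> {}"
    proof
      assume "C - T = {}"
      then have "C = T" using T(1) by blast
      then show False using T(2) Suc.prems by simp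
    qed
    then have fin: "finite (f ` (C - T))" "f ` (C - T) \<noteq> {}" using assms(1) by simp_all
    obtain m where m: "m \<in> C - T" "Max (f ` (C - T)) = f m" using Max_in[OF fin] by (rule imageE)
    have m_max: "f j \<le> f m" if "j \<in> C - T" for j
      using Max_ge[OF fin(1)] that unfolding m(2)[symmetric] by blast
    have "insert m T \<subseteq> C" "card (insert m T) = Suc k" using T m(1) finT by auto
    moreover have "\<forall>i\<in>insert m T. \<forall>j\<in>C - insert m T. f j \<le> f i" using T(3) m(1) m_max by blast
    ultimately show ?case by blast
  qed auto
  then show ?thesis using that by blast
qed

lemma L2_set_le_bound:
  assumes "finite C" "card C \<le> k" "\<And>j. j \<in> C \<Longrightarrow> \<bar>x j\<bar> \<le> M" "0 \<le> M"
  shows "L2_set x C \<le> sqrt (real k) * M"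
proof -
  have "(\<Sum>j\<in>C. (x j)\<^sup>2) \<le> (\<Sum>j\<in>C. M\<^sup>2)"
    using assms(3,4) by (intro sum_mono) (metis abs_le_square_iff abs_of_nonneg)
  also have "\<dots> \<le> real k * M\<^sup>2" using assms(2) by (simp add: mult_right_mono)
  finally have "L2_set x C \<le> sqrt (real k * M\<^sup>2)" unfolding L2_set_def by simp
  then show ?thesis using assms(4) by (simp add: real_sqrt_mult)
qed

text \<open>Peel off a block of the \<open>k\<close> largest coordinates. Its \<open>L2\<close> norm
  is at most \<open>sqrt k * M\<close>, and its mean is an admissible \<open>M\<close> for the
  coordinates that remain, where it costs the \<open>l1\<close> norm of the block divided by
  \<open>sqrt k\<close>. So each block pays for the next one, and the costs add up to the
  \<open>l1\<close> norm of \<open>C\<close>.\<close>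

lemma rip_tail_bound:
  fixes a :: "'i \<Rightarrow> 'j \<Rightarrow> real"
  assumes rip: "rip_bounds \<alpha> \<beta> (2 * k) I V a" and "\<alpha> \<le> \<beta>" "0 < k"
    and V: "finite V" "U \<subseteq> V" and card: "card U \<le> k"
    and C: "C \<subseteq> V" "U \<inter> C = {}" and M: "\<And>j. j \<in> C \<Longrightarrow> \<bar>x j\<bar> \<le> M" "0 \<le> M"
  shows "\<bar>\<Sum>i\<in>I. (\<Sum>j\<in>U. a i j * x j) * (\<Sum>j\<in>C. a i j * x j)\<bar>
           \<le> (\<beta> - \<alpha>) / 2 * L2_set x U * (sqrt (real k) * M + (\<Sum>j\<in>C. \<bar>x j\<bar>) / sqrt (real k))"
  using C M
proof (induction "card C" arbitrary: C M rule: less_induct)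
  case less
  have finC: "finite C" using less.prems V by (auto intro: finite_subset)
  have c0: "0 \<le> (\<beta> - \<alpha>) / 2 * L2_set x U" using \<open>\<alpha> \<le> \<beta>\<close> by simp
  show ?case
  proof (cases "card C \<le> k")
    case True
    have "\<bar>\<Sum>i\<in>I. (\<Sum>j\<in>U. a i j * x j) * (\<Sum>j\<in>C. a i j * x j)\<bar> \<le> (\<beta> - \<alpha>) / 2 * L2_set x U * L2_set x C"
      using less.prems V card True by (intro rip_bilinear_bound[OF rip]) auto
    also have "\<dots> \<le> (\<beta> - \<alpha>) / 2 * L2_set x U * (sqrt (real k) * M + (\<Sum>j\<in>C. \<bar>x j\<bar>) / sqrt (real k))"
    proof (intro mult_left_mono c0)
      have "L2_set x C \<le> sqrt (real k) * M" using less.prems True finC by (intro L2_set_le_bound) auto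
      moreover have "0 \<le> (\<Sum>j\<in>C. \<bar>x j\<bar>) / sqrt (real k)" by (simp add: sum_nonneg)
      ultimately show "L2_set x C \<le> sqrt (real k) * M + (\<Sum>j\<in>C. \<bar>x j\<bar>) / sqrt (real k)" by linarith
    qed
    finally show ?thesis .
  next
    case False
    then obtain T where T: "T \<subseteq> C" "card T = k" "\<And>i j. i \<in> T \<Longrightarrow> j \<in> C - T \<Longrightarrow> \<bar>x j\<bar> \<le> \<bar>x i\<bar>"
      using ex_largest_subset[OF finC, of k "\<lambda>j. \<bar>x j\<bar>"] by auto
    have finT: "finite T" using T finC by (auto intro: finite_subset)
    have neT: "T \<noteq> {}" using T \<open>0 < k\<close> by auto
    define m where "m = (\<Sum>j\<in>T. \<bar>x j\<bar>) / real k"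
    have m: "\<bar>x j\<bar> \<le> m" if "j \<in> C - T" for j
    proof -
      have "real (card T) * \<bar>x j\<bar> \<le> (\<Sum>i\<in>T. \<bar>x i\<bar>)" using T(3) that by (intro sum_bounded_below) auto
      then show ?thesis using T(2) \<open>0 < k\<close> by (simp add: m_def field_simps)
    qed
    have m0: "0 \<le> m" by (simp add: m_def sum_nonneg)
    have km: "sqrt (real k) * m = (\<Sum>j\<in>T. \<bar>x j\<bar>) / sqrt (real k)"
      using \<open>0 < k\<close> by (simp add: m_def field_simps)
    have splitC: "(\<Sum>j\<in>C. f j) = (\<Sum>j\<in>T. f j) + (\<Sum>j\<in>C - T. f j)" for f :: "'j \<Rightarrow> real"
      using T finC by (simp add: add.commute sum.subset_diff)
    have 1: "\<bar>\<Sum>i\<in>I. (\<Sum>j\<in>U. a i j * x j) * (\<Sum>j\<in>T. a i j * x j)\<bar>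
        \<le> (\<beta> - \<alpha>) / 2 * L2_set x U * (sqrt (real k) * M)"
    proof -
      have "\<bar>\<Sum>i\<in>I. (\<Sum>j\<in>U. a i j * x j) * (\<Sum>j\<in>T. a i j * x j)\<bar> \<le> (\<beta> - \<alpha>) / 2 * L2_set x U * L2_set x T"
        using less.prems V card T by (intro rip_bilinear_bound[OF rip]) auto
      also have "\<dots> \<le> (\<beta> - \<alpha>) / 2 * L2_set x U * (sqrt (real k) * M)"
        using less.prems T finT by (intro mult_left_mono c0 L2_set_le_bound) auto
      finally show ?thesis .
    qed
    have 2: "\<bar>\<Sum>i\<in>I. (\<Sum>j\<in>U. a i j * x j) * (\<Sum>j\<in>C - T. a i j * x j)\<bar>
        \<le> (\<beta> - \<alpha>) / 2 * L2_set x U * (sqrt (real k) * m + (\<Sum>j\<in>C - T. \<bar>x j\<bar>) / sqrt (real k))"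
      using less.prems m m0 neT T finC by (intro less.hyps) (auto intro!: psubset_card_mono)
    have "(\<Sum>i\<in>I. (\<Sum>j\<in>U. a i j * x j) * (\<Sum>j\<in>C. a i j * x j)) =
      (\<Sum>i\<in>I. (\<Sum>j\<in>U. a i j * x j) * (\<Sum>j\<in>T. a i j * x j)) + (\<Sum>i\<in>I. (\<Sum>j\<in>U. a i j * x j) * (\<Sum>j\<in>C - T. a i j * x j))"
      unfolding splitC sum.distrib[symmetric] by (simp add: algebra_simps)
    with 1 2 have "\<bar>\<Sum>i\<in>I. (\<Sum>j\<in>U. a i j * x j) * (\<Sum>j\<in>C. a i j * x j)\<bar> \<le>
       (\<beta> - \<alpha>) / 2 * L2_set x U * (sqrt (real k) * M) + 
       (\<beta> - \<alpha>) / 2 * L2_set x U * ((\<Sum>j\<in>T. \<bar>x j\<bar>) / sqrt (real k) + (\<Sum>j\<in>C - T. \<bar>x j\<bar>) / sqrt (real k))"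
      unfolding km by linarith
    also have "\<dots> = (\<beta> - \<alpha>) / 2 * L2_set x U * (sqrt (real k) * M + (\<Sum>j\<in>C. \<bar>x j\<bar>) / sqrt (real k))"
      unfolding splitC by (simp add: algebra_simps add_divide_distrib)
    finally show ?thesis .
  qed
qed

lemma l1_le_sqrt_card_L2:
  "(\<Sum>j\<in>S. \<bar>x j\<bar>) \<le> sqrt (real (card S)) * L2_set x S"
proof -
  have "(\<Sum>j\<in>S. \<bar>1 :: real\<bar> * \<bar>x j\<bar>) \<le> L2_set (\<lambda>_. 1) S * L2_set x S" by (rule L2_set_mult_ineq)
  then show ?thesis by (simp add: L2_set_def)
qed

text \<open>The point \<open>(p, q)\<close> lies in the disc around \<open>(c, c)\<close> whose
  boundary passes through the origin, so its radius is \<open>sqrt 2 * c\<close>. This is where the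
  factor \<open>1 + sqrt 2\<close> of \<open>mu_FL\<close> comes from.\<close>

lemma two_squares_le_linear:
  fixes p q c :: real
  assumes "p\<^sup>2 + q\<^sup>2 \<le> 2 * c * (p + q)" "0 \<le> c"
  shows "p \<le> (1 + sqrt 2) * c"
proof -
  have "(p - c)\<^sup>2 \<le> (sqrt 2 * c)\<^sup>2"
  proof -
    have "(sqrt 2 * c)\<^sup>2 = 2 * c\<^sup>2" by (simp add: power_mult_distrib)
    moreover have "0 \<le> (q - c)\<^sup>2" by simp
    ultimately show ?thesis using assms(1) by (simp add: power2_eq_square algebra_simps)
  qed
  then have "p - c \<le> sqrt 2 * c" by (rule power2_le_imp_le) (simp add: assms)
  then show ?thesis by (simp add: algebra_simps)
qed

text \<open>Foucart and Lai: a restricted isometry with constant ratio \<open>\<beta> / \<alpha>\<close> close to one forces the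
  null space property. The coordinates outside \<open>S\<close> are sorted into blocks of decreasing size; the
  first block \<open>T\<close> is grouped with \<open>S\<close>.\<close>

lemma rip_imp_null_space_property:
  fixes a :: "'i \<Rightarrow> 'j \<Rightarrow> real"
  assumes rip: "rip_bounds \<alpha> \<beta> (2 * k) I V a" and ab: "0 < \<alpha>" "\<alpha> \<le> \<beta>"
    and ratio: "(1 + sqrt 2) / 4 * (\<beta> / \<alpha> - 1) < 1"
    and V: "finite V" "S \<subseteq> V" "card S \<le> k" and ker: "\<And>i. i \<in> I \<Longrightarrow> (\<Sum>j\<in>V. a i j * x j) = 0"
    and nz: "\<exists>j\<in>V. x j \<noteq> 0"
  shows "(\<Sum>j\<in>S. \<bar>x j\<bar>) < (\<Sum>j\<in>V - S. \<bar>x j\<bar>)"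
proof (cases "k = 0")
  case True
  then have S: "S = {}" using V finite_subset[OF V(2,1)] by auto
  obtain j where "j \<in> V" "x j \<noteq> 0" using nz by auto
  then have "0 < (\<Sum>j\<in>V. \<bar>x j\<bar>)" using V(1) by (intro sum_pos2[of _ j]) auto
  then show ?thesis using S by simp
next
  case False
  then have k: "0 < k" by simp
  have finS: "finite S" using V by (auto intro: finite_subset)
  define \<Sigma> where "\<Sigma> = (\<Sum>j\<in>V - S. \<bar>x j\<bar>) / sqrt (real k)"
  define b where "b = (\<beta> - \<alpha>) / 2"
  have b0: "0 \<le> b" using ab by (simp add: b_def)
  \<comment> \<open>If at most \<open>k\<close> coordinates lie outside \<open>S\<close>, all of
    them go into \<open>T\<close> and the tail is empty. Otherwise the mean of the largest block
    serves as \<open>M\<close> in the tail bound, whose two summands then add up to \<Sigma>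
    exactly.\<close>
  have "\<exists>T\<subseteq>V - S. card T \<le> k \<and> (\<forall>U\<subseteq>V. card U \<le> k \<longrightarrow> U \<inter> (V - S - T) = {} \<longrightarrow>
     \<bar>\<Sum>i\<in>I. (\<Sum>j\<in>U. a i j * x j) * (\<Sum>j\<in>V - S - T. a i j * x j)\<bar> \<le> b * L2_set x U * \<Sigma>)"
  proof (cases "card (V - S) \<le> k")
    case True
    have "0 \<le> \<Sigma>" by (simp add: \<Sigma>_def sum_nonneg)
    then show ?thesis using True b0 by (intro exI[of _ "V - S"]) auto
  next
    case False
    have finC: "finite (V - S)" using V by auto
    obtain T where T: "T \<subseteq> V - S" "card T = k" "\<And>i j. i \<in> T \<Longrightarrow> j \<in> V - S - T \<Longrightarrow> \<bar>x j\<bar> \<le> \<bar>x i\<bar>"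
      using False ex_largest_subset[OF finC, of k "\<lambda>j. \<bar>x j\<bar>"] by auto
    define m where "m = (\<Sum>j\<in>T. \<bar>x j\<bar>) / real k"
    have m: "\<bar>x j\<bar> \<le> m" if "j \<in> V - S - T" for j
    proof -
      have "real (card T) * \<bar>x j\<bar> \<le> (\<Sum>i\<in>T. \<bar>x i\<bar>)" using T(3) that by (intro sum_bounded_below) auto
      then show ?thesis using T(2) k by (simp add: m_def field_simps)
    qed
    have m0: "0 \<le> m" by (simp add: m_def sum_nonneg)
    have "(\<Sum>j\<in>V - S. \<bar>x j\<bar>) = (\<Sum>j\<in>T. \<bar>x j\<bar>) + (\<Sum>j\<in>V - S - T. \<bar>x j\<bar>)"
      using T finC by (simp add: add.commute sum.subset_diff)
    then have \<Sigma>: "sqrt (real k) * m + (\<Sum>j\<in>V - S - T. \<bar>x j\<bar>) / sqrt (real k) = \<Sigma>"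
      using k by (simp add: m_def \<Sigma>_def field_simps)
    show ?thesis
    proof (intro exI[of _ T] conjI allI impI)
      fix U assume U: "U \<subseteq> V" "card U \<le> k" "U \<inter> (V - S - T) = {}"
      show "\<bar>\<Sum>i\<in>I. (\<Sum>j\<in>U. a i j * x j) * (\<Sum>j\<in>V - S - T. a i j * x j)\<bar> \<le> b * L2_set x U * \<Sigma>"
      proof -
        have "V - S - T \<subseteq> V" by auto
        from rip_tail_bound[where x = x and M = m, OF rip ab(2) k V(1) U(1) U(2) this U(3) m m0]
        show ?thesis unfolding \<Sigma> b_def by simp
      qed
    qed (use T in auto)
  qed
  then obtain T where TT: "T \<subseteq> V - S \<and> card T \<le> k \<and> (\<forall>U\<subseteq>V. card U \<le> k \<longrightarrow> U \<inter> (V - S - T) = {} \<longrightarrow>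
     \<bar>\<Sum>i\<in>I. (\<Sum>j\<in>U. a i j * x j) * (\<Sum>j\<in>V - S - T. a i j * x j)\<bar> \<le> b * L2_set x U * \<Sigma>)"
    by (rule exE)
  then have T: "T \<subseteq> V - S" "card T \<le> k" by simp_all
  have tail: "\<bar>\<Sum>i\<in>I. (\<Sum>j\<in>U. a i j * x j) * (\<Sum>j\<in>V - S - T. a i j * x j)\<bar> \<le> b * L2_set x U * \<Sigma>"
    if "U \<subseteq> V" "card U \<le> k" "U \<inter> (V - S - T) = {}" for U
    using TT that by simp
  have finT: "finite T" using T V by (auto intro: finite_subset)
  define p where "p = L2_set x S"
  define q where "q = L2_set x T"
  define s where "s U i = (\<Sum>j\<in>U. a i j * x j)" for U i
  have psq: "(\<Sum>j\<in>S \<union> T. (x j)\<^sup>2) = p\<^sup>2 + q\<^sup>2"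
    using finS finT T by (subst sum.union_disjoint) (auto simp: p_def q_def L2_set_def sum_nonneg)
  have ST: "s (S \<union> T) i = s S i + s T i" for i
    using finS finT T unfolding s_def by (subst sum.union_disjoint) auto
  have zero: "s (S \<union> T) i + s (V - S - T) i = 0" if "i \<in> I" for i
  proof -
    have "s (S \<union> T) i + s (V - S - T) i = (\<Sum>j\<in>(S \<union> T) \<union> (V - S - T). a i j * x j)"
      unfolding s_def using finS finT V by (subst sum.union_disjoint[symmetric]) auto
    also have "(S \<union> T) \<union> (V - S - T) = V" using V T by auto
    finally show ?thesis using ker[OF that] by simp
  qed
  \<comment> \<open>On a kernel vector the image of \<open>S \<union> T\<close> is minus that of the
    tail. Replacing one factor of its squared length accordingly leaves two inner products with the
    tail, one for \<open>S\<close> and one for \<open>T\<close>.\<close>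
  have "\<alpha> * (p\<^sup>2 + q\<^sup>2) \<le> (\<Sum>i\<in>I. (s (S \<union> T) i)\<^sup>2)"
  proof -
    have "card (S \<union> T) \<le> 2 * k" using card_Un_le[of S T] V T by linarith
    moreover have "S \<union> T \<subseteq> V" using T V by auto
    ultimately show ?thesis using rip[unfolded rip_bounds_def, rule_format, of "S \<union> T" x] unfolding psq s_def by auto
  qed
  also have "\<dots> = (\<Sum>i\<in>I. - (s S i * s (V - S - T) i) + - (s T i * s (V - S - T) i))"
  proof (intro sum.cong refl)
    fix i assume i: "i \<in> I"
    have r: "s (V - S - T) i = - (s S i + s T i)" using zero[OF i] ST[of i] by linarith
    show "(s (S \<union> T) i)\<^sup>2 = - (s S i * s (V - S - T) i) + - (s T i * s (V - S - T) i)"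
      unfolding ST r power2_eq_square by (simp add: algebra_simps)
  qed
  also have "\<dots> = - (\<Sum>i\<in>I. s S i * s (V - S - T) i) - (\<Sum>i\<in>I. s T i * s (V - S - T) i)"
    by (simp add: sum.distrib sum_negf sum_subtractf)
  also have "\<dots> \<le> b * p * \<Sigma> + b * q * \<Sigma>"
  proof -
    have "T \<subseteq> V" "S \<inter> (V - S - T) = {}" "T \<inter> (V - S - T) = {}" using T by auto
    then show ?thesis using tail[of S] tail[of T] V T unfolding p_def q_def s_def by linarith
  qed
  finally have "\<alpha> * (p\<^sup>2 + q\<^sup>2) \<le> b * \<Sigma> * (p + q)" by (simp add: algebra_simps)
  then have "p\<^sup>2 + q\<^sup>2 \<le> 2 * (b * \<Sigma> / (2 * \<alpha>)) * (p + q)" using ab by (simp add: field_simps)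
  moreover have "0 \<le> b * \<Sigma> / (2 * \<alpha>)" using b0 ab by (simp add: \<Sigma>_def sum_nonneg)
  ultimately have "p \<le> (1 + sqrt 2) * (b * \<Sigma> / (2 * \<alpha>))" by (rule two_squares_le_linear)
  also have "\<dots> = (1 + sqrt 2) / 4 * (\<beta> / \<alpha> - 1) * \<Sigma>" using ab by (simp add: b_def field_simps)
  finally have p: "p \<le> (1 + sqrt 2) / 4 * (\<beta> / \<alpha> - 1) * \<Sigma>" .
  have "(\<Sum>j\<in>S. \<bar>x j\<bar>) \<le> sqrt (real (card S)) * p" unfolding p_def by (rule l1_le_sqrt_card_L2)
  also have "\<dots> \<le> sqrt (real k) * p" using V by (intro mult_right_mono) (auto simp: p_def)
  also have "\<dots> \<le> sqrt (real k) * ((1 + sqrt 2) / 4 * (\<beta> / \<alpha> - 1) * \<Sigma>)" using p by (intro mult_left_mono) auto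
  also have "\<dots> = (1 + sqrt 2) / 4 * (\<beta> / \<alpha> - 1) * (\<Sum>j\<in>V - S. \<bar>x j\<bar>)" using k by (simp add: \<Sigma>_def)
  finally have le: "(\<Sum>j\<in>S. \<bar>x j\<bar>) \<le> (1 + sqrt 2) / 4 * (\<beta> / \<alpha> - 1) * (\<Sum>j\<in>V - S. \<bar>x j\<bar>)" .
  have "(\<Sum>j\<in>V - S. \<bar>x j\<bar>) > 0"
  proof (rule ccontr)
    assume "\<not> ?thesis"
    moreover have "(\<Sum>j\<in>V - S. \<bar>x j\<bar>) \<ge> 0" by (simp add: sum_nonneg)
    ultimately have z: "(\<Sum>j\<in>V - S. \<bar>x j\<bar>) = 0" by linarith
    then have "(\<Sum>j\<in>S. \<bar>x j\<bar>) \<le> 0" using le by simp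
    moreover have "0 \<le> (\<Sum>j\<in>S. \<bar>x j\<bar>)" by (simp add: sum_nonneg)
    ultimately have "(\<Sum>j\<in>S. \<bar>x j\<bar>) = 0" by linarith
    then have "\<forall>j\<in>V. x j = 0" using z finS V by (auto simp: sum_nonneg_eq_0_iff)
    then show False using nz by auto
  qed
  from mult_strict_right_mono[OF ratio this] le show ?thesis by simp
qed

section \<open>Rotation invariance of the Gaussian measure\<close>

definition std_gauss :: "real measure" where
  "std_gauss = density lborel (\<lambda>x. ennreal (std_normal_density x))"

definition gauss :: "'i set \<Rightarrow> ('i \<Rightarrow> real) measure" where
  "gauss J = Pi\<^sub>M J (\<lambda>_. std_gauss)"

lemma sets_std_gauss [measurable_cong, simp]: "sets std_gauss = sets borel"
  by (simp add: std_gauss_def)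

lemma space_std_gauss [simp]: "space std_gauss = UNIV"
  by (simp add: std_gauss_def)

interpretation std_gauss: prob_space std_gauss
  unfolding std_gauss_def by (rule prob_space_normal_density) simp

interpretation gauss_prod: product_prob_space "\<lambda>_. std_gauss" J for J :: "'i set"
  by unfold_locales

lemma prob_space_gauss: "prob_space (gauss J)"
  unfolding gauss_def by (rule prob_space_PiM) unfold_locales

lemma emeasure_space_gauss [simp]: "emeasure (gauss J) (space (gauss J)) = 1"
  by (rule prob_space.emeasure_space_1[OF prob_space_gauss])

lemma sets_gauss: "sets (gauss J) = sets (Pi\<^sub>M J (\<lambda>_. borel))"
  unfolding gauss_def by (rule sets_PiM_cong) auto

lemma space_gauss: "space (gauss J) = J \<rightarrow>\<^sub>E UNIV"
  by (simp add: gauss_def space_PiM)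

lemma nn_integral_gauss_insert:
  assumes "finite J" "i \<notin> J" "f \<in> borel_measurable (gauss (insert i J))"
  shows "(\<integral>\<^sup>+x. f x \<partial>gauss (insert i J)) = (\<integral>\<^sup>+z. (\<integral>\<^sup>+y. f (z(i := y)) \<partial>std_gauss) \<partial>gauss J)"
  using assms unfolding gauss_def by (intro gauss_prod.product_nn_integral_insert) auto

lemma nn_integral_std_gauss:
  "f \<in> borel_measurable borel \<Longrightarrow>
     (\<integral>\<^sup>+x. f x \<partial>std_gauss) = (\<integral>\<^sup>+x. ennreal (std_normal_density x) * f x \<partial>lborel)"
  unfolding std_gauss_def by (rule nn_integral_density) auto

lemma nn_integral_shear1:
  fixes F :: "real \<times> real \<Rightarrow> ennreal"
  assumes [measurable]: "F \<in> borel_measurable borel"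
  shows "(\<integral>\<^sup>+x. \<integral>\<^sup>+y. F (x + t * y, y) \<partial>lborel \<partial>lborel) = (\<integral>\<^sup>+x. \<integral>\<^sup>+y. F (x, y) \<partial>lborel \<partial>lborel)"
proof -
  have [measurable]: "F \<in> borel_measurable (borel \<Otimes>\<^sub>M borel)" using assms by (simp add: borel_prod)
  have "(\<integral>\<^sup>+x. \<integral>\<^sup>+y. F (x + t * y, y) \<partial>lborel \<partial>lborel) = (\<integral>\<^sup>+y. \<integral>\<^sup>+x. F (x + t * y, y) \<partial>lborel \<partial>lborel)"
    by (rule lborel_pair.Fubini'[symmetric]) measurable
  also have "\<dots> = (\<integral>\<^sup>+y. \<integral>\<^sup>+x. F (x, y) \<partial>lborel \<partial>lborel)"
  proof (rule nn_integral_cong)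
    fix y :: real
    show "(\<integral>\<^sup>+x. F (x + t * y, y) \<partial>lborel) = (\<integral>\<^sup>+x. F (x, y) \<partial>lborel)"
      using nn_integral_real_affine[of "\<lambda>x. F (x, y)" 1 "t * y"] by (simp add: add.commute)
  qed
  also have "\<dots> = (\<integral>\<^sup>+x. \<integral>\<^sup>+y. F (x, y) \<partial>lborel \<partial>lborel)"
    by (rule lborel_pair.Fubini') measurable
  finally show ?thesis .
qed

lemma nn_integral_shear2:
  fixes F :: "real \<times> real \<Rightarrow> ennreal"
  assumes [measurable]: "F \<in> borel_measurable borel"
  shows "(\<integral>\<^sup>+x. \<integral>\<^sup>+y. F (x, y + t * x) \<partial>lborel \<partial>lborel) = (\<integral>\<^sup>+x. \<integral>\<^sup>+y. F (x, y) \<partial>lborel \<partial>lborel)"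
proof (rule nn_integral_cong)
  fix x :: real
  have [measurable]: "F \<in> borel_measurable (borel \<Otimes>\<^sub>M borel)" using assms by (simp add: borel_prod)
  show "(\<integral>\<^sup>+y. F (x, y + t * x) \<partial>lborel) = (\<integral>\<^sup>+y. F (x, y) \<partial>lborel)"
    using nn_integral_real_affine[of "\<lambda>y. F (x, y)" 1 "t * x"] by (simp add: add.commute)
qed

text \<open>A plane rotation by an angle that is not a multiple of \<open>\<pi>\<close> is a product of three shears, each
  of which preserves Lebesgue measure by translation invariance.\<close>

lemma nn_integral_lborel_rotation:
  fixes F :: "real \<times> real \<Rightarrow> ennreal"
  assumes F [measurable]: "F \<in> borel_measurable borel" and cs: "c\<^sup>2 + s\<^sup>2 = 1" "s \<noteq> 0"
  shows "(\<integral>\<^sup>+x. \<integral>\<^sup>+y. F (c * x + s * y, - s * x + c * y) \<partial>lborel \<partial>lborel)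
         = (\<integral>\<^sup>+x. \<integral>\<^sup>+y. F (x, y) \<partial>lborel \<partial>lborel)"
proof -
  \<comment> \<open>For \<open>c = cos a\<close> and \<open>s = sin a\<close> this is
    \<open>tan (a / 2)\<close>: the rotation is a shear by \<open>t\<close>, a shear by
    \<open>- s\<close> in the other direction, and again the shear by \<open>t\<close>.\<close>
  define t where "t = (1 - c) / s"
  define S where "S = (\<lambda>(x :: real, y). (x + t * y, y))"
  define S' where "S' = (\<lambda>(x :: real, y). (x, y + (-s) * x))"
  have ts: "t * s = 1 - c" using cs by (simp add: t_def)
  have "t * (1 + c) = s" using cs by (simp add: t_def field_simps power2_eq_square)
  then have tc: "t + t * c = s" by (simp add: algebra_simps)
  have eq: "S (S' (S (x, y))) = (c * x + s * y, - s * x + c * y)" for x y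
  proof -
    have 1: "y + - s * (x + t * y) = - s * x + c * y"
    proof -
      have "y + - s * (x + t * y) = - s * x + (1 - t * s) * y" by (simp add: algebra_simps)
      then show ?thesis unfolding ts by simp
    qed
    have "x + t * y + t * (- s * x + c * y) = (1 - t * s) * x + (t + t * c) * y" by (simp add: algebra_simps)
    then have "x + t * y + t * (- s * x + c * y) = c * x + s * y" unfolding ts tc by simp
    with 1 show ?thesis by (simp add: S_def S'_def)
  qed
  have contS: "continuous_on UNIV S" "continuous_on UNIV S'"
    unfolding S_def S'_def case_prod_unfold by (intro continuous_intros)+
  note [measurable] = borel_measurable_continuous_onI[OF contS(1)] borel_measurable_continuous_onI[OF contS(2)]
  have S_eq: "S (x, y) = (x + t * y, y)" "S' (x, y) = (x, y + (-s) * x)" for x y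
    by (simp_all add: S_def S'_def)
  have meas: "(\<lambda>p. F (S (S' p))) \<in> borel_measurable borel" "(\<lambda>p. F (S p)) \<in> borel_measurable borel"
    by measurable
  have "(\<integral>\<^sup>+x. \<integral>\<^sup>+y. F (S (S' (S (x, y)))) \<partial>lborel \<partial>lborel) = (\<integral>\<^sup>+x. \<integral>\<^sup>+y. F (S (S' (x, y))) \<partial>lborel \<partial>lborel)"
    unfolding S_eq(1) by (rule nn_integral_shear1[OF meas(1)])
  also have "\<dots> = (\<integral>\<^sup>+x. \<integral>\<^sup>+y. F (S (x, y)) \<partial>lborel \<partial>lborel)"
    unfolding S_eq(2) by (rule nn_integral_shear2[OF meas(2)])
  also have "\<dots> = (\<integral>\<^sup>+x. \<integral>\<^sup>+y. F (x, y) \<partial>lborel \<partial>lborel)"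
    unfolding S_eq(1) by (rule nn_integral_shear1[OF F])
  finally show ?thesis by (simp add: eq)
qed

lemma std_normal_density_prod:
  "std_normal_density x * std_normal_density y = exp (- (x\<^sup>2 + y\<^sup>2) / 2) / (2 * pi)"
  by (simp add: std_normal_density_def exp_add[symmetric] add_divide_distrib)

lemma nn_integral_std_gauss_rotation:
  fixes f :: "real \<times> real \<Rightarrow> ennreal"
  assumes f [measurable]: "f \<in> borel_measurable borel" and cs: "c\<^sup>2 + s\<^sup>2 = 1" "s \<noteq> 0"
  shows "(\<integral>\<^sup>+x. \<integral>\<^sup>+y. f (c * x + s * y, - s * x + c * y) \<partial>std_gauss \<partial>std_gauss)
         = (\<integral>\<^sup>+x. \<integral>\<^sup>+y. f (x, y) \<partial>std_gauss \<partial>std_gauss)"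
proof -
  have [measurable]: "f \<in> borel_measurable (borel \<Otimes>\<^sub>M borel)" using f by (simp add: borel_prod)
  define F where "F = (\<lambda>p. ennreal (exp (- ((fst p)\<^sup>2 + (snd p)\<^sup>2) / 2) / (2 * pi)) * f p)"
  have F [measurable]: "F \<in> borel_measurable borel"
  proof -
    have "continuous_on UNIV (\<lambda>p :: real \<times> real. exp (- ((fst p)\<^sup>2 + (snd p)\<^sup>2) / 2) / (2 * pi))"
      by (intro continuous_intros) auto
    from measurable_compose[OF borel_measurable_continuous_onI[OF this] measurable_ennreal] f
    show ?thesis unfolding F_def by (rule borel_measurable_times_ennreal)
  qed
  have eq: "(\<integral>\<^sup>+x. \<integral>\<^sup>+y. g (x, y) \<partial>std_gauss \<partial>std_gauss)
      = (\<integral>\<^sup>+x. \<integral>\<^sup>+y. ennreal (exp (- (x\<^sup>2 + y\<^sup>2) / 2) / (2 * pi)) * g (x, y) \<partial>lborel \<partial>lborel)"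
    if [measurable]: "g \<in> borel_measurable (borel \<Otimes>\<^sub>M borel)" for g :: "real \<times> real \<Rightarrow> ennreal"
    by (simp add: nn_integral_std_gauss nn_integral_cmult[symmetric] mult.assoc[symmetric]
         ennreal_mult[symmetric] std_normal_density_prod)
  have sq: "(c * x + s * y)\<^sup>2 + (- s * x + c * y)\<^sup>2 = x\<^sup>2 + y\<^sup>2" for x y
  proof -
    have "(c * x + s * y)\<^sup>2 + (- s * x + c * y)\<^sup>2 = (c\<^sup>2 + s\<^sup>2) * (x\<^sup>2 + y\<^sup>2)"
      by (simp add: power2_eq_square algebra_simps)
    then show ?thesis using cs by simp
  qed
  have "(\<integral>\<^sup>+x. \<integral>\<^sup>+y. f (c * x + s * y, - s * x + c * y) \<partial>std_gauss \<partial>std_gauss)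
     = (\<integral>\<^sup>+x. \<integral>\<^sup>+y. F (c * x + s * y, - s * x + c * y) \<partial>lborel \<partial>lborel)"
  proof -
    have "(\<lambda>(x, y). f (c * x + s * y, - s * x + c * y)) \<in> borel_measurable (borel \<Otimes>\<^sub>M borel)"
      by measurable
    from eq[OF this] show ?thesis by (simp only: F_def fst_conv snd_conv sq prod.case)
  qed
  also have "\<dots> = (\<integral>\<^sup>+x. \<integral>\<^sup>+y. F (x, y) \<partial>lborel \<partial>lborel)"
    by (rule nn_integral_lborel_rotation[OF F cs])
  also have "\<dots> = (\<integral>\<^sup>+x. \<integral>\<^sup>+y. f (x, y) \<partial>std_gauss \<partial>std_gauss)"
    by (simp add: eq F_def)
  finally show ?thesis .
qed

definition rot :: "'i \<Rightarrow> 'i \<Rightarrow> real \<Rightarrow> real \<Rightarrow> ('i \<Rightarrow> real) \<Rightarrow> 'i \<Rightarrow> real" where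
  "rot i j c s x = x(i := c * x i + s * x j, j := - s * x i + c * x j)"

lemma measurable_rot [measurable]:
  assumes "i \<in> J" "j \<in> J"
  shows "rot i j c s \<in> measurable (gauss J) (gauss J)"
proof -
  have "rot i j c s \<in> measurable (Pi\<^sub>M J (\<lambda>_. borel)) (Pi\<^sub>M J (\<lambda>_. borel))"
  proof (rule measurable_PiM_single')
    fix a assume a: "a \<in> J"
    have [measurable]: "(\<lambda>x. x i) \<in> borel_measurable (Pi\<^sub>M J (\<lambda>_. borel :: real measure))"
      "(\<lambda>x. x j) \<in> borel_measurable (Pi\<^sub>M J (\<lambda>_. borel :: real measure))"
      "(\<lambda>x. x a) \<in> borel_measurable (Pi\<^sub>M J (\<lambda>_. borel :: real measure))"
      using assms a by measurable
    show "(\<lambda>x. rot i j c s x a) \<in> borel_measurable (Pi\<^sub>M J (\<lambda>_. borel))"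
      unfolding rot_def fun_upd_def by (cases "a = j"; cases "a = i") simp_all
  qed (use assms in \<open>auto simp: space_PiM rot_def PiE_def extensional_def\<close>)
  then show ?thesis by (simp add: measurable_cong_sets[OF sets_gauss sets_gauss])
qed

lemma nn_integral_gauss_rot:
  assumes J: "finite J" "i \<in> J" "j \<in> J" "i \<noteq> j" and cs: "c\<^sup>2 + s\<^sup>2 = 1" "s \<noteq> 0"
    and f: "f \<in> borel_measurable (gauss J)"
  shows "(\<integral>\<^sup>+x. f (rot i j c s x) \<partial>gauss J) = (\<integral>\<^sup>+x. f x \<partial>gauss J)"
proof -
  define J' where "J' = J - {i, j}"
  have J': "finite J'" "i \<notin> insert j J'" "j \<notin> J'" "J = insert i (insert j J')"
    using J by (auto simp: J'_def)
  have meas: "(\<lambda>z. \<integral>\<^sup>+y. g (z(i := y)) \<partial>std_gauss) \<in> borel_measurable (gauss (insert j J'))"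
    if g: "g \<in> borel_measurable (gauss J)" for g :: "_ \<Rightarrow> ennreal"
  proof -
    have "case_prod (\<lambda>z y. g (z(i := y))) \<in> borel_measurable (gauss (insert j J') \<Otimes>\<^sub>M std_gauss)"
      unfolding case_prod_unfold using g unfolding J'(4) gauss_def by measurable
    then show ?thesis by (rule std_gauss.borel_measurable_nn_integral)
  qed
  have two: "(\<integral>\<^sup>+x. g x \<partial>gauss J) = (\<integral>\<^sup>+z. (\<integral>\<^sup>+y. \<integral>\<^sup>+x. g (z(j := y, i := x)) \<partial>std_gauss \<partial>std_gauss) \<partial>gauss J')"
    if g: "g \<in> borel_measurable (gauss J)" for g :: "_ \<Rightarrow> ennreal"
    unfolding J'(4)
    apply (subst nn_integral_gauss_insert)
    using J' g meas[OF g] apply (auto simp del: fun_upd_apply)[3]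
    apply (subst nn_integral_gauss_insert)
    using J' g meas[OF g] by (auto simp del: fun_upd_apply)
  have fr: "(\<lambda>x. f (rot i j c s x)) \<in> borel_measurable (gauss J)"
    using measurable_compose[OF measurable_rot f] J by simp
  \<comment> \<open>The coordinate \<open>j\<close> is integrated outermost and so comes first in
    the pair; seen from there the rotation has the opposite angle, whence
    \<open>- s\<close>.\<close>
  have eq: "rot i j c s (z(j := y, i := x)) = z(j := c * y + (- s) * x, i := - (-s) * y + c * x)" for z y x
    using J(4) by (auto simp: rot_def fun_eq_iff)
  show ?thesis unfolding two[OF fr] two[OF f] eq
  proof (rule nn_integral_cong)
    fix z assume z: "z \<in> space (gauss J')"
    have [measurable]: "(\<lambda>p. z(j := fst p, i := snd p)) \<in> measurable (borel \<Otimes>\<^sub>M borel) (gauss J)"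
    proof -
      have "(\<lambda>p. z(j := fst p, i := snd p)) \<in> measurable (borel \<Otimes>\<^sub>M borel) (Pi\<^sub>M J (\<lambda>_. borel))"
        using z unfolding J'(4) space_gauss
      proof (intro measurable_PiM_single')
        fix a assume "a \<in> insert i (insert j J')"
        show "(\<lambda>p. (z(j := fst p, i := snd p)) a) \<in> borel_measurable (borel \<Otimes>\<^sub>M borel)"
          by (cases "a = i"; cases "a = j") simp_all
      qed (auto simp: PiE_def extensional_def)
      then show ?thesis by (simp add: measurable_cong_sets[OF refl sets_gauss])
    qed
    have m: "(\<lambda>p. f (z(j := fst p, i := snd p))) \<in> borel_measurable borel"
      unfolding borel_prod[symmetric] using f by measurable
    have cs': "c\<^sup>2 + (- s)\<^sup>2 = 1" "- s \<noteq> 0" using cs by auto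
    show "(\<integral>\<^sup>+y. \<integral>\<^sup>+x. f (z(j := c * y + (- s) * x, i := - (-s) * y + c * x)) \<partial>std_gauss \<partial>std_gauss)
      = (\<integral>\<^sup>+y. \<integral>\<^sup>+x. f (z(j := y, i := x)) \<partial>std_gauss \<partial>std_gauss)"
      using nn_integral_std_gauss_rotation[OF m cs'] by (simp only: fst_conv snd_conv)
  qed
qed

section \<open>Distance of a Gaussian vector to a subspace\<close>

definition ip :: "'i set \<Rightarrow> ('i \<Rightarrow> real) \<Rightarrow> ('i \<Rightarrow> real) \<Rightarrow> real" where
  "ip J x y = (\<Sum>i\<in>J. x i * y i)"

lemma ip_nonneg: "0 \<le> ip J x x"
  by (simp add: ip_def sum_nonneg)

lemma ip_cong: "(\<And>a. a \<in> J \<Longrightarrow> x a = x' a) \<Longrightarrow> (\<And>a. a \<in> J \<Longrightarrow> y a = y' a) \<Longrightarrow> ip J x y = ip J x' y'"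
  by (simp add: ip_def)

lemma ip_eq_0_iff: "finite J \<Longrightarrow> ip J x x = 0 \<longleftrightarrow> (\<forall>a\<in>J. x a = 0)"
  by (simp add: ip_def sum_nonneg_eq_0_iff)

lemma ip_insert: "finite J \<Longrightarrow> i \<notin> J \<Longrightarrow> ip (insert i J) x y = x i * y i + ip J x y"
  by (simp add: ip_def)

text \<open>Products of plane rotations stand in for the orthogonal group. Linearity, isometry and
  invariance of the Gaussian measure follow by induction, and the set is rich enough to move any
  given vector onto a coordinate axis.\<close>

inductive_set isos :: "'i set \<Rightarrow> (('i \<Rightarrow> real) \<Rightarrow> 'i \<Rightarrow> real) set" for J where
  isos_id: "(\<lambda>x. x) \<in> isos J"
| isos_rot: "T \<in> isos J \<Longrightarrow> i \<in> J \<Longrightarrow> j \<in> J \<Longrightarrow> i \<noteq> j \<Longrightarrow> c\<^sup>2 + s\<^sup>2 = 1 \<Longrightarrow> s \<noteq> 0 \<Longrightarrow>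
     (\<lambda>x. rot i j c s (T x)) \<in> isos J"

lemma isos_linear:
  "T \<in> isos J \<Longrightarrow> T (\<lambda>a. x a + t * y a) = (\<lambda>a. T x a + t * T y a)"
  by (induction rule: isos.induct) (auto simp: rot_def fun_eq_iff algebra_simps)

lemma ip_rot:
  assumes "finite J" "i \<in> J" "j \<in> J" "i \<noteq> j" "c\<^sup>2 + s\<^sup>2 = 1"
  shows "ip J (rot i j c s x) (rot i j c s y) = ip J x y"
proof -
  define J' where "J' = J - {i, j}"
  have J': "finite J'" "i \<notin> insert j J'" "j \<notin> J'" "J = insert i (insert j J')"
    using assms by (auto simp: J'_def)
  have "ip J' (rot i j c s x) (rot i j c s y) = ip J' x y"
    using J' by (intro ip_cong) (auto simp: rot_def)
  moreover have "(c * x i + s * x j) * (c * y i + s * y j) + (- s * x i + c * x j) * (- s * y i + c * y j)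
      = (c\<^sup>2 + s\<^sup>2) * (x i * y i + x j * y j)"
    by (simp add: power2_eq_square algebra_simps)
  ultimately show ?thesis using J' assms by (simp add: ip_insert rot_def)
qed

lemma isos_ip:
  assumes "T \<in> isos J" "finite J"
  shows "ip J (T x) (T y) = ip J x y"
  using assms by (induction rule: isos.induct) (auto simp: ip_rot)

lemma nn_integral_gauss_iso:
  assumes "T \<in> isos J" "finite J" "f \<in> borel_measurable (gauss J)"
  shows "(\<integral>\<^sup>+x. f (T x) \<partial>gauss J) = (\<integral>\<^sup>+x. f x \<partial>gauss J)"
  using assms
proof (induction arbitrary: f rule: isos.induct)
  case (isos_rot T i j c s)
  have m: "(\<lambda>x. f (rot i j c s x)) \<in> borel_measurable (gauss J)"
    by (rule measurable_compose[OF measurable_rot[OF isos_rot(2,3)] isos_rot.prems(2)])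
  show ?case using isos_rot.IH[OF isos_rot.prems(1) m]
      nn_integral_gauss_rot[OF isos_rot.prems(1) isos_rot(2-6) isos_rot.prems(2)] by simp
qed simp

text \<open>Givens rotations: the coordinates other than \<open>i0\<close> are annihilated one after
  the other by a rotation in the plane of \<open>i0\<close> and \<open>j\<close>, and zeros made
  earlier are not disturbed. A coordinate that is already zero is skipped, so the sine of each angle
  is nonzero. The sign of the remaining coordinate is not controlled, hence the square.\<close>

lemma ex_iso_axis:
  assumes "finite J" "i0 \<in> J"
  obtains T where "T \<in> isos J" "\<And>a. a \<in> J \<Longrightarrow> a \<noteq> i0 \<Longrightarrow> T v a = 0" "(T v i0)\<^sup>2 = ip J v v"
proof -
  have "\<exists>T\<in>isos J. \<forall>a\<in>F. T v a = 0" if "F \<subseteq> J - {i0}" for F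
  proof -
    have "finite F" using that assms by (auto intro: finite_subset)
    then show ?thesis using that
    proof (induction F)
      case empty
      show ?case using isos_id by blast
    next
      case (insert j F)
      then obtain T where T: "T \<in> isos J" "\<forall>a\<in>F. T v a = 0" by auto
      show ?case
      proof (cases "T v j = 0")
        case True
        then show ?thesis using T by (intro bexI[of _ T]) auto
      next
        case False
        define r where "r = sqrt ((T v i0)\<^sup>2 + (T v j)\<^sup>2)"
        have r: "r > 0" "r\<^sup>2 = (T v i0)\<^sup>2 + (T v j)\<^sup>2"
          using False by (auto simp: r_def sum_power2_gt_zero_iff)
        define c where "c = T v i0 / r"
        define s where "s = T v j / r"
        have cs: "c\<^sup>2 + s\<^sup>2 = 1" "s \<noteq> 0"
          using r False by (auto simp: c_def s_def power_divide add_divide_distrib[symmetric])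
        have "(\<lambda>x. rot i0 j c s (T x)) \<in> isos J"
          using T cs insert.prems assms by (intro isos_rot) auto
        moreover have "rot i0 j c s (T v) a = 0" if "a \<in> insert j F" for a
          using that T(2) insert.prems by (auto simp: rot_def c_def s_def)
        ultimately show ?thesis by (intro bexI[of _ "\<lambda>x. rot i0 j c s (T x)"]) auto
      qed
    qed
  qed
  from this[of "J - {i0}"] obtain T where T: "T \<in> isos J" "\<And>a. a \<in> J \<Longrightarrow> a \<noteq> i0 \<Longrightarrow> T v a = 0" by auto
  have "ip J v v = ip (insert i0 (J - {i0})) (T v) (T v)"
    using isos_ip[OF T(1) assms(1)] assms(2) by (simp add: insert_absorb)
  also have "\<dots> = (T v i0)\<^sup>2 + ip (J - {i0}) (T v) (T v)"
    using assms by (subst ip_insert) (auto simp: power2_eq_square)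
  also have "ip (J - {i0}) (T v) (T v) = 0" using T by (simp add: ip_def)
  finally show ?thesis using that T by simp
qed

section \<open>Gram-Schmidt distance to a span\<close>

definition pr :: "'i set \<Rightarrow> ('i \<Rightarrow> real) \<Rightarrow> ('i \<Rightarrow> real) \<Rightarrow> 'i \<Rightarrow> real" where
  "pr J b x = (\<lambda>a. x a - ip J b x / ip J b b * b a)"

text \<open>The squared distance from \<open>h\<close> to the span of the vectors \<open>bs\<close>, by Gram-Schmidt elimination.
  A vector \<open>b\<close> that has become zero is skipped, because \<open>pr J b\<close> is then the identity
  (division by zero).\<close>

function dist2 :: "'i set \<Rightarrow> ('i \<Rightarrow> real) list \<Rightarrow> ('i \<Rightarrow> real) \<Rightarrow> real" where
  "dist2 J [] h = ip J h h"
| "dist2 J (b # bs) h = dist2 J (map (pr J b) bs) (pr J b h)"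
  by pat_completeness auto
termination by (relation "Wellfounded.measure (\<lambda>(J, bs, h). length bs)") auto

lemma pr_iso:
  assumes "T \<in> isos J" "finite J"
  shows "pr J (T b) (T x) = T (pr J b x)"
  using isos_linear[OF assms(1), of x "- (ip J b x / ip J b b)" b]
  by (simp add: pr_def isos_ip[OF assms])

lemma dist2_iso:
  assumes "T \<in> isos J" "finite J"
  shows "dist2 J (map T bs) (T h) = dist2 J bs h"
  using assms
proof (induction J bs h rule: dist2.induct)
  case (2 J b bs h)
  have "map (pr J (T b)) (map T bs) = map T (map (pr J b) bs)"
    using pr_iso[OF 2(2,3)] by simp
  then have "dist2 J (map T (b # bs)) (T h) = dist2 J (map T (map (pr J b) bs)) (T (pr J b h))"
    by (simp only: list.map dist2.simps pr_iso[OF 2(2,3)])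
  then show ?case using 2(1)[OF 2(2,3)] by (simp only: dist2.simps)
qed (simp add: isos_ip)

lemma pr_cong:
  "(\<And>a. a \<in> J \<Longrightarrow> b a = b' a) \<Longrightarrow> (\<And>a. a \<in> J \<Longrightarrow> x a = x' a) \<Longrightarrow> a \<in> J \<Longrightarrow> pr J b x a = pr J b' x' a"
  unfolding pr_def using ip_cong[of J b b' b b'] ip_cong[of J b b' x x'] by simp

lemma dist2_cong:
  assumes "list_all2 (\<lambda>b b'. \<forall>a\<in>J. b a = b' a) bs bs'" "\<And>a. a \<in> J \<Longrightarrow> h a = h' a"
  shows "dist2 J bs h = dist2 J bs' h'"
  using assms
proof (induction J bs h arbitrary: bs' h' rule: dist2.induct)
  case (1 J h)
  then show ?case by (auto intro!: ip_cong)
next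
  case (2 J b bs h)
  from 2(2) obtain b' cs where bs': "bs' = b' # cs" "\<forall>a\<in>J. b a = b' a" "list_all2 (\<lambda>b b'. \<forall>a\<in>J. b a = b' a) bs cs"
    by (auto simp: list_all2_Cons1)
  have "list_all2 (\<lambda>b b'. \<forall>a\<in>J. b a = b' a) (map (pr J b) bs) (map (pr J b') cs)"
    unfolding list_all2_map1 list_all2_map2
    using bs'(3) by (rule list_all2_mono) (use bs'(2) in \<open>auto intro!: pr_cong\<close>)
  then show ?case unfolding bs'(1) dist2.simps
    by (rule 2(1)) (use bs'(2) 2(3) in \<open>auto intro!: pr_cong\<close>)
qed

text \<open>Meant for the situation after a rotation: once the first spanning vector lies on the
  axis \<open>i0\<close>, projecting along it clears the coordinate \<open>i0\<close> of all other
  vectors, and the dimension falls by one.\<close>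

lemma dist2_drop:
  assumes "finite J" "i0 \<in> J" "\<And>b. b \<in> set bs \<Longrightarrow> b i0 = 0" "h i0 = 0"
  shows "dist2 J bs h = dist2 (J - {i0}) bs h"
  using assms
proof (induction J bs h rule: dist2.induct)
  case (1 J h)
  then show ?case by (simp add: ip_def sum.remove[of J i0])
next
  case (2 J b bs h)
  have ip: "ip J b x = ip (J - {i0}) b x" for x
    using 2(2-5) by (simp add: ip_def sum.remove[of J i0])
  then have pr: "pr J b = pr (J - {i0}) b" by (simp add: pr_def fun_eq_iff)
  have b0: "b i0 = 0" "\<And>c. c \<in> set bs \<Longrightarrow> c i0 = 0" using 2(4) by auto
  have "dist2 J (map (pr J b) bs) (pr J b h) = dist2 (J - {i0}) (map (pr J b) bs) (pr J b h)"
    using 2(2,3,5) b0 by (intro 2(1)) (auto simp: pr_def)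
  then show ?case by (simp only: dist2.simps pr)
qed

lemma ip_pr_le:
  assumes "finite J"
  shows "ip J (pr J b x) (pr J b x) \<le> ip J (\<lambda>a. x a - t * b a) (\<lambda>a. x a - t * b a)"
proof -
  have ex: "ip J (\<lambda>a. x a - t * b a) (\<lambda>a. x a - t * b a) = ip J x x - 2 * t * ip J b x + t\<^sup>2 * ip J b b" for t
    by (simp add: ip_def sum_distrib_left sum.distrib sum_subtractf algebra_simps power2_eq_square)
  show ?thesis
  proof (cases "ip J b b = 0")
    case True
    then have "\<forall>a\<in>J. b a = 0" using assms by (simp add: ip_eq_0_iff)
    then have "ip J b x = 0" by (simp add: ip_def)
    then show ?thesis unfolding pr_def ex using True by simp
  next
    case False
    have "0 \<le> (t * ip J b b - ip J b x)\<^sup>2 / ip J b b" by (simp add: ip_nonneg)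
    also have "\<dots> = (- 2 * t * ip J b x + t\<^sup>2 * ip J b b) - (- 2 * (ip J b x / ip J b b) * ip J b x + (ip J b x / ip J b b)\<^sup>2 * ip J b b)"
      using False by (simp add: field_simps power2_eq_square)
    finally show ?thesis unfolding pr_def ex by linarith
  qed
qed

text \<open>Projecting along the first vector commutes with forming the residual of a linear
  combination, and the projected residual is no longer than the residual minus any multiple of that
  vector.\<close>

lemma dist2_le:
  assumes "finite J"
  shows "dist2 J (map f js) h \<le> ip J (\<lambda>a. h a - (\<Sum>j\<leftarrow>js. y j * f j a)) (\<lambda>a. h a - (\<Sum>j\<leftarrow>js. y j * f j a))"
proof (induction js arbitrary: f h)
  case (Cons j js)
  define x where "x = (\<lambda>a. h a - (\<Sum>j\<leftarrow>js. y j * f j a))"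
  have lin: "pr J b h a - (\<Sum>j\<leftarrow>js. y j * pr J b (f j) a) = pr J b x a" for b a
  proof -
    have "ip J b x = ip J b h - (\<Sum>j\<leftarrow>js. y j * ip J b (f j))"
      unfolding x_def
    proof (induction js)
      case (Cons j js)
      have "ip J b (\<lambda>a. h a - (\<Sum>j\<leftarrow>j # js. y j * f j a)) = ip J b (\<lambda>a. h a - (\<Sum>j\<leftarrow>js. y j * f j a)) - y j * ip J b (f j)"
        by (simp add: ip_def sum_distrib_left sum.distrib sum_subtractf algebra_simps)
      then show ?case using Cons by simp
    qed simp
    moreover have "(\<Sum>j\<leftarrow>js. y j * (f j a - ip J b (f j) / d * b a)) =
        (\<Sum>j\<leftarrow>js. y j * f j a) - (\<Sum>j\<leftarrow>js. y j * ip J b (f j)) / d * b a" for d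
      by (induction js) (simp_all add: algebra_simps add_divide_distrib)
    ultimately show ?thesis
      by (simp add: pr_def x_def diff_divide_distrib left_diff_distrib)
  qed
  have "dist2 J (map f (j # js)) h = dist2 J (map (\<lambda>j'. pr J (f j) (f j')) js) (pr J (f j) h)"
    by (simp add: comp_def)
  also have "\<dots> \<le> ip J (pr J (f j) x) (pr J (f j) x)"
    using Cons[of "\<lambda>j'. pr J (f j) (f j')" "pr J (f j) h"] unfolding lin .
  also have "\<dots> \<le> ip J (\<lambda>a. x a - y j * f j a) (\<lambda>a. x a - y j * f j a)"
    by (rule ip_pr_le[OF assms])
  finally show ?case by (simp add: x_def algebra_simps)
qed simp

lemma borel_measurable_ip:
  assumes "\<And>a. a \<in> J \<Longrightarrow> (\<lambda>\<omega>. f \<omega> a) \<in> borel_measurable N" "\<And>a. a \<in> J \<Longrightarrow> (\<lambda>\<omega>. g \<omega> a) \<in> borel_measurable N"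
  shows "(\<lambda>\<omega>. ip J (f \<omega>) (g \<omega>)) \<in> borel_measurable N"
  unfolding ip_def using assms by (intro borel_measurable_sum borel_measurable_times) auto

lemma borel_measurable_dist2:
  assumes "\<And>j a. j \<in> set js \<Longrightarrow> a \<in> J \<Longrightarrow> (\<lambda>\<omega>. f j \<omega> a) \<in> borel_measurable N"
    and "\<And>a. a \<in> J \<Longrightarrow> (\<lambda>\<omega>. h \<omega> a) \<in> borel_measurable N"
  shows "(\<lambda>\<omega>. dist2 J (map (\<lambda>j. f j \<omega>) js) (h \<omega>)) \<in> borel_measurable N"
  using assms
proof (induction js arbitrary: f h)
  case Nil
  then show ?case by (auto intro!: borel_measurable_ip)
next
  case (Cons j js)
  have pr: "(\<lambda>\<omega>. pr J (f j \<omega>) (g \<omega>) a) \<in> borel_measurable N"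
    if "\<And>a. a \<in> J \<Longrightarrow> (\<lambda>\<omega>. g \<omega> a) \<in> borel_measurable N" "a \<in> J" for g a
    unfolding pr_def using Cons.prems(1)[of j] that
    by (intro borel_measurable_diff borel_measurable_times borel_measurable_divide borel_measurable_ip) auto
  have "(\<lambda>\<omega>. dist2 J (map (\<lambda>j'. pr J (f j \<omega>) (f j' \<omega>)) js) (pr J (f j \<omega>) (h \<omega>))) \<in> borel_measurable N"
    using Cons.prems by (intro Cons.IH pr) auto
  then show ?case by (simp add: comp_def)
qed

section \<open>Exponential moments of squared lengths and distances\<close>

lemma measurable_gauss_component: "a \<in> J \<Longrightarrow> (\<lambda>x. x a) \<in> borel_measurable (gauss J)"
  unfolding measurable_cong_sets[OF sets_gauss refl] by measurable

text \<open>Multiplying the standard density by \<open>exp (t * y\<^sup>2)\<close> gives \<sigma>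
  times a centred normal density of variance \<open>1 / (1 - 2 * t)\<close>. Negative
  \<open>t\<close> is included and will be used.\<close>

lemma nn_integral_std_gauss_exp_square:
  assumes "t < 1 / 2"
  shows "(\<integral>\<^sup>+y. ennreal (exp (t * y\<^sup>2)) \<partial>std_gauss) = ennreal (1 / sqrt (1 - 2 * t))"
proof -
  define \<sigma> where "\<sigma> = 1 / sqrt (1 - 2 * t)"
  have \<sigma>: "\<sigma> > 0" using assms by (simp add: \<sigma>_def)
  have s2: "\<sigma>\<^sup>2 = 1 / (1 - 2 * t)" using assms by (simp add: \<sigma>_def power_divide)
  have eq: "std_normal_density y * exp (t * y\<^sup>2) = \<sigma> * normal_density 0 \<sigma> y" for y
  proof -
    have "- y\<^sup>2 / 2 + t * y\<^sup>2 = - (y - 0)\<^sup>2 / (2 * \<sigma>\<^sup>2)" unfolding s2 using assms by (simp add: field_simps)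
    then have "exp (- y\<^sup>2 / 2) * exp (t * y\<^sup>2) = exp (- (y - 0)\<^sup>2 / (2 * \<sigma>\<^sup>2))" by (simp only: exp_add[symmetric])
    moreover have "sqrt (2 * pi * \<sigma>\<^sup>2) = sqrt (2 * pi) * \<sigma>" using \<sigma> by (simp add: real_sqrt_mult)
    ultimately show ?thesis using \<sigma> by (simp add: std_normal_density_def normal_density_def)
  qed
  have "(\<integral>\<^sup>+y. ennreal (exp (t * y\<^sup>2)) \<partial>std_gauss) = (\<integral>\<^sup>+y. ennreal (std_normal_density y) * ennreal (exp (t * y\<^sup>2)) \<partial>lborel)"
    by (rule nn_integral_std_gauss) measurable
  also have "\<dots> = (\<integral>\<^sup>+y. ennreal \<sigma> * ennreal (normal_density 0 \<sigma> y) \<partial>lborel)"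
    using \<sigma> by (intro nn_integral_cong) (simp add: ennreal_mult[symmetric] eq)
  also have "\<dots> = ennreal \<sigma> * (\<integral>\<^sup>+y. ennreal (normal_density 0 \<sigma> y) \<partial>lborel)"
    by (rule nn_integral_cmult) measurable
  also have "(\<integral>\<^sup>+y. ennreal (normal_density 0 \<sigma> y) \<partial>lborel) = 1"
    using prob_space.emeasure_space_1[OF prob_space_normal_density[OF \<sigma>, of 0]]
    by (simp add: emeasure_density)
  finally show ?thesis by (simp add: \<sigma>_def)
qed

lemma nn_integral_gauss_insert_times:
  assumes J: "finite J" "i \<notin> J" and f: "f \<in> borel_measurable borel" and g: "g \<in> borel_measurable (gauss J)"
    and eq: "\<And>y z. z \<in> space (gauss J) \<Longrightarrow> F (z(i := y)) = f y * g z" and F: "F \<in> borel_measurable (gauss (insert i J))"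
  shows "(\<integral>\<^sup>+x. F x \<partial>gauss (insert i J)) = (\<integral>\<^sup>+y. f y \<partial>std_gauss) * (\<integral>\<^sup>+z. g z \<partial>gauss J)"
proof -
  have "(\<integral>\<^sup>+x. F x \<partial>gauss (insert i J)) = (\<integral>\<^sup>+z. (\<integral>\<^sup>+y. f y * g z \<partial>std_gauss) \<partial>gauss J)"
    by (subst nn_integral_gauss_insert[OF J F]) (auto intro!: nn_integral_cong simp: eq simp del: fun_upd_apply)
  also have "\<dots> = (\<integral>\<^sup>+z. (\<integral>\<^sup>+y. f y \<partial>std_gauss) * g z \<partial>gauss J)"
    using f by (intro nn_integral_cong nn_integral_multc) simp
  finally show ?thesis using g by (simp add: nn_integral_cmult)
qed

lemma borel_measurable_exp_ip:
  "(\<lambda>h. ennreal (exp (t * ip J h h))) \<in> borel_measurable (gauss J)"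
proof -
  have [measurable]: "(\<lambda>h. ip J h h) \<in> borel_measurable (gauss J)"
    by (intro borel_measurable_ip measurable_gauss_component)
  show ?thesis by measurable
qed

lemma nn_integral_gauss_exp_square:
  assumes "finite J" "t < 1 / 2"
  shows "(\<integral>\<^sup>+h. ennreal (exp (t * ip J h h)) \<partial>gauss J) = ennreal ((1 / sqrt (1 - 2 * t)) ^ card J)"
  using assms(1)
proof (induction J)
  case empty
  then show ?case by (simp add: ip_def)
next
  case (insert i J)
  have eq: "ennreal (exp (t * ip (insert i J) (z(i := y)) (z(i := y)))) = ennreal (exp (t * y\<^sup>2)) * ennreal (exp (t * ip J z z))" for y z
  proof -
    have "ip J (z(i := y)) (z(i := y)) = ip J z z" using insert by (intro ip_cong) auto
    then show ?thesis using insert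
      by (simp add: ip_insert ennreal_mult[symmetric] exp_add[symmetric] algebra_simps power2_eq_square)
  qed
  have "(\<integral>\<^sup>+h. ennreal (exp (t * ip (insert i J) h h)) \<partial>gauss (insert i J)) = ennreal (1 / sqrt (1 - 2 * t)) * ennreal ((1 / sqrt (1 - 2 * t)) ^ card J)"
    unfolding insert.IH[symmetric] nn_integral_std_gauss_exp_square[OF assms(2), symmetric]
    by (rule nn_integral_gauss_insert_times[OF insert(1,2) _ borel_measurable_exp_ip eq borel_measurable_exp_ip]) measurable
  then show ?case using insert assms by (simp add: ennreal_mult[symmetric])
qed

text \<open>Chernoff's estimate for the event that a Gaussian vector is close to a fixed subspace,
  relative to its length. Rotating the first spanning vector to a coordinate axis splits off one
  coordinate.\<close>

lemma nn_integral_gauss_exp_dist2: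
  assumes "finite J" "length bs \<le> card J" "0 < s" "s < 1 / 2" "0 < \<tau>"
  shows "(\<integral>\<^sup>+h. ennreal (exp (s * ip J h h - s * (1 + \<tau>) * dist2 J bs h)) \<partial>gauss J)
    \<le> ennreal ((1 / sqrt (1 - 2 * s)) ^ length bs * (1 / sqrt (1 + 2 * s * \<tau>)) ^ (card J - length bs))"
  using assms(1,2)
proof (induction "length bs" arbitrary: J bs)
  case 0
  \<comment> \<open>Directions in the span carry the weight \<open>s\<close> in the exponent. The
    others carry \<open>s - s * (1 + \<tau>) = - (s * \<tau>)\<close>, and with no spanning vector
    these are all directions.\<close>
  have "exp (s * ip J h h - s * (1 + \<tau>) * dist2 J bs h) = exp ((- (s * \<tau>)) * ip J h h)" for h
    using 0 by (simp add: algebra_simps)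
  moreover have "- (s * \<tau>) < 1 / 2"
  proof -
    have "0 < s * \<tau>" using assms by simp
    then show ?thesis by linarith
  qed
  ultimately show ?case using 0 nn_integral_gauss_exp_square[of J "- (s * \<tau>)"] by (simp add: mult.assoc)
next
  case (Suc k)
  then obtain b cs where bs: "bs = b # cs" "length cs = k" by (cases bs) auto
  have u: "1 \<le> 1 / sqrt (1 - 2 * s)" using assms by simp
  have "1 \<le> 1 + 2 * s * \<tau>" using assms by simp
  from real_sqrt_le_mono[OF this] have "1 \<le> sqrt (1 + 2 * s * \<tau>)" by (simp only: real_sqrt_one)
  moreover have "1 / x \<le> 1 \<and> 0 \<le> 1 / x" if "1 \<le> x" for x :: real using that by simp
  ultimately have w: "1 / sqrt (1 + 2 * s * \<tau>) \<le> 1" "0 \<le> 1 / sqrt (1 + 2 * s * \<tau>)" by blast+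
  have meas: "(\<lambda>h. ennreal (exp (s * ip J h h - s * (1 + \<tau>) * dist2 J' ds h))) \<in> borel_measurable (gauss J)" if "J' \<subseteq> J" for J' J ds
  proof -
    have [measurable]: "(\<lambda>h. ip J h h) \<in> borel_measurable (gauss J)"
      by (intro borel_measurable_ip measurable_gauss_component)
    have "(\<lambda>h. dist2 J' (map (\<lambda>b. b) ds) h) \<in> borel_measurable (gauss J)"
      by (rule borel_measurable_dist2[where f = "\<lambda>b h. b" and h = "\<lambda>h. h"])
        (use that in \<open>auto intro: measurable_gauss_component\<close>)
    then have [measurable]: "(\<lambda>h. dist2 J' ds h) \<in> borel_measurable (gauss J)" by (simp only: list.map_ident)
    show ?thesis by measurable
  qed
  show ?case
  proof (cases "ip J b b = 0")
    case True
    have "pr J b x = x" for x using True by (simp add: pr_def)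
    then have "map (pr J b) cs = cs" "pr J b h = h" for h by (simp_all add: map_idI)
    then have d: "dist2 J bs h = dist2 J cs h" for h by (simp add: bs)
    have "(\<integral>\<^sup>+h. ennreal (exp (s * ip J h h - s * (1 + \<tau>) * dist2 J bs h)) \<partial>gauss J)
       \<le> ennreal ((1 / sqrt (1 - 2 * s)) ^ k * (1 / sqrt (1 + 2 * s * \<tau>)) ^ (card J - k))"
      unfolding d using Suc.hyps(1)[of cs J] bs Suc.prems by simp
    \<comment> \<open>The bound for one vector fewer is the smaller one, since the first base is at
      least 1 and the second at most 1.\<close>
    also have "\<dots> \<le> ennreal ((1 / sqrt (1 - 2 * s)) ^ length bs * (1 / sqrt (1 + 2 * s * \<tau>)) ^ (card J - length bs))"
    proof (intro ennreal_leI mult_mono)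
      show "(1 / sqrt (1 - 2 * s)) ^ k \<le> (1 / sqrt (1 - 2 * s)) ^ length bs"
        using u bs by (intro power_increasing) auto
      show "(1 / sqrt (1 + 2 * s * \<tau>)) ^ (card J - k) \<le> (1 / sqrt (1 + 2 * s * \<tau>)) ^ (card J - length bs)"
        using w bs by (intro power_decreasing) auto
    qed (rule zero_le_power, use u in linarith, rule zero_le_power, rule w(2))
    finally show ?thesis .
  next
    case False
    then obtain i0 where i0: "i0 \<in> J" using Suc.prems(1) by (auto simp: ip_eq_0_iff)
    define J' where "J' = J - {i0}"
    have J': "finite J'" "i0 \<notin> J'" "J = insert i0 J'" using i0 Suc.prems by (auto simp: J'_def)
    obtain T where T: "T \<in> isos J" "\<And>a. a \<in> J \<Longrightarrow> a \<noteq> i0 \<Longrightarrow> T b a = 0" "(T b i0)\<^sup>2 = ip J b b"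
      using ex_iso_axis[OF Suc.prems(1) i0, of b] by metis
    define v where "v = T b"
    define ds where "ds = map (pr J v) (map T cs)"
    have v0: "v i0 \<noteq> 0" using T(3) False by (auto simp: v_def)
    have ipv: "ip J v x = v i0 * x i0" for x
    proof -
      have "ip J v x = v i0 * x i0 + ip J' v x"
        using ip_insert[OF J'(1,2), of v x] by (simp only: J'(3)[symmetric])
      also have "ip J' v x = 0"
      proof -
        have "v a = 0" if "a \<in> J'" for a using T(2)[of a] that J' by (auto simp: v_def)
        then show ?thesis by (simp add: ip_def)
      qed
      finally show ?thesis by simp
    qed
    have prv: "pr J v x i0 = 0" "a \<in> J' \<Longrightarrow> pr J v x a = x a" for x a
    proof -
      show "pr J v x i0 = 0" using v0 by (simp add: pr_def ipv)
      show "pr J v x a = x a" if "a \<in> J'" using that T(2)[of a] J' by (auto simp: pr_def v_def)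
    qed
    have d: "dist2 J bs h = dist2 J' ds (T h)" for h
    proof -
      have "dist2 J bs h = dist2 J (map T bs) (T h)" by (simp add: dist2_iso[OF T(1) Suc.prems(1)])
      also have "\<dots> = dist2 J ds (pr J v (T h))" by (simp add: bs ds_def v_def)
      also have "\<dots> = dist2 J' ds (pr J v (T h))"
        unfolding J'_def by (rule dist2_drop[OF Suc.prems(1) i0]) (auto simp: ds_def prv(1))
      also have "\<dots> = dist2 J' ds (T h)"
        by (rule dist2_cong) (auto simp: prv list_all2_refl)
      finally show ?thesis .
    qed
    have [simp]: "length ds = k" by (simp add: ds_def bs)
    have "(\<integral>\<^sup>+h. ennreal (exp (s * ip J h h - s * (1 + \<tau>) * dist2 J bs h)) \<partial>gauss J)
      = (\<integral>\<^sup>+h. ennreal (exp (s * ip J (T h) (T h) - s * (1 + \<tau>) * dist2 J' ds (T h))) \<partial>gauss J)"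
      by (simp only: d isos_ip[OF T(1) Suc.prems(1)])
    also have "\<dots> = (\<integral>\<^sup>+h. ennreal (exp (s * ip J h h - s * (1 + \<tau>) * dist2 J' ds h)) \<partial>gauss J)"
      by (rule nn_integral_gauss_iso[OF T(1) Suc.prems(1)]) (rule meas, auto simp: J'_def)
    also have "\<dots> = ennreal (1 / sqrt (1 - 2 * s)) * (\<integral>\<^sup>+z. ennreal (exp (s * ip J' z z - s * (1 + \<tau>) * dist2 J' ds z)) \<partial>gauss J')"
      unfolding nn_integral_std_gauss_exp_square[OF assms(4), symmetric] J'(3)
    proof (rule nn_integral_gauss_insert_times[OF J'(1,2)])
      fix y :: real and z assume "z \<in> space (gauss J')"
      have "ip J' (z(i0 := y)) (z(i0 := y)) = ip J' z z" using J' by (intro ip_cong) auto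
      moreover have "dist2 J' ds (z(i0 := y)) = dist2 J' ds z"
        using J' by (intro dist2_cong) (auto simp: list_all2_refl)
      ultimately show "ennreal (exp (s * ip (insert i0 J') (z(i0 := y)) (z(i0 := y)) - s * (1 + \<tau>) * dist2 J' ds (z(i0 := y))))
        = ennreal (exp (s * y\<^sup>2)) * ennreal (exp (s * ip J' z z - s * (1 + \<tau>) * dist2 J' ds z))"
        using J' by (simp add: ip_insert ennreal_mult[symmetric] exp_add[symmetric] algebra_simps power2_eq_square)
    next
      show "(\<lambda>y. ennreal (exp (s * y\<^sup>2))) \<in> borel_measurable borel" by measurable
    qed (rule meas[OF subset_refl], rule meas[OF subset_insertI])
    also have "\<dots> \<le> ennreal (1 / sqrt (1 - 2 * s)) * ennreal ((1 / sqrt (1 - 2 * s)) ^ k * (1 / sqrt (1 + 2 * s * \<tau>)) ^ (card J' - k))"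
      using Suc.hyps(1)[of ds J'] J' Suc.prems(2) bs by (intro mult_left_mono) auto
    also have "\<dots> = ennreal ((1 / sqrt (1 - 2 * s)) ^ length bs * (1 / sqrt (1 + 2 * s * \<tau>)) ^ (card J - length bs))"
      using J' bs assms by (simp add: ennreal_mult[symmetric])
    finally show ?thesis .
  qed
qed

section \<open>Extreme singular values of a Gaussian matrix\<close>

definition colmap :: "(('i \<Rightarrow> real) \<Rightarrow> 'i \<Rightarrow> real) \<Rightarrow> 'j set \<Rightarrow> ('i \<times> 'j \<Rightarrow> real) \<Rightarrow> 'i \<times> 'j \<Rightarrow> real" where
  "colmap T F B = (\<lambda>(i, j). if j \<in> F then T (\<lambda>i. B (i, j)) i else B (i, j))"

lemma colmap_rot_insert:
  assumes "l \<notin> F"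
  shows "colmap (rot i j c s) (insert l F) B = rot (i, l) (j, l) c s (colmap (rot i j c s) F B)"
  using assms by (auto simp: colmap_def rot_def fun_eq_iff)

text \<open>A plane rotation acting on every column is a composition of plane rotations of the
  matrix entries, one for each column. Hence multiplication from the left by a rotation preserves
  the law of a Gaussian matrix.\<close>

lemma colmap_isos:
  assumes "T \<in> isos J" "finite F" "F \<subseteq> S"
  shows "colmap T F \<in> isos (J \<times> S)"
  using assms(1)
proof (induction rule: isos.induct)
  case isos_id
  have "colmap (\<lambda>x. x) F = (\<lambda>B. B :: 'a \<times> 'b \<Rightarrow> real)" by (auto simp: colmap_def fun_eq_iff)
  then show ?case using isos.isos_id by metis
next
  case (isos_rot T i j c s)
  have "(\<lambda>B. colmap (rot i j c s) F' (colmap T F B)) \<in> isos (J \<times> S)" if "finite F'" "F' \<subseteq> S" for F'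
    using that
  proof (induction F')
    case empty
    have "colmap (rot i j c s) {} (colmap T F B) = colmap T F B" for B by (simp add: colmap_def)
    then show ?case using isos_rot.IH by simp
  next
    case (insert l F')
    then show ?case using isos_rot.hyps unfolding colmap_rot_insert[OF insert(2)]
      by (intro isos.isos_rot) auto
  qed
  moreover have "(\<lambda>B. colmap (rot i j c s) F (colmap T F B)) = colmap (\<lambda>x. rot i j c s (T x)) F"
    by (auto simp: colmap_def fun_eq_iff)
  ultimately show ?case using assms(2,3) by metis
qed

lemma dist2_scale: "dist2 J bs (\<lambda>a. r * h a) = r\<^sup>2 * dist2 J bs h"
proof (induction J bs h rule: dist2.induct)
  case (1 J h)
  then show ?case by (simp add: ip_def sum_distrib_left power2_eq_square mult_ac)
next
  case (2 J b bs h)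
  have "pr J b (\<lambda>a. r * h a) = (\<lambda>a. r * pr J b h a)"
    by (simp add: pr_def ip_def sum_distrib_left fun_eq_iff algebra_simps)
  then show ?case using 2 by simp
qed

definition unit_vector :: "'i \<Rightarrow> 'i \<Rightarrow> real" where
  "unit_vector e = (\<lambda>i. if i = e then 1 else 0)"

lemma borel_measurable_of_bool_le:
  fixes f g :: "_ \<Rightarrow> real"
  assumes [measurable]: "f \<in> borel_measurable N" "g \<in> borel_measurable N"
  shows "(\<lambda>\<omega>. of_bool (f \<omega> \<le> g \<omega>) :: ennreal) \<in> borel_measurable N"
  by measurable

lemma sigma_finite_gauss: "sigma_finite_measure (gauss J)"
  using prob_space_gauss by (rule prob_space_imp_sigma_finite)

text \<open>By rotation invariance the direction \<open>e\<close> may be replaced by that of a random Gaussian vector.\<close>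

lemma gauss_dist2_unit_vector:
  assumes J: "finite J" "e \<in> J" and S: "finite S" "set js = S" "length js \<le> card J"
    and par: "0 < s" "s < 1 / 2" "0 < \<tau>"
  shows "(\<integral>\<^sup>+B. of_bool (dist2 J (map (\<lambda>j i. B (i, j)) js) (unit_vector e) * (1 + \<tau>) \<le> 1) \<partial>gauss (J \<times> S))
    \<le> ennreal ((1 / sqrt (1 - 2 * s)) ^ length js * (1 / sqrt (1 + 2 * s * \<tau>)) ^ (card J - length js))"
proof -
  define \<phi> :: "_ \<Rightarrow> _ \<Rightarrow> ennreal" where
    "\<phi> B h = of_bool (dist2 J (map (\<lambda>j i. B (i, j)) js) h * (1 + \<tau>) \<le> ip J h h)" for B h
  have comp: "a \<in> J \<Longrightarrow> j \<in> set js \<Longrightarrow> (\<lambda>B. B (a, j)) \<in> borel_measurable (gauss (J \<times> S))" for a j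
    using S by (intro measurable_gauss_component) auto
  have dmeas: "(\<lambda>B. dist2 J (map (\<lambda>j i. B (i, j)) js) h) \<in> borel_measurable (gauss (J \<times> S))" for h
    by (rule borel_measurable_dist2) (use comp in auto)
  have meas1: "(\<lambda>B. of_bool (dist2 J (map (\<lambda>j i. B (i, j)) js) h * (1 + \<tau>) \<le> c) :: ennreal) \<in> borel_measurable (gauss (J \<times> S))" for h c
    by (intro borel_measurable_of_bool_le borel_measurable_times dmeas) auto
  have meas2: "(\<lambda>(B, h). \<phi> B h) \<in> borel_measurable (gauss (J \<times> S) \<Otimes>\<^sub>M gauss J)"
    unfolding \<phi>_def case_prod_unfold
    by (intro borel_measurable_of_bool_le borel_measurable_times borel_measurable_dist2 borel_measurable_ip borel_measurable_const
         measurable_compose[OF measurable_fst comp] measurable_compose[OF measurable_snd measurable_gauss_component])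
  interpret P: pair_sigma_finite "gauss (J \<times> S)" "gauss J"
    by (intro pair_sigma_finite.intro sigma_finite_gauss)
  define c where "c = (\<integral>\<^sup>+B. of_bool (dist2 J (map (\<lambda>j i. B (i, j)) js) (unit_vector e) * (1 + \<tau>) \<le> 1) \<partial>gauss (J \<times> S) :: ennreal)"
  \<comment> \<open>Rotating \<open>h\<close> onto the axis \<open>e\<close> makes it a multiple of
    the unit vector, and \<open>dist2\<close> is homogeneous of degree two. If \<open>h\<close>
    vanishes on \<open>J\<close>, then the event of \<open>\<phi>\<close> holds trivially, which is
    why this is only an inequality.\<close>
  have le: "c \<le> (\<integral>\<^sup>+B. \<phi> B h \<partial>gauss (J \<times> S))" for h
  proof -
    obtain T where T: "T \<in> isos J" "\<And>a. a \<in> J \<Longrightarrow> a \<noteq> e \<Longrightarrow> T h a = 0" "(T h e)\<^sup>2 = ip J h h"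
      using ex_iso_axis[OF J, of h] by metis
    have "c \<le> (\<integral>\<^sup>+B. of_bool (dist2 J (map (\<lambda>j i. B (i, j)) js) (T h) * (1 + \<tau>) \<le> ip J h h) \<partial>gauss (J \<times> S))"
      unfolding c_def
    proof (rule nn_integral_mono)
      fix B
      have "dist2 J (map (\<lambda>j i. B (i, j)) js) (T h) = dist2 J (map (\<lambda>j i. B (i, j)) js) (\<lambda>a. T h e * unit_vector e a)"
        by (rule dist2_cong) (auto simp: list_all2_refl unit_vector_def T)
      then have "dist2 J (map (\<lambda>j i. B (i, j)) js) (T h) = ip J h h * dist2 J (map (\<lambda>j i. B (i, j)) js) (unit_vector e)"
        by (simp only: dist2_scale T)
      then have "dist2 J (map (\<lambda>j i. B (i, j)) js) (T h) * (1 + \<tau>) \<le> ip J h h"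
        if "dist2 J (map (\<lambda>j i. B (i, j)) js) (unit_vector e) * (1 + \<tau>) \<le> 1"
        using mult_left_mono[OF that ip_nonneg[of J h]] by (simp add: mult.assoc)
      then show "(of_bool (dist2 J (map (\<lambda>j i. B (i, j)) js) (unit_vector e) * (1 + \<tau>) \<le> 1) :: ennreal)
         \<le> of_bool (dist2 J (map (\<lambda>j i. B (i, j)) js) (T h) * (1 + \<tau>) \<le> ip J h h)" by simp
    qed
    also have "\<dots> = (\<integral>\<^sup>+B. of_bool (dist2 J (map (\<lambda>j i. colmap T S B (i, j)) js) (T h) * (1 + \<tau>) \<le> ip J h h) \<partial>gauss (J \<times> S))"
      by (rule nn_integral_gauss_iso[symmetric, OF colmap_isos[OF T(1) S(1) subset_refl] _ meas1]) (use J S in auto)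
    also have "\<dots> = (\<integral>\<^sup>+B. \<phi> B h \<partial>gauss (J \<times> S))"
    proof (rule nn_integral_cong)
      fix B
      have "map (\<lambda>j i. colmap T S B (i, j)) js = map T (map (\<lambda>j i. B (i, j)) js)"
        using S by (auto simp: colmap_def)
      then show "(of_bool (dist2 J (map (\<lambda>j i. colmap T S B (i, j)) js) (T h) * (1 + \<tau>) \<le> ip J h h) :: ennreal) = \<phi> B h"
        unfolding \<phi>_def by (simp only: dist2_iso[OF T(1) J(1)])
    qed
    finally show ?thesis .
  qed
  \<comment> \<open>Averaging over \<open>h\<close> and exchanging the integrals reverses the roles:
    now \<open>B\<close> is fixed, and the Gaussian vector \<open>h\<close> is to be close to a
    fixed subspace.\<close>
  have "c = (\<integral>\<^sup>+h. c \<partial>gauss J)"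
    by simp
  also have "\<dots> \<le> (\<integral>\<^sup>+h. (\<integral>\<^sup>+B. \<phi> B h \<partial>gauss (J \<times> S)) \<partial>gauss J)"
    by (rule nn_integral_mono) (rule le)
  also have "\<dots> = (\<integral>\<^sup>+B. (\<integral>\<^sup>+h. \<phi> B h \<partial>gauss J) \<partial>gauss (J \<times> S))"
    by (rule P.Fubini'[OF meas2])
  also have "\<dots> \<le> (\<integral>\<^sup>+B. ennreal ((1 / sqrt (1 - 2 * s)) ^ length js * (1 / sqrt (1 + 2 * s * \<tau>)) ^ (card J - length js)) \<partial>gauss (J \<times> S))"
  proof (rule nn_integral_mono)
    fix B
    have "(\<integral>\<^sup>+h. \<phi> B h \<partial>gauss J) \<le> (\<integral>\<^sup>+h. ennreal (exp (s * ip J h h - s * (1 + \<tau>) * dist2 J (map (\<lambda>j i. B (i, j)) js) h)) \<partial>gauss J)"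
    proof (rule nn_integral_mono)
      fix h
      have "0 \<le> s * ip J h h - s * (1 + \<tau>) * dist2 J (map (\<lambda>j i. B (i, j)) js) h"
        if "dist2 J (map (\<lambda>j i. B (i, j)) js) h * (1 + \<tau>) \<le> ip J h h"
        using mult_left_mono[OF that, of s] par by (simp add: mult_ac)
      then show "\<phi> B h \<le> ennreal (exp (s * ip J h h - s * (1 + \<tau>) * dist2 J (map (\<lambda>j i. B (i, j)) js) h))"
        unfolding \<phi>_def by (auto simp: ennreal_1[symmetric] simp del: ennreal_1)
    qed
    also have "\<dots> \<le> ennreal ((1 / sqrt (1 - 2 * s)) ^ length js * (1 / sqrt (1 + 2 * s * \<tau>)) ^ (card J - length js))"
      using nn_integral_gauss_exp_dist2[of J "map (\<lambda>j i. B (i, j)) js" s \<tau>] J S par by simp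
    finally show "(\<integral>\<^sup>+h. \<phi> B h \<partial>gauss J) \<le> \<dots>" .
  qed
  also have "\<dots> = ennreal ((1 / sqrt (1 - 2 * s)) ^ length js * (1 / sqrt (1 + 2 * s * \<tau>)) ^ (card J - length js))"
    by simp
  finally show ?thesis unfolding c_def .
qed

text \<open>Rotating \<open>x\<close> onto an axis shows that its product with a Gaussian vector is,
  up to sign, the length of \<open>x\<close> times one standard normal variable.\<close>

lemma nn_integral_gauss_linear_square:
  assumes K: "finite K" and f: "f \<in> borel_measurable borel"
  shows "(\<integral>\<^sup>+g. f ((ip K x g)\<^sup>2) \<partial>gauss K) = (\<integral>\<^sup>+y. f (ip K x x * y\<^sup>2) \<partial>std_gauss)"
proof (cases "K = {}")
  case True
  then show ?thesis using std_gauss.emeasure_space_1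
    by (simp add: ip_def)
next
  case False
  then obtain i0 where i0: "i0 \<in> K" by auto
  obtain T where T: "T \<in> isos K" "\<And>a. a \<in> K \<Longrightarrow> a \<noteq> i0 \<Longrightarrow> T x a = 0" "(T x i0)\<^sup>2 = ip K x x"
    using ex_iso_axis[OF K i0, of x] by metis
  have ip: "ip K (T x) g = T x i0 * g i0" for g
    using T(2) K i0 by (simp add: ip_def sum.remove[of K i0])
  have meas: "(\<lambda>g. f (ip K x x * (g i0)\<^sup>2)) \<in> borel_measurable (gauss K)"
    using f measurable_gauss_component[OF i0] by measurable
  have "(\<integral>\<^sup>+g. f ((ip K x g)\<^sup>2) \<partial>gauss K) = (\<integral>\<^sup>+g. f ((ip K (T x) (T g))\<^sup>2) \<partial>gauss K)"
    by (simp only: isos_ip[OF T(1) K])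
  also have "\<dots> = (\<integral>\<^sup>+g. f (ip K x x * (T g i0)\<^sup>2) \<partial>gauss K)"
    by (simp add: ip power_mult_distrib T)
  also have "\<dots> = (\<integral>\<^sup>+g. f (ip K x x * (g i0)\<^sup>2) \<partial>gauss K)"
    by (rule nn_integral_gauss_iso[OF T(1) K meas])
  also have "\<dots> = (\<integral>\<^sup>+g. f (ip K x x * (g i0)\<^sup>2) \<partial>gauss (insert i0 (K - {i0})))"
    using i0 by (simp add: insert_absorb)
  also have "\<dots> = (\<integral>\<^sup>+y. f (ip K x x * y\<^sup>2) \<partial>std_gauss) * (\<integral>\<^sup>+z. 1 \<partial>gauss (K - {i0}))"
  proof (rule nn_integral_gauss_insert_times)
    show "(\<lambda>y. f (ip K x x * y\<^sup>2)) \<in> borel_measurable borel" using f by measurable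
    show "(\<lambda>g. f (ip K x x * (g i0)\<^sup>2)) \<in> borel_measurable (gauss (insert i0 (K - {i0})))"
      using meas i0 by (simp add: insert_absorb)
  qed (use K in auto)
  finally show ?thesis by simp
qed

text \<open>The reciprocal of the standard normal density at \<open>sqrt t + 1\<close>, which is the
  least density on an interval of length 1 starting at \<open>sqrt t\<close>. To first order in the
  exponent it is \<open>exp (t / 2)\<close>.\<close>

definition tail_const :: "real \<Rightarrow> real" where
  "tail_const t = sqrt (2 * pi) * exp (t / 2 + sqrt t + 1 / 2)"

lemma tail_const_pos: "0 < tail_const t"
  by (simp add: tail_const_def)

lemma std_gauss_tail:
  assumes "0 \<le> t"
  shows "1 \<le> ennreal (tail_const t) * (\<integral>\<^sup>+y. of_bool (t \<le> y\<^sup>2) \<partial>std_gauss)"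
proof -
  have square_meas: "(\<lambda>y :: real. y\<^sup>2) \<in> borel_measurable borel"
    by (intro borel_measurable_power measurable_ident_sets refl)
  define r where "r = sqrt t"
  have r: "0 \<le> r" "r\<^sup>2 = t" using assms by (simp_all add: r_def)
  have d: "std_normal_density (r + 1) = 1 / tail_const t"
  proof -
    have "- (r + 1)\<^sup>2 / 2 = - (t / 2 + sqrt t + 1 / 2)"
      using r by (simp add: power2_eq_square r_def field_simps)
    then have "std_normal_density (r + 1) = 1 / sqrt (2 * pi) * exp (- (t / 2 + sqrt t + 1 / 2))"
      by (simp only: std_normal_density_def)
    also have "\<dots> = 1 / tail_const t"
      unfolding tail_const_def exp_minus by (simp only: inverse_eq_divide times_divide_times_eq mult_1)
    finally show ?thesis .
  qed
  have "ennreal (1 / tail_const t) = (\<integral>\<^sup>+y. ennreal (1 / tail_const t) * indicator {r..r+1} y \<partial>lborel)"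
    by (simp add: nn_integral_cmult)
  also have "\<dots> \<le> (\<integral>\<^sup>+y. ennreal (std_normal_density y) * of_bool (t \<le> y\<^sup>2) \<partial>lborel)"
  proof (rule nn_integral_mono)
    fix y :: real
    show "ennreal (1 / tail_const t) * indicator {r..r+1} y \<le> ennreal (std_normal_density y) * of_bool (t \<le> y\<^sup>2)"
    proof (cases "y \<in> {r..r+1}")
      case True
      then have "t \<le> y\<^sup>2" using r by (metis atLeastAtMost_iff power_mono)
      moreover have "std_normal_density (r + 1) \<le> std_normal_density y"
      proof -
        have "y\<^sup>2 \<le> (r + 1)\<^sup>2" using True r by (intro power_mono) auto
        moreover have "exp (- b / 2) \<le> exp (- a / 2)" if "a \<le> b" for a b :: real using that by simp
        ultimately have "exp (- (r + 1)\<^sup>2 / 2) \<le> exp (- y\<^sup>2 / 2)" by blast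
        then show ?thesis unfolding std_normal_density_def by (rule mult_left_mono) simp
      qed
      ultimately show ?thesis using True by (simp add: d)
    qed simp
  qed
  also have "\<dots> = (\<integral>\<^sup>+y. of_bool (t \<le> y\<^sup>2) \<partial>std_gauss)"
    by (rule nn_integral_std_gauss[OF borel_measurable_of_bool_le[OF borel_measurable_const square_meas], symmetric])
  finally have "ennreal (tail_const t) * ennreal (1 / tail_const t) \<le> ennreal (tail_const t) * (\<integral>\<^sup>+y. of_bool (t \<le> y\<^sup>2) \<partial>std_gauss)"
    by (rule mult_left_mono) simp
  then show ?thesis using tail_const_pos[of t] by (simp add: ennreal_mult[symmetric])
qed

lemma nn_integral_gauss_Un:
  assumes "finite K" "finite K'" "K \<inter> K' = {}" "f \<in> borel_measurable (gauss (K \<union> K'))"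
  shows "(\<integral>\<^sup>+x. f x \<partial>gauss (K \<union> K')) = (\<integral>\<^sup>+x. (\<integral>\<^sup>+y. f (merge K K' (x, y)) \<partial>gauss K') \<partial>gauss K)"
  using assms unfolding gauss_def by (intro gauss_prod.product_nn_integral_fold) auto

lemma measurable_merge_gauss:
  "merge K K' \<in> measurable (gauss K \<Otimes>\<^sub>M gauss K') (gauss (K \<union> K'))"
  unfolding gauss_def by (rule measurable_merge)

lemma ip_row: "ip ({e} \<times> S) x y = (\<Sum>j\<in>S. x (e, j) * y (e, j))"
proof -
  have "{e} \<times> S = Pair e ` S" by auto
  then show ?thesis by (simp add: ip_def sum.reindex inj_on_def)
qed

text \<open>The function \<open>p\<close> dominates the indicator of the event that the least singular value of \<open>G\<close> is
  small, whose measurability is thereby not an issue. For the proof a random row with index \<open>e\<close> is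
  added to \<open>G\<close>: if \<open>G x\<close> is short, then with probability at least \<open>1 / tail_const\<close> the product of the
  new row with \<open>x\<close> is not, and then the unit vector \<open>e\<close> is close to the column space.\<close>

lemma gauss_min_singular_value:
  fixes I S :: "nat set"
  assumes fin: "finite I" "finite S" and card: "card S \<le> card I"
    and par: "0 < s" "s < 1 / 2" "0 < \<tau>" and L: "0 < L"
  shows "\<exists>p\<in>borel_measurable (gauss (I \<times> S)).
    (\<integral>\<^sup>+G. p G \<partial>gauss (I \<times> S)) \<le> ennreal (tail_const (\<tau> * L) *
        ((1 / sqrt (1 - 2 * s)) ^ card S * (1 / sqrt (1 + 2 * s * \<tau>)) ^ (card I + 1 - card S))) \<and>
    (\<forall>G x. (\<Sum>j\<in>S. (x j)\<^sup>2) = 1 \<longrightarrow> (\<Sum>i\<in>I. (\<Sum>j\<in>S. G (i, j) * x j)\<^sup>2) \<le> L \<longrightarrow> 1 \<le> p G)"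
proof -
  obtain e where e: "e \<notin> I" using ex_new_if_finite[OF infinite_UNIV_nat fin(1)] by auto
  define J where "J = insert e I"
  define js where "js = sorted_list_of_set S"
  have js: "set js = S" "length js = card S" "distinct js" using fin by (simp_all add: js_def)
  have J: "finite J" "e \<in> J" "card J = card I + 1" using e fin by (auto simp: J_def)
  define \<xi> :: "_ \<Rightarrow> ennreal" where
    "\<xi> B = of_bool (dist2 J (map (\<lambda>j i. B (i, j)) js) (unit_vector e) * (1 + \<tau>) \<le> 1)" for B
  define C where "C = ennreal (tail_const (\<tau> * L))"
  define m :: "(nat \<times> nat \<Rightarrow> real) \<times> (nat \<times> nat \<Rightarrow> real) \<Rightarrow> nat \<times> nat \<Rightarrow> real"
    where "m = merge (I \<times> S) ({e} \<times> S)"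
  \<comment> \<open>The conditional probability of the event of \<open>\<xi>\<close> given
    \<open>G\<close>, multiplied by the reciprocal of its lower bound for bad \<open>G\<close>. Its
    mean is \<open>C\<close> times the unconditional probability.\<close>
  define p where "p G = C * (\<integral>\<^sup>+g. \<xi> (m (G, g)) \<partial>gauss ({e} \<times> S))" for G
  have JS: "J \<times> S = I \<times> S \<union> {e} \<times> S" by (auto simp: J_def)
  have meas: "\<xi> \<in> borel_measurable (gauss (J \<times> S))" unfolding \<xi>_def
    by (intro borel_measurable_of_bool_le borel_measurable_times borel_measurable_dist2 borel_measurable_const measurable_gauss_component)
       (auto simp: js)
  have meas2: "case_prod (\<lambda>G g. \<xi> (m (G, g))) \<in> borel_measurable (gauss (I \<times> S) \<Otimes>\<^sub>M gauss ({e} \<times> S))"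
    using measurable_compose[OF measurable_merge_gauss meas[unfolded JS]] by (simp add: m_def case_prod_unfold)
  have p_meas: "(\<lambda>G. \<integral>\<^sup>+g. \<xi> (m (G, g)) \<partial>gauss ({e} \<times> S)) \<in> borel_measurable (gauss (I \<times> S))"
    using sigma_finite_measure.borel_measurable_nn_integral[OF sigma_finite_gauss meas2] .
  show ?thesis
  proof (intro bexI[of _ p] conjI allI impI)
    show "p \<in> borel_measurable (gauss (I \<times> S))" unfolding p_def using p_meas by simp
    have "(\<integral>\<^sup>+G. p G \<partial>gauss (I \<times> S)) = C * (\<integral>\<^sup>+B. \<xi> B \<partial>gauss (J \<times> S))"
      unfolding p_def JS using fin e p_meas meas
      by (subst nn_integral_gauss_Un) (auto simp: nn_integral_cmult m_def JS)
    also have "\<dots> \<le> C * ennreal ((1 / sqrt (1 - 2 * s)) ^ card S * (1 / sqrt (1 + 2 * s * \<tau>)) ^ (card I + 1 - card S))"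
      using gauss_dist2_unit_vector[OF J(1,2) fin(2) js(1) _ par] J js card
      unfolding \<xi>_def by (intro mult_left_mono) simp_all
    also have "\<dots> = ennreal (tail_const (\<tau> * L) * ((1 / sqrt (1 - 2 * s)) ^ card S * (1 / sqrt (1 + 2 * s * \<tau>)) ^ (card I + 1 - card S)))"
      unfolding C_def using tail_const_pos[of "\<tau> * L"] by (simp add: ennreal_mult' less_imp_le)
    finally show "(\<integral>\<^sup>+G. p G \<partial>gauss (I \<times> S)) \<le> \<dots>" .
  next
    fix G x assume x: "(\<Sum>j\<in>S. (x j)\<^sup>2) = 1" "(\<Sum>i\<in>I. (\<Sum>j\<in>S. G (i, j) * x j)\<^sup>2) \<le> L"
    define x' where "x' = (\<lambda>(i :: nat, j). x j)"
    define V where "V = (\<Sum>i\<in>I. (\<Sum>j\<in>S. G (i, j) * x j)\<^sup>2)"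
    have V: "0 \<le> V" "V \<le> L" using x by (simp_all add: V_def sum_nonneg)
    have x': "ip ({e} \<times> S) x' x' = 1"
      using x by (simp add: ip_row x'_def power2_eq_square)
    have key: "of_bool (\<tau> * L \<le> (ip ({e} \<times> S) x' g)\<^sup>2) \<le> \<xi> (m (G, g))" for g
    proof -
      define w where "w = ip ({e} \<times> S) x' g"
      have "dist2 J (map (\<lambda>j i. m (G, g) (i, j)) js) (unit_vector e) * (1 + \<tau>) \<le> 1" if t: "\<tau> * L \<le> w\<^sup>2"
      proof -
        have "\<tau> * V \<le> \<tau> * L" using par by (intro mult_left_mono V(2)) simp
        with t have "\<tau> * V \<le> w\<^sup>2" by (rule order_trans[rotated])
        then have "V * (1 + \<tau>) \<le> V + w\<^sup>2" by (simp add: algebra_simps)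
        moreover have w0: "0 < w\<^sup>2" using less_le_trans[OF mult_pos_pos[OF par(3) L] t] .
        ultimately have le1: "V / (V + w\<^sup>2) * (1 + \<tau>) \<le> 1"
          using V(1) by (simp only: times_divide_eq_left divide_le_eq_1_pos add_nonneg_pos)
        \<comment> \<open>The coefficient that minimises
          \<open>(1 - y * w)\<^sup>2 + y\<^sup>2 * V\<close>, the squared distance of the unit
          vector from \<open>y\<close> times the image of \<open>x\<close> under the extended
          matrix.\<close>
        define y where "y = w / (V + w\<^sup>2)"
        have Vw: "V + w\<^sup>2 \<noteq> 0" using V w0 by linarith
        define r where "r i = (\<Sum>j\<leftarrow>js. (y * x j) * m (G, g) (i, j))" for i
        have r_sum: "r i = y * (\<Sum>j\<in>S. m (G, g) (i, j) * x j)" for i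
          unfolding r_def using js by (simp add: sum_list_distinct_conv_sum_set sum_distrib_left mult_ac)
        have re: "r e = y * w"
          unfolding r_sum w_def using e
          by (simp add: m_def merge_def ip_row x'_def mult.commute)
        have ri: "r i = y * (\<Sum>j\<in>S. G (i, j) * x j)" if "i \<in> I" for i
          unfolding r_sum using that by (simp add: m_def merge_def)
        have "dist2 J (map (\<lambda>j i. m (G, g) (i, j)) js) (unit_vector e)
          \<le> ip J (\<lambda>i. unit_vector e i - r i) (\<lambda>i. unit_vector e i - r i)"
          unfolding r_def by (rule dist2_le[OF J(1)])
        also have "\<dots> = (1 - y * w)\<^sup>2 + (\<Sum>i\<in>I. (r i)\<^sup>2)"
        proof -
          have ue: "unit_vector e e = 1" "i \<in> I \<Longrightarrow> unit_vector e i = 0" for i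
            using e by (auto simp: unit_vector_def)
          have "ip I (\<lambda>i. unit_vector e i - r i) (\<lambda>i. unit_vector e i - r i) = (\<Sum>i\<in>I. (r i)\<^sup>2)"
            by (simp add: ip_def ue(2) power2_eq_square)
          then show ?thesis by (simp add: J_def ip_insert[OF fin(1) e] re ue(1) power2_eq_square)
        qed
        also have "(\<Sum>i\<in>I. (r i)\<^sup>2) = y\<^sup>2 * V"
        proof -
          have "(\<Sum>i\<in>I. (r i)\<^sup>2) = (\<Sum>i\<in>I. y\<^sup>2 * (\<Sum>j\<in>S. G (i, j) * x j)\<^sup>2)"
            by (intro sum.cong refl) (simp only: ri power_mult_distrib)
          then show ?thesis by (simp only: V_def sum_distrib_left)
        qed
        also have "(1 - y * w)\<^sup>2 + y\<^sup>2 * V = V / (V + w\<^sup>2)"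
        proof -
          have "1 - y * w = (V + w\<^sup>2) / (V + w\<^sup>2) - w\<^sup>2 / (V + w\<^sup>2)"
            using Vw by (simp add: y_def power2_eq_square)
          then have "1 - y * w = V / (V + w\<^sup>2)" by (simp only: diff_divide_distrib[symmetric] add_diff_cancel_right')
          moreover have "(V / (V + w\<^sup>2))\<^sup>2 + y\<^sup>2 * V = V * (V + w\<^sup>2) / (V + w\<^sup>2)\<^sup>2"
            by (simp add: y_def power_divide add_divide_distrib[symmetric] power2_eq_square algebra_simps)
          moreover have "V * (V + w\<^sup>2) / (V + w\<^sup>2)\<^sup>2 = V / (V + w\<^sup>2)"
            using Vw by (simp add: power2_eq_square)
          ultimately show ?thesis by simp
        qed
        finally have "dist2 J (map (\<lambda>j i. m (G, g) (i, j)) js) (unit_vector e) \<le> V / (V + w\<^sup>2)" .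
        from mult_right_mono[OF this, of "1 + \<tau>"] le1 par show ?thesis by linarith
      qed
      then show ?thesis unfolding \<xi>_def w_def by simp
    qed
    have "1 \<le> C * (\<integral>\<^sup>+y. of_bool (\<tau> * L \<le> y\<^sup>2) \<partial>std_gauss)"
      unfolding C_def using par L by (intro std_gauss_tail) simp
    also have "\<dots> = C * (\<integral>\<^sup>+g. of_bool (\<tau> * L \<le> (ip ({e} \<times> S) x' g)\<^sup>2) \<partial>gauss ({e} \<times> S))"
      using nn_integral_gauss_linear_square[of "{e} \<times> S" "\<lambda>z. of_bool (\<tau> * L \<le> z)" x'] fin x' by simp
    also have "\<dots> \<le> p G" unfolding p_def by (intro mult_left_mono nn_integral_mono key) simp
    finally show "1 \<le> p G" .
  qed
qed

text \<open>The rows are independent, and each yields one normal variable of variance equal to the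
  squared length of \<open>g\<close>; the integral is the corresponding power of a one-dimensional
  one.\<close>

lemma nn_integral_gauss_matrix_exp:
  fixes I S :: "nat set"
  assumes fin: "finite I" "finite S" and c: "2 * c * (\<Sum>j\<in>S. (g j)\<^sup>2) < 1"
  shows "(\<integral>\<^sup>+G. ennreal (exp (c * (\<Sum>i\<in>I. (\<Sum>j\<in>S. G (i, j) * g j)\<^sup>2))) \<partial>gauss (I \<times> S))
     = ennreal ((1 / sqrt (1 - 2 * c * (\<Sum>j\<in>S. (g j)\<^sup>2))) ^ card I)"
  using fin(1)
proof (induction I)
  case empty
  then show ?case by simp
next
  case (insert i I)
  define Q where "Q K G = (\<Sum>i\<in>K. (\<Sum>j\<in>S. G (i, j) * g j)\<^sup>2)" for K and G :: "nat \<times> nat \<Rightarrow> real"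
  have Qm: "(\<lambda>G. ennreal (exp (c * Q K G))) \<in> borel_measurable (gauss (K \<times> S))" for K
  proof -
    have "(\<lambda>G. Q K G) \<in> borel_measurable (gauss (K \<times> S))" unfolding Q_def
      by (intro borel_measurable_sum borel_measurable_power borel_measurable_times borel_measurable_const measurable_gauss_component) auto
    then show ?thesis by measurable
  qed
  define g' where "g' = (\<lambda>(i :: nat, j). g j)"
  have g': "ip ({i} \<times> S) g' x = (\<Sum>j\<in>S. x (i, j) * g j)" for x
    by (simp add: ip_row g'_def mult.commute)
  have g'g': "ip ({i} \<times> S) g' g' = (\<Sum>j\<in>S. (g j)\<^sup>2)"
    by (simp add: ip_row g'_def power2_eq_square)
  have un: "insert i I \<times> S = I \<times> S \<union> {i} \<times> S" by auto
  have "(\<integral>\<^sup>+G. ennreal (exp (c * Q (insert i I) G)) \<partial>gauss (insert i I \<times> S))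
    = (\<integral>\<^sup>+G. (\<integral>\<^sup>+x. ennreal (exp (c * Q (insert i I) (merge (I \<times> S) ({i} \<times> S) (G, x)))) \<partial>gauss ({i} \<times> S)) \<partial>gauss (I \<times> S))"
    using insert.hyps fin(2) Qm[of "insert i I"] unfolding un by (intro nn_integral_gauss_Un) auto
  also have "\<dots> = (\<integral>\<^sup>+G. (\<integral>\<^sup>+x. ennreal (exp (c * Q I G)) * ennreal (exp (c * (ip ({i} \<times> S) g' x)\<^sup>2)) \<partial>gauss ({i} \<times> S)) \<partial>gauss (I \<times> S))"
  proof (intro nn_integral_cong)
    fix G x
    have "Q (insert i I) (merge (I \<times> S) ({i} \<times> S) (G, x)) = (ip ({i} \<times> S) g' x)\<^sup>2 + Q I (merge (I \<times> S) ({i} \<times> S) (G, x))"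
      using insert.hyps by (simp add: Q_def g' merge_def)
    also have "Q I (merge (I \<times> S) ({i} \<times> S) (G, x)) = Q I G" by (simp add: Q_def merge_def)
    finally show "ennreal (exp (c * Q (insert i I) (merge (I \<times> S) ({i} \<times> S) (G, x))))
      = ennreal (exp (c * Q I G)) * ennreal (exp (c * (ip ({i} \<times> S) g' x)\<^sup>2))"
      by (simp add: ennreal_mult[symmetric] exp_add[symmetric] algebra_simps)
  qed
  also have "\<dots> = (\<integral>\<^sup>+G. ennreal (exp (c * Q I G)) * ennreal (1 / sqrt (1 - 2 * c * (\<Sum>j\<in>S. (g j)\<^sup>2))) \<partial>gauss (I \<times> S))"
  proof (rule nn_integral_cong)
    fix G
    have m: "(\<lambda>x. ennreal (exp (c * (ip ({i} \<times> S) g' x)\<^sup>2))) \<in> borel_measurable (gauss ({i} \<times> S))"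
    proof -
      have [measurable]: "(\<lambda>x. ip ({i} \<times> S) g' x) \<in> borel_measurable (gauss ({i} \<times> S))"
        by (intro borel_measurable_ip measurable_gauss_component) auto
      show ?thesis by measurable
    qed
    have "(\<integral>\<^sup>+x. ennreal (exp (c * (ip ({i} \<times> S) g' x)\<^sup>2)) \<partial>gauss ({i} \<times> S))
        = (\<integral>\<^sup>+y. ennreal (exp (c * (ip ({i} \<times> S) g' g' * y\<^sup>2))) \<partial>std_gauss)"
      using fin by (intro nn_integral_gauss_linear_square) auto
    also have "\<dots> = (\<integral>\<^sup>+y. ennreal (exp ((c * (\<Sum>j\<in>S. (g j)\<^sup>2)) * y\<^sup>2)) \<partial>std_gauss)"
      by (simp add: g'g' mult.assoc)
    also have "\<dots> = ennreal (1 / sqrt (1 - 2 * c * (\<Sum>j\<in>S. (g j)\<^sup>2)))"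
      using nn_integral_std_gauss_exp_square[of "c * (\<Sum>j\<in>S. (g j)\<^sup>2)"] c by (simp add: mult.assoc)
    finally show "(\<integral>\<^sup>+x. ennreal (exp (c * Q I G)) * ennreal (exp (c * (ip ({i} \<times> S) g' x)\<^sup>2)) \<partial>gauss ({i} \<times> S))
      = ennreal (exp (c * Q I G)) * ennreal (1 / sqrt (1 - 2 * c * (\<Sum>j\<in>S. (g j)\<^sup>2)))"
      using m by (simp add: nn_integral_cmult)
  qed
  also have "\<dots> = (\<integral>\<^sup>+G. ennreal (exp (c * Q I G)) \<partial>gauss (I \<times> S)) * ennreal (1 / sqrt (1 - 2 * c * (\<Sum>j\<in>S. (g j)\<^sup>2)))"
    by (rule nn_integral_multc[OF Qm])
  also have "(\<integral>\<^sup>+G. ennreal (exp (c * Q I G)) \<partial>gauss (I \<times> S)) = ennreal ((1 / sqrt (1 - 2 * c * (\<Sum>j\<in>S. (g j)\<^sup>2))) ^ card I)"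
    unfolding Q_def by (rule insert.IH)
  finally show ?case unfolding Q_def using insert.hyps c by (simp add: ennreal_mult[symmetric] mult.commute)
qed

text \<open>As above, with a random Gaussian vector \<open>g\<close> in place of the row: if \<open>G\<close> has a large singular
  value, then \<open>G g\<close> is long with probability at least \<open>1 / tail_const\<close>.\<close>

lemma gauss_max_singular_value:
  fixes I S :: "nat set"
  assumes fin: "finite I" "finite S"
    and par: "0 < P" "P < 1" "0 < Q" "Q < 1" and L: "0 < L"
  shows "\<exists>p\<in>borel_measurable (gauss (I \<times> S)).
    (\<integral>\<^sup>+G. p G \<partial>gauss (I \<times> S)) \<le> ennreal (tail_const (P * Q * L) * exp (- (P * Q * L)) *
        ((1 / sqrt (1 - P)) ^ card I * (1 / sqrt (1 - Q)) ^ card S)) \<and>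
    (\<forall>G x. (\<Sum>j\<in>S. (x j)\<^sup>2) = 1 \<longrightarrow> L \<le> (\<Sum>i\<in>I. (\<Sum>j\<in>S. G (i, j) * x j)\<^sup>2) \<longrightarrow> 1 \<le> p G)"
proof -
  define t where "t = P * Q * L"
  have t: "0 < t" using par L by (simp add: t_def)
  define q where "q G g = (\<Sum>i\<in>I. (\<Sum>j\<in>S. G (i, j) * g j)\<^sup>2)" for G :: "nat \<times> nat \<Rightarrow> real" and g
  define \<xi> :: "_ \<Rightarrow> _ \<Rightarrow> ennreal" where "\<xi> G g = of_bool (t * L \<le> q G g)" for G g
  define C where "C = ennreal (tail_const t)"
  define p where "p G = C * (\<integral>\<^sup>+g. \<xi> G g \<partial>gauss S)" for G
  have meas: "case_prod \<xi> \<in> borel_measurable (gauss (I \<times> S) \<Otimes>\<^sub>M gauss S)"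
    unfolding \<xi>_def case_prod_unfold q_def
    by (intro borel_measurable_of_bool_le borel_measurable_sum borel_measurable_power borel_measurable_times borel_measurable_const
         measurable_compose[OF measurable_fst measurable_gauss_component] measurable_compose[OF measurable_snd measurable_gauss_component]) auto
  have p_meas: "(\<lambda>G. \<integral>\<^sup>+g. \<xi> G g \<partial>gauss S) \<in> borel_measurable (gauss (I \<times> S))"
    using sigma_finite_measure.borel_measurable_nn_integral[OF sigma_finite_gauss meas] .
  interpret P: pair_sigma_finite "gauss (I \<times> S)" "gauss S"
    by (intro pair_sigma_finite.intro sigma_finite_gauss)
  have inner: "(\<integral>\<^sup>+G. \<xi> G g \<partial>gauss (I \<times> S)) \<le> ennreal (exp (- t) * (1 / sqrt (1 - P)) ^ card I) * ennreal (exp (Q / 2 * ip S g g))" for g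
  proof -
    define Y where "Y = (\<Sum>j\<in>S. (g j)\<^sup>2)"
    have Y: "0 \<le> Y" "ip S g g = Y" by (simp_all add: Y_def sum_nonneg ip_def power2_eq_square)
    \<comment> \<open>Adapting the Chernoff parameter to \<open>g\<close> makes
      \<open>2 * c * Y\<close> equal to \<open>P\<close>, so that the integral over the matrix does
      not depend on \<open>g\<close>. For \<open>Y = 0\<close> division by zero gives
      \<open>c = 0\<close>, hence the inequality below.\<close>
    define c where "c = P / (2 * Y)"
    have c: "2 * c * Y \<le> P" using par Y by (simp add: c_def)
    have "(\<integral>\<^sup>+G. \<xi> G g \<partial>gauss (I \<times> S)) \<le> (\<integral>\<^sup>+G. ennreal (exp (Q / 2 * Y - t)) * ennreal (exp (c * q G g)) \<partial>gauss (I \<times> S))"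
    proof (rule nn_integral_mono)
      fix G
      show "\<xi> G g \<le> ennreal (exp (Q / 2 * Y - t)) * ennreal (exp (c * q G g))"
      proof (cases "t * L \<le> q G g")
        case True
        have pos: "0 < q G g" using mult_pos_pos[OF t L] True by linarith
        have "Y \<noteq> 0"
        proof
          assume "Y = 0"
          then have "\<forall>j\<in>S. g j = 0" using fin by (simp add: Y_def sum_nonneg_eq_0_iff)
          then have "q G g = 0" by (simp add: q_def)
          then show False using pos by simp
        qed
        then have Y0: "0 < Y" using Y by simp
        \<comment> \<open>The geometric mean of \<open>c * q G g\<close> and
          \<open>Q / 2 * Y\<close> is at least \<open>t / 2\<close>, because
          \<open>t = P * Q * L\<close>. The inequality of means then yields a sum of one term for
          \<open>G\<close> and one for \<open>g\<close>, as the exponential bound requires.\<close>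
        have "t\<^sup>2 \<le> P * Q * q G g"
          using mult_left_mono[OF True, of "P * Q"] par by (simp add: t_def power2_eq_square mult_ac)
        also have "\<dots> = 4 * ((c * q G g) * (Q / 2 * Y))" using Y0 by (simp add: c_def field_simps)
        also have "\<dots> \<le> (c * q G g + Q / 2 * Y)\<^sup>2"
          using zero_le_power2[of "c * q G g - Q / 2 * Y"] by (simp add: power2_eq_square algebra_simps)
        finally have "t \<le> c * q G g + Q / 2 * Y"
          using pos Y0 par by (rule_tac power2_le_imp_le) (simp_all add: c_def)
        then have "1 \<le> exp (Q / 2 * Y - t) * exp (c * q G g)" by (simp add: exp_add[symmetric])
        then show ?thesis using True by (simp add: \<xi>_def ennreal_mult[symmetric])
      qed (simp add: \<xi>_def)
    qed
    also have "\<dots> = ennreal (exp (Q / 2 * Y - t)) * (\<integral>\<^sup>+G. ennreal (exp (c * q G g)) \<partial>gauss (I \<times> S))"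
    proof (rule nn_integral_cmult)
      have [measurable]: "(\<lambda>G. q G g) \<in> borel_measurable (gauss (I \<times> S))" unfolding q_def
        by (intro borel_measurable_sum borel_measurable_power borel_measurable_times borel_measurable_const measurable_gauss_component) auto
      show "(\<lambda>G. ennreal (exp (c * q G g))) \<in> borel_measurable (gauss (I \<times> S))" by measurable
    qed
    also have "(\<integral>\<^sup>+G. ennreal (exp (c * q G g)) \<partial>gauss (I \<times> S)) = ennreal ((1 / sqrt (1 - 2 * c * Y)) ^ card I)"
      unfolding q_def Y_def using c par by (intro nn_integral_gauss_matrix_exp fin) (simp add: Y_def)
    also have "ennreal (exp (Q / 2 * Y - t)) * \<dots> \<le> ennreal (exp (Q / 2 * Y - t)) * ennreal ((1 / sqrt (1 - P)) ^ card I)"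
      using c par by (intro mult_left_mono ennreal_leI power_mono divide_left_mono) auto
    also have "\<dots> = ennreal (exp (- t) * (1 / sqrt (1 - P)) ^ card I) * ennreal (exp (Q / 2 * ip S g g))"
    proof -
      have "exp (Q / 2 * Y - t) = exp (- t) * exp (Q / 2 * Y)" by (simp add: exp_add[symmetric])
      then show ?thesis unfolding Y(2) using par by (simp add: ennreal_mult[symmetric] mult_ac)
    qed
    finally show ?thesis .
  qed
  show ?thesis
  proof (intro bexI[of _ p] conjI allI impI)
    show "p \<in> borel_measurable (gauss (I \<times> S))" unfolding p_def using p_meas by simp
    have "(\<integral>\<^sup>+G. p G \<partial>gauss (I \<times> S)) = C * (\<integral>\<^sup>+G. (\<integral>\<^sup>+g. \<xi> G g \<partial>gauss S) \<partial>gauss (I \<times> S))"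
      unfolding p_def by (rule nn_integral_cmult[OF p_meas])
    also have "(\<integral>\<^sup>+G. (\<integral>\<^sup>+g. \<xi> G g \<partial>gauss S) \<partial>gauss (I \<times> S)) = (\<integral>\<^sup>+g. (\<integral>\<^sup>+G. \<xi> G g \<partial>gauss (I \<times> S)) \<partial>gauss S)"
      by (rule P.Fubini'[OF meas, symmetric])
    also have "\<dots> \<le> (\<integral>\<^sup>+g. ennreal (exp (- t) * (1 / sqrt (1 - P)) ^ card I) * ennreal (exp (Q / 2 * ip S g g)) \<partial>gauss S)"
      by (rule nn_integral_mono) (rule inner)
    also have "\<dots> = ennreal (exp (- t) * (1 / sqrt (1 - P)) ^ card I) * ennreal ((1 / sqrt (1 - Q)) ^ card S)"
    proof -
      have "(\<integral>\<^sup>+g. ennreal (exp (Q / 2 * ip S g g)) \<partial>gauss S) = ennreal ((1 / sqrt (1 - Q)) ^ card S)"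
        using nn_integral_gauss_exp_square[OF fin(2), of "Q / 2"] par by simp
      then show ?thesis unfolding nn_integral_cmult[OF borel_measurable_exp_ip] by (rule arg_cong)
    qed
    finally have "(\<integral>\<^sup>+G. p G \<partial>gauss (I \<times> S)) \<le> C * (ennreal (exp (- t) * (1 / sqrt (1 - P)) ^ card I) * ennreal ((1 / sqrt (1 - Q)) ^ card S))"
      by (simp add: mult_left_mono)
    also have "\<dots> = ennreal (tail_const t * exp (- t) * ((1 / sqrt (1 - P)) ^ card I * (1 / sqrt (1 - Q)) ^ card S))"
      unfolding C_def using tail_const_pos[of t] par by (simp add: ennreal_mult[symmetric] mult_ac less_imp_le)
    finally show "(\<integral>\<^sup>+G. p G \<partial>gauss (I \<times> S)) \<le> ennreal (tail_const (P * Q * L) * exp (- (P * Q * L)) *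
        ((1 / sqrt (1 - P)) ^ card I * (1 / sqrt (1 - Q)) ^ card S))" by (simp add: t_def)
  next
    fix G :: "nat \<times> nat \<Rightarrow> real" and x :: "nat \<Rightarrow> real"
    assume x: "(\<Sum>j\<in>S. (x j)\<^sup>2) = 1" "L \<le> (\<Sum>i\<in>I. (\<Sum>j\<in>S. G (i, j) * x j)\<^sup>2)"
    define z where "z i = (\<Sum>j\<in>S. G (i, j) * x j)" for i
    define w where "w j = (\<Sum>i\<in>I. G (i, j) * z i)" for j
    define V where "V = (\<Sum>i\<in>I. (z i)\<^sup>2)"
    have V: "L \<le> V" "0 < V" using x L by (auto simp: V_def z_def)
    \<comment> \<open>The unit vector \<open>z / sqrt V\<close> is mapped by the transpose of \<open>G\<close> to a vector of norm at least \<open>sqrt V\<close>.\<close>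
    have "(\<Sum>j\<in>S. w j * x j) = V"
    proof -
      have "(\<Sum>j\<in>S. w j * x j) = (\<Sum>j\<in>S. \<Sum>i\<in>I. G (i, j) * z i * x j)" by (simp add: w_def sum_distrib_right)
      also have "\<dots> = (\<Sum>i\<in>I. \<Sum>j\<in>S. G (i, j) * z i * x j)" by (rule sum.swap)
      also have "\<dots> = (\<Sum>i\<in>I. z i * z i)"
        by (intro sum.cong refl) (simp add: z_def sum_distrib_left sum_distrib_right mult_ac)
      finally show ?thesis by (simp add: V_def power2_eq_square)
    qed
    then have "V\<^sup>2 \<le> (\<Sum>j\<in>S. (w j)\<^sup>2) * (\<Sum>j\<in>S. (x j)\<^sup>2)"
      using Cauchy_Schwarz_ineq_sum[of w x S] by simp
    then have wV: "V\<^sup>2 \<le> ip S w w" using x by (simp add: ip_def power2_eq_square)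
    \<comment> \<open>As \<open>w\<close> is the transpose of \<open>G\<close> applied to
      \<open>z\<close>, its product with \<open>g\<close> equals that of \<open>z\<close> with
      \<open>G g\<close>. By Cauchy-Schwarz a large product forces \<open>G g\<close> to be
      long.\<close>
    have key: "of_bool (t * V * V \<le> (ip S w g)\<^sup>2) \<le> \<xi> G g" for g
    proof -
      have "ip S w g = (\<Sum>i\<in>I. z i * (\<Sum>j\<in>S. G (i, j) * g j))"
      proof -
        have "ip S w g = (\<Sum>j\<in>S. \<Sum>i\<in>I. G (i, j) * z i * g j)" by (simp add: ip_def w_def sum_distrib_right)
        also have "\<dots> = (\<Sum>i\<in>I. \<Sum>j\<in>S. G (i, j) * z i * g j)" by (rule sum.swap)
        finally show ?thesis by (simp add: sum_distrib_left mult_ac)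
      qed
      then have le: "(ip S w g)\<^sup>2 \<le> V * q G g"
        unfolding V_def q_def using Cauchy_Schwarz_ineq_sum[of z "\<lambda>i. \<Sum>j\<in>S. G (i, j) * g j" I] by simp
      have "t * L \<le> q G g" if "t * V * V \<le> (ip S w g)\<^sup>2"
      proof -
        have "V * (t * V) \<le> V * q G g" using that le by (simp add: mult_ac)
        then have "t * V \<le> q G g" using V(2) by (simp only: mult_le_cancel_left_pos)
        moreover have "t * L \<le> t * V" using V(1) t by simp
        ultimately show ?thesis by linarith
      qed
      then show ?thesis by (simp add: \<xi>_def)
    qed
    have "1 \<le> C * (\<integral>\<^sup>+y. of_bool (t \<le> y\<^sup>2) \<partial>std_gauss)"
      unfolding C_def using t by (intro std_gauss_tail) simp
    also have "\<dots> \<le> C * (\<integral>\<^sup>+y. of_bool (t * V * V \<le> ip S w w * y\<^sup>2) \<partial>std_gauss)"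
    proof (intro mult_left_mono nn_integral_mono)
      fix y :: real
      have "t * V * V \<le> ip S w w * y\<^sup>2" if "t \<le> y\<^sup>2"
      proof -
        have "V\<^sup>2 * t \<le> ip S w w * y\<^sup>2" using wV that t by (intro mult_mono) (auto simp: ip_nonneg)
        then show ?thesis by (simp add: power2_eq_square mult_ac)
      qed
      then show "(of_bool (t \<le> y\<^sup>2) :: ennreal) \<le> of_bool (t * V * V \<le> ip S w w * y\<^sup>2)" by simp
    qed simp
    also have "\<dots> = C * (\<integral>\<^sup>+g. of_bool (t * V * V \<le> (ip S w g)\<^sup>2) \<partial>gauss S)"
      using nn_integral_gauss_linear_square[of S "\<lambda>z. of_bool (t * V * V \<le> z)" w] fin by simp
    also have "\<dots> \<le> p G" unfolding p_def by (intro mult_left_mono nn_integral_mono key) simp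
    finally show "1 \<le> p G" .
  qed
qed

section \<open>The bounding functions\<close>

lemma ln_diff_bounds:
  fixes a b :: real
  assumes "0 < a" "a < b"
  shows "ln b - ln a < (b - a) / a" "(b - a) / b < ln b - ln a"
proof -
  have ne: "ln x \<noteq> x - 1" if "0 < x" "x \<noteq> 1" for x :: real using ln_eq_minus_one that by blast
  have "ln (b / a) < b / a - 1"
    using assms ne[of "b / a"] ln_le_minus_one[of "b / a"] by (simp add: less_le)
  then show "ln b - ln a < (b - a) / a" using assms by (simp add: ln_div diff_divide_distrib)
  have "ln (a / b) < a / b - 1"
    using assms ne[of "a / b"] ln_le_minus_one[of "a / b"] by (simp add: less_le)
  then show "(b - a) / b < ln b - ln a" using assms by (simp add: ln_div diff_divide_distrib)
qed

lemma H_eq: "0 < p \<Longrightarrow> p < 1 \<Longrightarrow> H p = - p * ln p - (1 - p) * ln (1 - p)"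
  by (simp add: H_def ln_div)

lemma H_pos:
  assumes "0 < p" "p < 1"
  shows "0 < H p"
proof -
  have "p * ln p < 0" "(1 - p) * ln (1 - p) < 0" using assms by (intro mult_pos_neg; simp)+
  then show ?thesis using H_eq[OF assms] by simp
qed

text \<open>For \<open>l \<le> 1 - r\<close> the derivative \<open>((1 - r) / l - 1) / 2\<close> is
  nonnegative. The strict bounds for the logarithm give strictness up to the endpoint
  \<open>1 - r\<close>, where the derivative vanishes.\<close>

lemma psi_min_strict_mono:
  assumes "0 < a" "a < b" "b \<le> 1 - r"
  shows "psi_min a r < psi_min b r"
proof -
  have "b - a = b * ((b - a) / b)" using assms by simp
  also have "\<dots> \<le> (1 - r) * ((b - a) / b)" using assms by (intro mult_right_mono) auto
  also have "\<dots> < (1 - r) * (ln b - ln a)"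
    using ln_diff_bounds(2)[OF assms(1,2)] assms by (intro mult_strict_left_mono) auto
  finally show ?thesis by (simp add: psi_min_def algebra_simps)
qed

lemma psi_max_strict_antimono:
  assumes "1 + r \<le> a" "a < b" "0 \<le> r"
  shows "psi_max b r < psi_max a r"
proof -
  have "(1 + r) * (ln b - ln a) < (1 + r) * ((b - a) / a)"
    using ln_diff_bounds(1)[of a b] assms by (intro mult_strict_left_mono) auto
  also have "\<dots> \<le> a * ((b - a) / a)" using assms by (intro mult_right_mono) auto
  also have "\<dots> = b - a" using assms by simp
  finally show ?thesis by (simp add: psi_max_def algebra_simps)
qed

section \<open>The solutions \<open>lambda_min\<close> and \<open>lambda_max\<close> as zeros of
  \<open>F_min\<close> and \<open>F_max\<close>\<close>

context
  fixes \<delta> :: real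
  assumes \<delta>: "0 < \<delta>" "\<delta> < 1"
begin

definition F_min :: "real \<Rightarrow> real \<Rightarrow> real" where
  "F_min l r = \<delta> * psi_min l r + H (r * \<delta>)"

definition F_max :: "real \<Rightarrow> real \<Rightarrow> real" where
  "F_max l r = \<delta> * psi_max l r + H (r * \<delta>)"

lemma prod_bounds:
  assumes "0 < r" "r \<le> 1"
  shows "0 < r * \<delta> \<and> r * \<delta> < 1"
proof -
  have "r * \<delta> \<le> 1 * \<delta>" using assms \<delta> by (intro mult_right_mono) auto
  then have "r * \<delta> < 1" using \<delta>(2) by linarith
  then show ?thesis using assms \<delta> by simp
qed

lemma F_min_strict_mono: "0 < a \<Longrightarrow> a < b \<Longrightarrow> b \<le> 1 - r \<Longrightarrow> F_min a r < F_min b r"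
  using mult_strict_left_mono[OF psi_min_strict_mono \<delta>(1), of a b r] by (simp add: F_min_def)

lemma F_max_strict_antimono: "1 + r \<le> a \<Longrightarrow> a < b \<Longrightarrow> 0 \<le> r \<Longrightarrow> F_max b r < F_max a r"
  using mult_strict_left_mono[OF psi_max_strict_antimono \<delta>(1), of r a b] by (simp add: F_max_def)

lemma F_min_pos: "0 < r \<Longrightarrow> r < 1 \<Longrightarrow> 0 < F_min (1 - r) r"
proof -
  assume r: "0 < r" "r < 1"
  have "psi_min (1 - r) r = H r / 2" using r by (simp add: psi_min_def H_eq field_simps)
  then have "0 < psi_min (1 - r) r" using H_pos[OF r] by simp
  moreover have "0 < H (r * \<delta>)" using prod_bounds[of r] r by (intro H_pos) auto
  ultimately show ?thesis using \<delta> by (simp add: F_min_def add_pos_pos)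
qed

lemma F_max_pos: "0 < r \<Longrightarrow> r \<le> 1 \<Longrightarrow> 0 < F_max (1 + r) r"
proof -
  assume r: "0 < r" "r \<le> 1"
  have "0 < (1 + r) * ln (1 + r)" using r by (intro mult_pos_pos) auto
  moreover have "r * ln r \<le> 0" using r by (simp add: mult_nonneg_nonpos)
  ultimately have "0 < psi_max (1 + r) r" by (simp add: psi_max_def)
  moreover have "0 < H (r * \<delta>)" using prod_bounds[of r] r by (intro H_pos) auto
  ultimately show ?thesis using \<delta> by (simp add: F_max_def add_pos_pos)
qed

lemma lambda_min:
  assumes "0 < r" "r < 1"
  shows "0 < lambda_min \<delta> r" "lambda_min \<delta> r < 1 - r" "F_min (lambda_min \<delta> r) r = 0"
proof -
  define C where "C = \<delta> * (H r + 1 / 2 * (1 - r + r * ln r)) + H (r * \<delta>)"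
  \<comment> \<open>Large enough for \<open>exp (- K)\<close> to be at most \<open>1 - r\<close> and
    for the logarithmic term \<open>- \<delta> * (1 - r) / 2 * K\<close> to outweigh the constant
    \<open>C\<close>.\<close>
  define K where "K = max (2 * \<bar>C\<bar> / (\<delta> * (1 - r)) + 1) (- ln (1 - r))"
  define a where "a = exp (- K)"
  have a: "0 < a" "a \<le> 1 - r"
  proof -
    have "- K \<le> ln (1 - r)" by (simp add: K_def)
    then have "exp (- K) \<le> exp (ln (1 - r))" by simp
    then show "a \<le> 1 - r" using assms by (simp add: a_def)
  qed (simp add: a_def)
  have "ln a = - K" by (simp add: a_def)
  then have "F_min a r = C - \<delta> * (1 - r) / 2 * K - \<delta> * a / 2"
    unfolding F_min_def psi_min_def C_def by (simp add: field_simps)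
  moreover have "0 \<le> \<delta> * a / 2" using \<delta> a by simp
  ultimately have "F_min a r \<le> C - \<delta> * (1 - r) / 2 * K" by linarith
  also have "\<dots> \<le> C - \<delta> * (1 - r) / 2 * (2 * \<bar>C\<bar> / (\<delta> * (1 - r)) + 1)"
    using \<delta> assms by (intro diff_left_mono mult_left_mono) (auto simp: K_def)
  also have "\<dots> = C - \<bar>C\<bar> - \<delta> * (1 - r) / 2"
  proof -
    have "\<delta> * (1 - r) \<noteq> 0" using \<delta> assms by simp
    then have "\<delta> * (1 - r) / 2 * (2 * \<bar>C\<bar> / (\<delta> * (1 - r))) = \<bar>C\<bar>" by simp
    then show ?thesis by (simp only: distrib_left)
  qed
  also have "\<dots> < 0"
  proof -
    have "0 < \<delta> * (1 - r) / 2" using \<delta> assms by simp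
    then show ?thesis by linarith
  qed
  finally have neg: "F_min a r < 0" .
  have "continuous_on {a..1 - r} (\<lambda>l. F_min l r)"
    unfolding F_min_def psi_min_def using a by (auto intro!: continuous_intros)
  then obtain l where l: "a \<le> l" "l \<le> 1 - r" "F_min l r = 0"
    using IVT'[of "\<lambda>l. F_min l r" a 0 "1 - r"] neg F_min_pos[OF assms] a by auto
  have "lambda_min \<delta> r = l" unfolding lambda_min_def F_min_def[symmetric]
  proof (rule the_equality)
    show "0 < l \<and> l \<le> 1 - r \<and> F_min l r = 0" using l a by simp
    fix l' assume l': "0 < l' \<and> l' \<le> 1 - r \<and> F_min l' r = 0"
    then show "l' = l" using l a F_min_strict_mono[of l l' r] F_min_strict_mono[of l' l r]
      by (cases rule: linorder_cases[of l l']) auto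
  qed
  then show "0 < lambda_min \<delta> r" "lambda_min \<delta> r < 1 - r" "F_min (lambda_min \<delta> r) r = 0"
    using l a F_min_pos[OF assms] by (auto simp: less_le)
qed

lemma lambda_max:
  assumes "0 < r" "r \<le> 1"
  shows "1 + r < lambda_max \<delta> r" "F_max (lambda_max \<delta> r) r = 0"
proof -
  define C where "C = 2 * ln 4 + 2 - r * ln r + 2 * H (r * \<delta>) / \<delta>"
  \<comment> \<open>By \<open>ln b \<le> b / 4 + ln 4\<close> and \<open>1 + r \<le> 2\<close> the
    logarithm consumes at most half of the linear term, so \<open>C - b / 2\<close> bounds the
    doubled expression divided by \<delta>. The 2 ensures \<open>1 + r \<le> b\<close>.\<close>
  define b where "b = max 2 (2 * C + 2)"
  have b: "1 + r \<le> b" "1 < b" using assms by (auto simp: b_def)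
  have "ln b \<le> b / 4 + ln 4"
    using ln_le_minus_one[of "b / 4"] b by (simp add: ln_div)
  then have "(1 + r) * ln b \<le> 2 * (b / 4 + ln 4)"
    using assms b by (intro mult_mono) auto
  then have "2 * psi_max b r + 2 * H (r * \<delta>) / \<delta> \<le> C - b / 2"
    using assms by (simp add: psi_max_def C_def)
  also have "\<dots> < 0" by (simp add: b_def)
  finally have "\<delta> / 2 * (2 * psi_max b r + 2 * H (r * \<delta>) / \<delta>) < 0"
    using \<delta> by (intro mult_pos_neg) auto
  then have neg: "F_max b r < 0" using \<delta> by (simp add: F_max_def distrib_left)
  have "continuous_on {1 + r..b} (\<lambda>l. F_max l r)"
    unfolding F_max_def psi_max_def using assms by (auto intro!: continuous_intros)
  then obtain l where l: "1 + r \<le> l" "l \<le> b" "F_max l r = 0"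
    using IVT2'[of "\<lambda>l. F_max l r" b 0 "1 + r"] neg F_max_pos[OF assms] b by auto
  have "lambda_max \<delta> r = l" unfolding lambda_max_def F_max_def[symmetric]
  proof (rule the_equality)
    show "1 + r \<le> l \<and> F_max l r = 0" using l by simp
    fix l' assume l': "1 + r \<le> l' \<and> F_max l' r = 0"
    then show "l' = l" using l assms F_max_strict_antimono[of r l l'] F_max_strict_antimono[of r l' l]
      by (cases rule: linorder_cases[of l l']) auto
  qed
  then show "1 + r < lambda_max \<delta> r" "F_max (lambda_max \<delta> r) r = 0"
    using l F_max_pos[OF assms] by (auto simp: less_le)
qed

text \<open>Monotonicity in the first argument converts inequalities about an implicitly defined
  number into signs of an explicit function. Continuity and monotonicity of
  \<open>lambda_min\<close> are read off from these signs.\<close>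

lemma lambda_min_greater_iff:
  assumes "0 < r" "r < 1" "0 < a" "a \<le> 1 - r"
  shows "a < lambda_min \<delta> r \<longleftrightarrow> F_min a r < 0" "lambda_min \<delta> r < a \<longleftrightarrow> 0 < F_min a r"
  using F_min_strict_mono[of a "lambda_min \<delta> r" r] F_min_strict_mono[of "lambda_min \<delta> r" a r]
    lambda_min[OF assms(1,2)] assms
  by (cases rule: linorder_cases[of a "lambda_min \<delta> r"]; simp)+

lemma lambda_max_greater_iff:
  assumes "0 < r" "r \<le> 1" "1 + r \<le> a"
  shows "a < lambda_max \<delta> r \<longleftrightarrow> 0 < F_max a r" "lambda_max \<delta> r < a \<longleftrightarrow> F_max a r < 0"
  using F_max_strict_antimono[of r a "lambda_max \<delta> r"] F_max_strict_antimono[of r "lambda_max \<delta> r" a]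
    lambda_max[OF assms(1,2)] assms
  by (cases rule: linorder_cases[of a "lambda_max \<delta> r"]; simp)+

text \<open>After division by \<open>1 - r\<close> the term with \<open>ln l\<close> no longer depends on \<open>r\<close>.\<close>

lemma F_min_scaled_strict_mono:
  assumes "0 < r" "r < r'" "r' \<le> 1 - l" "0 < l"
  shows "F_min l r / (1 - r) < F_min l r' / (1 - r')"
proof -
  define G where "G x = \<delta> / 2 * (- (x * ln x) / (1 - x) - 2 * ln (1 - x) + ln l + 1 - l / (1 - x))
     + (- (x * \<delta>) * ln (x * \<delta>) - (1 - x * \<delta>) * ln (1 - x * \<delta>)) / (1 - x)" for x
  have FG: "F_min l x / (1 - x) = G x" if "0 < x" "x < 1" for x
  proof -
    have p: "0 < x * \<delta>" "x * \<delta> < 1" using prod_bounds[of x] that by auto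
    have alg: "\<delta> * (- x * u - q * v + 1 / 2 * (q * w + 1 - x + x * u - l)) / q = \<delta> / 2 * (- (x * u) / q - 2 * v + w + 1 - l / q)"
      if "q \<noteq> 0" "q = 1 - x" for q u v w :: real
    proof -
      have e: "q * w + 1 - x = q * w + q" using that(2) by simp
      show ?thesis unfolding e using that(1) by (simp add: field_simps)
    qed
    have "\<delta> * psi_min l x / (1 - x) = \<delta> / 2 * (- (x * ln x) / (1 - x) - 2 * ln (1 - x) + ln l + 1 - l / (1 - x))"
      using alg[of "1 - x" "ln x" "ln (1 - x)" "ln l"] that unfolding psi_min_def H_eq[OF that] by simp
    then show ?thesis unfolding G_def F_min_def add_divide_distrib H_eq[OF p] by simp
  qed
  have "G r < G r'"
  proof (rule DERIV_pos_imp_increasing[OF assms(2)])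
    fix x assume x: "r \<le> x" "x \<le> r'"
    have x01: "0 < x" "x < 1" "l \<le> 1 - x" using x assms by auto
    have p: "0 < x * \<delta>" "x * \<delta> < 1" using prod_bounds[of x] x01 by auto
    have nz: "1 - x \<noteq> 0" "x \<noteq> 0" "1 - x * \<delta> \<noteq> 0" "\<delta> \<noteq> 0" using x01 p \<delta> by auto
    \<comment> \<open>The derivative of \<open>G\<close>, with the numerator of the quotient rule
      collected. Every remaining term has a visible sign: the logarithms are of numbers below 1, and
      \<open>l \<le> 1 - x\<close>.\<close>
    define D where "D = (\<delta> / 2 * (- ln x + (1 - x) - l) + (- \<delta> * ln (x * \<delta>) - (1 - \<delta>) * ln (1 - x * \<delta>))) / (1 - x)\<^sup>2"
    have d1: "((\<lambda>x. - (x * ln x) / (1 - x)) has_real_derivative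
        (- (ln x + 1) * (1 - x) - - (x * ln x) * (- 1)) / ((1 - x) * (1 - x))) (at x)"
      by (intro DERIV_divide) (use x01 in \<open>auto intro!: derivative_eq_intros\<close>)
    have d2: "((\<lambda>x. ln (1 - x)) has_real_derivative - 1 / (1 - x)) (at x)"
      using x01 by (auto intro!: derivative_eq_intros)
    have d3: "((\<lambda>x. l / (1 - x)) has_real_derivative (0 * (1 - x) - l * (- 1)) / ((1 - x) * (1 - x))) (at x)"
      by (intro DERIV_divide) (use x01 in \<open>auto intro!: derivative_eq_intros\<close>)
    have entropy: "((\<lambda>x. - (x * \<delta>) * ln (x * \<delta>) - (1 - x * \<delta>) * ln (1 - x * \<delta>)) has_real_derivative
        - \<delta> * ln (x * \<delta>) + \<delta> * ln (1 - x * \<delta>)) (at x)"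
    proof -
      have f: "((\<lambda>y. y * ln y) has_real_derivative ln y + 1) (at y)" if "0 < y" for y :: real
        using that by (auto intro!: derivative_eq_intros)
      have "((\<lambda>x. x * \<delta>) has_real_derivative \<delta>) (at x)" "((\<lambda>x. 1 - x * \<delta>) has_real_derivative - \<delta>) (at x)"
        by (auto intro!: derivative_eq_intros)
      note c = DERIV_chain2[OF f this(1)] DERIV_chain2[OF f this(2)]
      from DERIV_diff[OF DERIV_minus[OF c(1)] c(2)] p show ?thesis by (simp add: algebra_simps)
    qed
    have d4: "((\<lambda>x. (- (x * \<delta>) * ln (x * \<delta>) - (1 - x * \<delta>) * ln (1 - x * \<delta>)) / (1 - x)) has_real_derivative
        ((- \<delta> * ln (x * \<delta>) + \<delta> * ln (1 - x * \<delta>)) * (1 - x)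
           - (- (x * \<delta>) * ln (x * \<delta>) - (1 - x * \<delta>) * ln (1 - x * \<delta>)) * (- 1)) / ((1 - x) * (1 - x))) (at x)"
      by (intro DERIV_divide entropy) (use x01 in \<open>auto intro!: derivative_eq_intros\<close>)
    have "(G has_real_derivative 
        \<delta> / 2 * ((- (ln x + 1) * (1 - x) - (x * ln x)) / (1 - x)\<^sup>2 + 2 / (1 - x) - l / (1 - x)\<^sup>2)
        + ((- \<delta> * ln (x * \<delta>) + \<delta> * ln (1 - x * \<delta>)) * (1 - x) + (- (x * \<delta>) * ln (x * \<delta>) - (1 - x * \<delta>) * ln (1 - x * \<delta>))) / (1 - x)\<^sup>2) (at x)"
      unfolding G_def[abs_def]
      by (rule DERIV_cong[OF DERIV_add[OF DERIV_cmult[OF DERIV_diff[OF DERIV_add[OF DERIV_add[OF DERIV_diff[OF d1 DERIV_cmult[OF d2, of 2]]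
            DERIV_const[of "ln l"]] DERIV_const[of 1]] d3], of "\<delta> / 2"] d4]])
         (simp add: power2_eq_square)
    also have "\<delta> / 2 * ((- (ln x + 1) * (1 - x) - (x * ln x)) / (1 - x)\<^sup>2 + 2 / (1 - x) - l / (1 - x)\<^sup>2)
        + ((- \<delta> * ln (x * \<delta>) + \<delta> * ln (1 - x * \<delta>)) * (1 - x) + (- (x * \<delta>) * ln (x * \<delta>) - (1 - x * \<delta>) * ln (1 - x * \<delta>))) / (1 - x)\<^sup>2 = D"
    proof -
      have alg: "\<delta> / 2 * ((- (u + 1) * q - y * u) / q\<^sup>2 + 2 / q - l / q\<^sup>2) + ((- \<delta> * v + \<delta> * w) * q + (- (y * \<delta>) * v - (1 - y * \<delta>) * w)) / q\<^sup>2
          = (\<delta> / 2 * (- u + q - l) + (- \<delta> * v - (1 - \<delta>) * w)) / q\<^sup>2"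
        if "q \<noteq> 0" "y = 1 - q" for q u v w y :: real
        unfolding that(2) using that(1) by (simp add: field_simps power2_eq_square)
      show ?thesis unfolding D_def by (rule alg[OF nz(1)]) simp
    qed
    finally have "(G has_real_derivative D) (at x)" .
    moreover have "0 < D"
    proof -
      have "0 < - ln x + (1 - x) - l" using x01(3) ln_less_zero[OF x01(1,2)] by linarith
      moreover have "0 < \<delta> / 2" using \<delta> by simp
      ultimately have "0 < \<delta> / 2 * (- ln x + (1 - x) - l)" by (intro mult_pos_pos)
      moreover have "0 \<le> - \<delta> * ln (x * \<delta>)" using p \<delta> by (simp add: mult_nonneg_nonpos)
      moreover have "0 \<le> - ((1 - \<delta>) * ln (1 - x * \<delta>))" using p \<delta> by (simp add: mult_nonneg_nonpos)
      ultimately have "0 < \<delta> / 2 * (- ln x + (1 - x) - l) + (- \<delta> * ln (x * \<delta>) - (1 - \<delta>) * ln (1 - x * \<delta>))"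
        by linarith
      then show ?thesis unfolding D_def using nz by (intro divide_pos_pos) auto
    qed
    ultimately show "\<exists>y. (G has_real_derivative y) (at x) \<and> 0 < y" by blast
  qed
  then show ?thesis using FG[of r] FG[of r'] assms by simp
qed

text \<open>At \<open>l = lambda_min \<delta> r'\<close> the scaled function vanishes at
  \<open>r'\<close>. Being strictly increasing in \<open>r\<close>, it is negative at the smaller
  \<open>r\<close>, and a negative sign means that \<open>l\<close> lies below
  \<open>lambda_min \<delta> r\<close>.\<close>

lemma lambda_min_strict_antimono:
  assumes "0 < r" "r < r'" "r' < 1"
  shows "lambda_min \<delta> r' < lambda_min \<delta> r"
proof -
  define l where "l = lambda_min \<delta> r'"
  have l: "0 < l" "l < 1 - r'" "F_min l r' = 0" using lambda_min[of r'] assms by (auto simp: l_def)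
  have "r' \<le> 1 - l" using l(2) by linarith
  from F_min_scaled_strict_mono[OF assms(1,2) this l(1)] have "F_min l r / (1 - r) < 0" by (simp add: l(3))
  then have "F_min l r < 0" using assms by (simp add: divide_less_0_iff)
  then show ?thesis using lambda_min_greater_iff(1)[of r l] l assms by (simp add: l_def)
qed

lemma isCont_F_min:
  assumes "0 < r" "r < 1" "0 < a"
  shows "isCont (F_min a) r"
  using assms prod_bounds[of r] \<delta>
  unfolding F_min_def psi_min_def H_def by (auto intro!: continuous_intros)

lemma isCont_F_max:
  assumes "0 < r" "r \<le> 1" "0 < a"
  shows "isCont (F_max a) r"
  using assms prod_bounds[of r] \<delta>
  unfolding F_max_def psi_max_def H_def by (auto intro!: continuous_intros)

lemma isCont_lambda_min:
  assumes "0 < r" "r < 1"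
  shows "isCont (lambda_min \<delta>) r"
  unfolding isCont_def
proof (rule order_tendstoI)
  have ev: "\<forall>\<^sub>F x in at r. 0 < x \<and> x < 1"
    using eventually_at_in_open'[of "{0<..<1}" r] assms by simp
  have id: "((\<lambda>x. x) \<longlongrightarrow> r) (at r)" by (rule tendsto_ident_at)
  fix a assume a: "a < lambda_min \<delta> r"
  show "\<forall>\<^sub>F x in at r. a < lambda_min \<delta> x"
  proof (cases "0 < a")
    case True
    have a1: "a < 1 - r" using a lambda_min[OF assms] by linarith
    have "F_min a r < 0" using lambda_min_greater_iff(1)[of r a] True a a1 assms by simp
    then have "\<forall>\<^sub>F x in at r. F_min a x < 0"
      using isCont_F_min[OF assms True] unfolding isCont_def by (rule order_tendstoD(2)[rotated])
    moreover have "\<forall>\<^sub>F x in at r. x < 1 - a" using a1 by (intro order_tendstoD(2)[OF id]) simp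
    ultimately show ?thesis using ev
    proof eventually_elim
      case (elim x)
      then show ?case using lambda_min_greater_iff(1)[of x a] True by simp
    qed
  next
    case False
    from ev show ?thesis
    proof eventually_elim
      case (elim x)
      then show ?case using lambda_min(1)[of x] False by simp
    qed
  qed
next
  have ev: "\<forall>\<^sub>F x in at r. 0 < x \<and> x < 1"
    using eventually_at_in_open'[of "{0<..<1}" r] assms by simp
  have id: "((\<lambda>x. x) \<longlongrightarrow> r) (at r)" by (rule tendsto_ident_at)
  fix a assume a: "lambda_min \<delta> r < a"
  show "\<forall>\<^sub>F x in at r. lambda_min \<delta> x < a"
  proof (cases "a < 1 - r")
    case True
    have a0: "0 < a" using a lambda_min[OF assms] by linarith
    have "0 < F_min a r" using lambda_min_greater_iff(2)[of r a] True a a0 assms by simp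
    then have "\<forall>\<^sub>F x in at r. 0 < F_min a x"
      using isCont_F_min[OF assms a0] unfolding isCont_def by (rule order_tendstoD(1)[rotated])
    moreover have "\<forall>\<^sub>F x in at r. x < 1 - a" using True by (intro order_tendstoD(2)[OF id]) simp
    ultimately show ?thesis using ev
    proof eventually_elim
      case (elim x)
      then show ?case using lambda_min_greater_iff(2)[of x a] a0 by simp
    qed
  next
    case False
    \<comment> \<open>The sign test applies only to thresholds of at most \<open>1 - x\<close>. A
      midpoint below \<open>1 - r\<close> still satisfies this for all \<open>x\<close> near
      \<open>r\<close>.\<close>
    define c where "c = (lambda_min \<delta> r + (1 - r)) / 2"
    have c: "lambda_min \<delta> r < c" "c < 1 - r" "0 < c" "c < a"
      using lambda_min[OF assms] False by (auto simp: c_def)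
    have "0 < F_min c r" using lambda_min_greater_iff(2)[of r c] c assms by simp
    then have "\<forall>\<^sub>F x in at r. 0 < F_min c x"
      using isCont_F_min[OF assms c(3)] unfolding isCont_def by (rule order_tendstoD(1)[rotated])
    moreover have "\<forall>\<^sub>F x in at r. x < 1 - c" using c by (intro order_tendstoD(2)[OF id]) simp
    ultimately show ?thesis using ev
    proof eventually_elim
      case (elim x)
      then show ?case using lambda_min_greater_iff(2)[of x c] c by simp
    qed
  qed
qed

lemma continuous_on_lambda_max: "continuous_on {0<..1} (lambda_max \<delta>)"
  unfolding continuous_on_def
proof (intro ballI)
  fix r :: real assume "r \<in> {0<..1}"
  then have r: "0 < r" "r \<le> 1" by auto
  let ?F = "at r within {0<..1}"
  have ev: "\<forall>\<^sub>F x in ?F. 0 < x \<and> x \<le> 1" by (auto simp: eventually_at_filter)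
  have id: "((\<lambda>x. x) \<longlongrightarrow> r) ?F" by (rule tendsto_ident_at)
  have cont: "((\<lambda>x. F_max a x) \<longlongrightarrow> F_max a r) ?F" if "0 < a" for a
    using isCont_F_max[OF r that] unfolding isCont_def by (rule tendsto_within_subset) simp
  show "(lambda_max \<delta> \<longlongrightarrow> lambda_max \<delta> r) ?F"
  proof (rule order_tendstoI)
    fix a assume a: "a < lambda_max \<delta> r"
    \<comment> \<open>Raising the threshold strictly above \<open>1 + r\<close> makes the sign test
      applicable for all \<open>x\<close> near \<open>r\<close>.\<close>
    define c where "c = max a ((lambda_max \<delta> r + (1 + r)) / 2)"
    have "1 + r < (lambda_max \<delta> r + (1 + r)) / 2" "(lambda_max \<delta> r + (1 + r)) / 2 < lambda_max \<delta> r"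
      using lambda_max(1)[OF r] by (simp_all add: field_simps)
    then have c: "1 + r < c" "a \<le> c" "c < lambda_max \<delta> r" using a by (auto simp: c_def less_max_iff_disj)
    have "0 < F_max c r" using lambda_max_greater_iff(1)[of r c] c r by simp
    then have "\<forall>\<^sub>F x in ?F. 0 < F_max c x" using c r by (intro order_tendstoD(1)[OF cont]) auto
    moreover have "\<forall>\<^sub>F x in ?F. x < c - 1" using c by (intro order_tendstoD(2)[OF id]) simp
    ultimately show "\<forall>\<^sub>F x in ?F. a < lambda_max \<delta> x" using ev
    proof eventually_elim
      case (elim x)
      then show ?case using lambda_max_greater_iff(1)[of x c] c by simp
    qed
  next
    fix a assume a: "lambda_max \<delta> r < a"
    have a1: "1 + r < a" using a lambda_max[OF r] by linarith
    have "F_max a r < 0" using lambda_max_greater_iff(2)[of r a] a a1 r by simp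
    then have "\<forall>\<^sub>F x in ?F. F_max a x < 0" using a1 r by (intro order_tendstoD(2)[OF cont]) auto
    moreover have "\<forall>\<^sub>F x in ?F. x < a - 1" using a1 by (intro order_tendstoD(2)[OF id]) simp
    ultimately show "\<forall>\<^sub>F x in ?F. lambda_max \<delta> x < a" using ev
    proof eventually_elim
      case (elim x)
      then show ?case using lambda_max_greater_iff(2)[of x a] by simp
    qed
  qed
qed

section \<open>The minimum over the column ratio and the root \<open>rho_S_FL\<close>\<close>

definition m_max :: "real \<Rightarrow> real" where
  "m_max r = 1 + U_bound \<delta> r"

lemma
  assumes "0 < r" "r \<le> 1"
  shows m_max_attained: "\<exists>\<nu>\<in>{r..1}. m_max r = lambda_max \<delta> \<nu>"
    and m_max_le: "\<And>x. x \<in> {r..1} \<Longrightarrow> m_max r \<le> lambda_max \<delta> x"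
proof -
  have "continuous_on {r..1} (lambda_max \<delta>)"
    by (rule continuous_on_subset[OF continuous_on_lambda_max]) (use assms in auto)
  then obtain \<nu> where \<nu>: "\<nu> \<in> {r..1}" "\<And>x. x \<in> {r..1} \<Longrightarrow> lambda_max \<delta> \<nu> \<le> lambda_max \<delta> x"
    using continuous_attains_inf[of "{r..1}" "lambda_max \<delta>"] assms by auto
  have "(LEAST l. l \<in> lambda_max \<delta> ` {r..1}) = lambda_max \<delta> \<nu>"
    by (rule Least_equality) (use \<nu> in auto)
  then have "m_max r = lambda_max \<delta> \<nu>" by (simp add: m_max_def U_bound_def)
  then show "\<exists>\<nu>\<in>{r..1}. m_max r = lambda_max \<delta> \<nu>" "\<And>x. x \<in> {r..1} \<Longrightarrow> m_max r \<le> lambda_max \<delta> x"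
    using \<nu> by auto
qed

lemma m_max_mono: "0 < r \<Longrightarrow> r \<le> r' \<Longrightarrow> r' \<le> 1 \<Longrightarrow> m_max r \<le> m_max r'"
proof -
  assume r: "0 < r" "r \<le> r'" "r' \<le> 1"
  have "0 < r'" using r by linarith
  from m_max_attained[OF this r(3)] obtain \<nu> where \<nu>: "\<nu> \<in> {r'..1}" "m_max r' = lambda_max \<delta> \<nu>" by blast
  then show ?thesis using m_max_le[of r \<nu>] r by auto
qed

lemma m_max_ge_1: "0 < r \<Longrightarrow> r \<le> 1 \<Longrightarrow> 1 \<le> m_max r"
proof -
  assume r: "0 < r" "r \<le> 1"
  from m_max_attained[OF r] obtain \<nu> where \<nu>: "\<nu> \<in> {r..1}" "m_max r = lambda_max \<delta> \<nu>" by blast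
  then show ?thesis using lambda_max(1)[of \<nu>] r by auto
qed

text \<open>Moving the left endpoint from \<open>u\<close> to \<open>v\<close> only discards
  arguments between them. If the minimiser is among these, then \<open>v\<close> itself does almost
  as well, by uniform continuity of \<open>lambda_max\<close>; the other direction is
  monotonicity.\<close>

lemma continuous_on_m_max:
  assumes "0 < a" "b \<le> 1"
  shows "continuous_on {a..b} m_max"
  unfolding continuous_on_iff
proof (intro ballI allI impI)
  fix x e :: real assume x: "x \<in> {a..b}" and e: "0 < e"
  have "continuous_on {a..1} (lambda_max \<delta>)"
    by (rule continuous_on_subset[OF continuous_on_lambda_max]) (use assms in auto)
  then have "uniformly_continuous_on {a..1} (lambda_max \<delta>)"
    by (rule compact_uniformly_continuous) simp
  then obtain d where d: "0 < d" "\<And>u v. u \<in> {a..1} \<Longrightarrow> v \<in> {a..1} \<Longrightarrow> dist v u < d \<Longrightarrow> dist (lambda_max \<delta> v) (lambda_max \<delta> u) < e"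
    using e unfolding uniformly_continuous_on_def by metis
  have step: "m_max v \<le> m_max u + e \<and> m_max v < m_max u + e" if uv: "u \<in> {a..b}" "v \<in> {a..b}" "u \<le> v" "v - u < d" for u v
  proof -
    have u: "0 < u" "u \<le> 1" and v: "0 < v" "v \<le> 1" using uv assms by auto
    from m_max_attained[OF u] obtain \<nu> where \<nu>: "\<nu> \<in> {u..1}" "m_max u = lambda_max \<delta> \<nu>" by blast
    note \<mu> = m_max_le[OF v]
    show ?thesis
    proof (cases "v \<le> \<nu>")
      case True
      then show ?thesis using \<mu>[of \<nu>] \<nu> e by auto
    next
      case False
      then have "dist (lambda_max \<delta> v) (lambda_max \<delta> \<nu>) < e"
        using \<nu> uv assms by (intro d(2)) (auto simp: dist_real_def)
      then show ?thesis using \<mu>[of v] \<nu> uv assms by (auto simp: dist_real_def)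
    qed
  qed
  show "\<exists>d>0. \<forall>x'\<in>{a..b}. dist x' x < d \<longrightarrow> dist (m_max x') (m_max x) < e"
  proof (intro exI[of _ d] conjI ballI impI d(1))
    fix x' assume x': "x' \<in> {a..b}" "dist x' x < d"
    show "dist (m_max x') (m_max x) < e"
    proof (cases "x' \<le> x")
      case True
      then show ?thesis using step[of x' x] m_max_mono[of x' x] x x' assms by (auto simp: dist_real_def)
    next
      case False
      then show ?thesis using step[of x x'] m_max_mono[of x x'] x x' assms by (auto simp: dist_real_def)
    qed
  qed
qed

text \<open>The value of \<open>(1 + U_bound) / (1 - L_bound)\<close> for which \<open>mu_FL\<close>
  equals 1. With it the defining equation becomes linear in \<open>m_max\<close> and
  \<open>lambda_min\<close>.\<close>

definition gap_ratio :: real where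
  "gap_ratio = 1 + 4 / (1 + sqrt 2)"

lemma gap_ratio_ge_2: "2 \<le> gap_ratio"
proof -
  have "sqrt 2 \<le> 3" by (rule real_le_lsqrt) auto
  moreover have "0 < 1 + sqrt (2::real)" by (simp add: add_pos_pos)
  ultimately show ?thesis by (simp add: gap_ratio_def field_simps)
qed

lemma mu_FL_iff:
  assumes "0 < \<rho>" "\<rho> < 1 / 2"
  shows "mu_FL \<delta> \<rho> = 1 \<longleftrightarrow> m_max (2 * \<rho>) - gap_ratio * lambda_min \<delta> (2 * \<rho>) = 0"
proof -
  have l: "0 < lambda_min \<delta> (2 * \<rho>)" using assms by (intro lambda_min) auto
  have s: "0 < 1 + sqrt (2::real)" by (simp add: add_pos_pos)
  have "mu_FL \<delta> \<rho> = 1 \<longleftrightarrow> m_max (2 * \<rho>) / lambda_min \<delta> (2 * \<rho>) - 1 = 4 / (1 + sqrt 2)"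
  proof -
    have "s / 4 * y = 1 \<longleftrightarrow> y = 4 / s" if "0 < s" for s y :: real using that by (auto simp: field_simps)
    from this[OF s] show ?thesis by (simp add: mu_FL_def m_max_def L_bound_def)
  qed
  also have "\<dots> \<longleftrightarrow> m_max (2 * \<rho>) / lambda_min \<delta> (2 * \<rho>) = gap_ratio" by (auto simp: gap_ratio_def)
  also have "\<dots> \<longleftrightarrow> m_max (2 * \<rho>) = gap_ratio * lambda_min \<delta> (2 * \<rho>)" using l by (simp add: divide_eq_eq)
  finally show ?thesis by simp
qed

text \<open>For \<open>r\<close> tending to 0 both exponents tend to
  \<open>\<delta> / 2 * (ln l + 1 - l)\<close>, which is negative unless \<open>l = 1\<close>. So
  \<open>lambda_max\<close> falls below 6/5 and \<open>lambda_min\<close> exceeds 4/5, and the ratio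
  of these constants is below 2, hence below \<open>gap_ratio\<close>.\<close>

lemma gap_neg_near_0:
  obtains r where "0 < r" "r < 1" "m_max r - gap_ratio * lambda_min \<delta> r < 0"
proof -
  have "((\<lambda>r. F_max (6/5) r) \<longlongrightarrow> \<delta> / 2 * (ln (6/5) - 1/5)) (at_right 0)"
    unfolding F_max_def psi_max_def H_def using \<delta> by real_asymp
  moreover have "\<delta> / 2 * (ln (6/5) - 1/5) < 0"
    using ln_diff_bounds(1)[of 1 "6/5"] \<delta> by (intro mult_pos_neg) auto
  ultimately have 1: "\<forall>\<^sub>F r in at_right 0. F_max (6/5) r < 0" by (rule order_tendstoD)
  have "((\<lambda>r. F_min (4/5) r) \<longlongrightarrow> \<delta> / 2 * (ln (4/5) + 1/5)) (at_right 0)"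
    unfolding F_min_def psi_min_def H_def using \<delta> by real_asymp
  moreover have "\<delta> / 2 * (ln (4/5) + 1/5) < 0"
    using ln_diff_bounds(2)[of "4/5" 1] \<delta> by (intro mult_pos_neg) auto
  ultimately have 2: "\<forall>\<^sub>F r in at_right 0. F_min (4/5) r < 0" by (rule order_tendstoD)
  have "\<forall>\<^sub>F r in at_right (0::real). 0 < r \<and> r < 1/5"
    using eventually_at_right_less[of "0::real"] by (auto simp: eventually_at_right_field intro: exI[of _ "1/5"])
  with 1 2 have "\<forall>\<^sub>F r in at_right 0. F_max (6/5) r < 0 \<and> F_min (4/5) r < 0 \<and> 0 < r \<and> r < 1/5"
    by eventually_elim simp
  then obtain r where r: "F_max (6/5) r < 0" "F_min (4/5) r < 0" "0 < r" "r < 1/5"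
    using eventually_happens'[of "at_right (0::real)"] by (auto simp: trivial_limit_at_right_real)
  have "lambda_max \<delta> r < 6/5" using lambda_max_greater_iff(2)[of r "6/5"] r by simp
  moreover have "m_max r \<le> lambda_max \<delta> r" using r by (intro m_max_le) auto
  moreover have "4/5 < lambda_min \<delta> r" using lambda_min_greater_iff(1)[of r "4/5"] r by simp
  moreover have "2 * lambda_min \<delta> r \<le> gap_ratio * lambda_min \<delta> r"
    using gap_ratio_ge_2 lambda_min(1)[of r] r by (intro mult_right_mono) auto
  ultimately show ?thesis using that[of r] r by linarith
qed

text \<open>Shrinking the interval can only raise the minimum in \<open>m_max\<close>; strictness
  comes from \<open>lambda_min\<close> alone.\<close>

lemma gap_strict_mono:
  assumes "0 < r" "r < r'" "r' < 1"
  shows "m_max r - gap_ratio * lambda_min \<delta> r < m_max r' - gap_ratio * lambda_min \<delta> r'"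
proof -
  have "gap_ratio * lambda_min \<delta> r' < gap_ratio * lambda_min \<delta> r"
    using gap_ratio_ge_2 lambda_min_strict_antimono[OF assms] by (intro mult_strict_left_mono) auto
  then show ?thesis using m_max_mono[of r r'] assms by linarith
qed

lemma rho_S_FL_root:
  "0 < rho_S_FL \<delta>" "rho_S_FL \<delta> < 1 / 2"
  "m_max (2 * rho_S_FL \<delta>) - gap_ratio * lambda_min \<delta> (2 * rho_S_FL \<delta>) = 0"
proof -
  define D where "D r = m_max r - gap_ratio * lambda_min \<delta> r" for r
  obtain a where a: "0 < a" "a < 1" "D a < 0" using gap_neg_near_0 unfolding D_def by blast
  \<comment> \<open>Since \<open>lambda_min \<delta> b < 1 - b\<close>, this makes the subtracted
    term at most 1/2, while \<open>m_max\<close> is at least 1.\<close>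
  define b where "b = max a (1 - 1 / (2 * gap_ratio))"
  have b: "a \<le> b" "b < 1" "0 < b" using a gap_ratio_ge_2 by (auto simp: b_def)
  have "gap_ratio * lambda_min \<delta> b \<le> gap_ratio * (1 / (2 * gap_ratio))"
    using lambda_min[of b] b gap_ratio_ge_2 by (intro mult_left_mono) (auto simp: b_def)
  also have "\<dots> = 1 / 2" using gap_ratio_ge_2 by simp
  finally have Db: "0 < D b" using m_max_ge_1[of b] b by (simp add: D_def)
  have "continuous_on {a..b} (lambda_min \<delta>)"
    using a b by (intro continuous_at_imp_continuous_on ballI isCont_lambda_min) auto
  then have "continuous_on {a..b} D"
    unfolding D_def using a b by (intro continuous_intros continuous_on_m_max) auto
  then obtain r where r: "a \<le> r" "r \<le> b" "D r = 0" using IVT'[of D a 0 b] a b Db by auto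
  have r01: "0 < r" "r < 1" using r a b by linarith+
  have "rho_S_FL \<delta> = r / 2" unfolding rho_S_FL_def
  proof (rule the_equality)
    show "0 < r / 2 \<and> r / 2 < 1 / 2 \<and> mu_FL \<delta> (r / 2) = 1"
      using r(3) r01 mu_FL_iff[of "r / 2"] by (simp add: D_def)
    fix \<rho> assume *: "0 < \<rho> \<and> \<rho> < 1 / 2 \<and> mu_FL \<delta> \<rho> = 1"
    then have "D (2 * \<rho>) = 0" using mu_FL_iff[of \<rho>] by (simp add: D_def)
    then have "2 * \<rho> = r" using gap_strict_mono[of "2 * \<rho>" r] gap_strict_mono[of r "2 * \<rho>"] r(3) r01 *
      by (cases rule: linorder_cases[of "2 * \<rho>" r]) (auto simp: D_def)
    then show "\<rho> = r / 2" by simp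
  qed
  then have e: "2 * rho_S_FL \<delta> = r" by simp
  show "m_max (2 * rho_S_FL \<delta>) - gap_ratio * lambda_min \<delta> (2 * rho_S_FL \<delta>) = 0"
    unfolding e using r(3) by (simp add: D_def)
  show "0 < rho_S_FL \<delta>" "rho_S_FL \<delta> < 1 / 2"
    using e r01 by linarith+
qed

text \<open>The witness is a minimiser from \<open>U_bound\<close>. It becomes the limiting ratio of
  columns to rows in the union bound for the upper inequality.\<close>

lemma below_rho_S_FL:
  assumes "0 < \<rho>" "\<rho> < rho_S_FL \<delta>"
  obtains \<nu> where "2 * \<rho> \<le> \<nu>" "\<nu> \<le> 1" "lambda_max \<delta> \<nu> < gap_ratio * lambda_min \<delta> (2 * \<rho>)"
proof -
  have "m_max (2 * \<rho>) - gap_ratio * lambda_min \<delta> (2 * \<rho>) < 0"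
  proof -
    have "0 < 2 * \<rho>" "2 * \<rho> < 2 * rho_S_FL \<delta>" "2 * rho_S_FL \<delta> < 1"
      using rho_S_FL_root(2) assms by auto
    from gap_strict_mono[OF this] show ?thesis by (simp only: rho_S_FL_root(3))
  qed
  moreover have "0 < 2 * \<rho>" "2 * \<rho> \<le> 1" using assms rho_S_FL_root(2) by auto
  from m_max_attained[OF this] obtain \<nu> where "\<nu> \<in> {2 * \<rho>..1}" "m_max (2 * \<rho>) = lambda_max \<delta> \<nu>" by blast
  ultimately show ?thesis using that by auto
qed

end

section \<open>Exponents\<close>

text \<open>\<open>(1 - sqrt r)\<^sup>2\<close> is the left edge of the Marchenko-Pastur law, the
  almost sure limit of the least eigenvalue. A nonnegative value there confines negative values of
  \<open>psi_min\<close> to \<open>l\<close> below the edge. In \<open>s = sqrt r\<close> the bounds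
  \<open>ln s \<le> s - 1\<close> and \<open>ln (1 + s) \<le> s\<close> cancel exactly.\<close>

lemma psi_min_edge_nonneg:
  assumes "0 < r" "r < 1"
  shows "0 \<le> psi_min ((1 - sqrt r)\<^sup>2) r"
proof -
  define s where "s = sqrt r"
  have s: "0 < s" "s < 1" "r = s\<^sup>2" using assms by (auto simp: s_def)
  have lnr: "ln r = 2 * ln s" "ln ((1 - s)\<^sup>2) = 2 * ln (1 - s)" using s by (simp_all add: ln_realpow)
  have "1 - r = (1 - s) * (1 + s)" unfolding s(3) by (simp add: power2_eq_square algebra_simps)
  then have ln1: "ln (1 - r) = ln (1 - s) + ln (1 + s)" using s by (simp add: ln_mult)
  have "psi_min ((1 - s)\<^sup>2) r = s * (1 - s) - s\<^sup>2 * ln s - (1 - s\<^sup>2) * ln (1 + s)"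
    unfolding psi_min_def H_eq[OF assms] lnr ln1 unfolding s(3)
    by (simp add: field_simps power2_eq_square)
  moreover have "s\<^sup>2 * ln s \<le> s\<^sup>2 * (s - 1)"
    using ln_le_minus_one[of s] s by (intro mult_left_mono) auto
  moreover have "(1 - s\<^sup>2) * ln (1 + s) \<le> (1 - s\<^sup>2) * s"
    using ln_add_one_self_le_self[of s] s by (intro mult_left_mono) (auto simp: power_le_one)
  moreover have "s * (1 - s) - s\<^sup>2 * (s - 1) - (1 - s\<^sup>2) * s = 0"
    by (simp add: algebra_simps power2_eq_square)
  moreover have "0 \<le> x" if "x = A - B - C" "B \<le> B'" "C \<le> C'" "A - B' - C' = 0" for x A B C B' C' :: real
    using that by linarith
  ultimately show ?thesis unfolding s_def[symmetric] by blast
qed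

text \<open>The right edge of the Marchenko-Pastur law. Here the logarithm bounds leave the surplus
  \<open>s ^ 3 * (1 - s) / (1 + s)\<close>.\<close>

lemma psi_max_edge_nonneg:
  assumes "0 < r" "r \<le> 1"
  shows "0 \<le> psi_max ((1 + sqrt r)\<^sup>2) r"
proof -
  define s where "s = sqrt r"
  have s: "0 < s" "s \<le> 1" "r = s\<^sup>2" using assms by (auto simp: s_def)
  have lnr: "ln r = 2 * ln s" "ln ((1 + s)\<^sup>2) = 2 * ln (1 + s)" using s by (simp_all add: ln_realpow)
  have "psi_max ((1 + s)\<^sup>2) r = (1 + s\<^sup>2) * ln (1 + s) - s\<^sup>2 * ln s - s"
    unfolding psi_max_def lnr unfolding s(3) by (simp add: field_simps power2_eq_square)
  moreover have "s\<^sup>2 * ln s \<le> s\<^sup>2 * (s - 1)"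
    using ln_le_minus_one[of s] s by (intro mult_left_mono) auto
  moreover have "(1 + s\<^sup>2) * (s / (1 + s)) \<le> (1 + s\<^sup>2) * ln (1 + s)"
    using ln_diff_bounds(2)[of 1 "1 + s"] s by (intro mult_left_mono) auto
  moreover have "(1 + s\<^sup>2) * (s / (1 + s)) - s\<^sup>2 * (s - 1) - s = s ^ 3 * (1 - s) / (1 + s)"
    using s by (simp add: field_simps power2_eq_square power3_eq_cube)
  moreover have "0 \<le> s ^ 3 * (1 - s) / (1 + s)" using s by simp
  moreover have "0 \<le> x" if "x = A - B - s" "B \<le> B'" "A' \<le> A" "A' - B' - s = C" "0 \<le> C" for x A B A' B' C :: real
    using that by linarith
  ultimately show ?thesis unfolding s_def[symmetric] by blast
qed

text \<open>The parameters below optimise the Chernoff bounds for the extreme singular values; the resulting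
  exponents are the large deviation rates, which are at most \<open>2 * psi_min\<close> and \<open>2 * psi_max\<close>.\<close>

lemma psi_min_exponent:
  assumes r: "0 < r" "r < 1" and l: "0 < l" "l \<le> 1 - r" and neg: "psi_min l r < 0"
  shows "\<exists>s \<tau>. 0 < s \<and> s < 1 / 2 \<and> 0 < \<tau> \<and>
    \<tau> * l - r * ln (1 - 2 * s) - (1 - r) * ln (1 + 2 * s * \<tau>) \<le> 2 * psi_min l r"
proof -
  define s0 where "s0 = sqrt r"
  have s0: "0 < s0" "s0 < 1" "s0 * s0 = r" using r by (auto simp: s0_def)
  have rs0: "r < s0" using s0 mult_strict_right_mono[of s0 1 s0] by simp
  have "l < (1 - s0)\<^sup>2"
  proof (rule ccontr)
    assume "\<not> l < (1 - s0)\<^sup>2"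
    then have "(1 - s0)\<^sup>2 = l \<or> (1 - s0)\<^sup>2 < l" by linarith
    moreover have "0 < (1 - s0)\<^sup>2" using s0 by simp
    ultimately have "psi_min ((1 - s0)\<^sup>2) r \<le> psi_min l r"
      using psi_min_strict_mono[of "(1 - s0)\<^sup>2" l r] l by fastforce
    then show False using psi_min_edge_nonneg[OF r, folded s0_def] neg by linarith
  qed
  moreover have "(1 - s0)\<^sup>2 = 1 + r - s0 - r / s0"
    using s0 by (simp add: power2_eq_square field_simps)
  \<comment> \<open>The substitution \<open>l = 1 + r - c - r / c\<close> rationalises the
    stationary point of the Chernoff bound. It takes \<open>c = s0\<close> to the spectral edge and
    \<open>c = 1\<close> to 0, so every \<open>l\<close> below the edge is reached.\<close>
  moreover have "continuous_on {s0..1} (\<lambda>c. 1 + r - c - r / c)"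
    using s0 by (auto intro!: continuous_intros)
  ultimately obtain c where c: "s0 \<le> c" "c \<le> 1" "1 + r - c - r / c = l"
    using IVT2'[of "\<lambda>c. 1 + r - c - r / c" 1 l s0] s0 l by auto
  have c1: "c < 1" using c l by (cases "c = 1") auto
  have c0: "0 < c" "r < c" using c s0 rs0 by auto
  have lc: "l = (c - r) * (1 - c) / c" using c c0 by (simp add: field_simps)
  \<comment> \<open>The amount by which \<open>2 * psi_min\<close> exceeds the optimised exponent,
    as a function of the new parameter. It vanishes at 1 and decreases towards it, so it is
    nonnegative at \<open>c\<close>.\<close>
  define D where "D x = (1 - r) * ln ((x - r) / (1 - r)) - ln x + r * (1 - x) / x" for x
  have "D 1 \<le> D c"
  proof (rule DERIV_nonpos_imp_nonincreasing[OF less_imp_le[OF c1]])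
    fix x assume x: "c \<le> x" "x \<le> 1"
    then have x0: "0 < x" "r < x" "x \<noteq> 0" using c0 by linarith+
    have sx: "s0 \<le> x" using c x by linarith
    have "(D has_real_derivative (1 - r) / (x - r) - 1 / x - r / x\<^sup>2) (at x)"
    proof -
      have "((\<lambda>x. r * (1 - x) / x) has_real_derivative (r * (0 - 1) * x - r * (1 - x) * 1) / (x * x)) (at x)"
        using x0 by (intro DERIV_divide DERIV_cmult DERIV_diff DERIV_const DERIV_ident) auto
      moreover have "(r * (0 - 1) * x - r * (1 - x) * 1) / (x * x) = - r / x\<^sup>2"
        by (simp add: power2_eq_square algebra_simps)
      ultimately have d1: "((\<lambda>x. r * (1 - x) / x) has_real_derivative - r / x\<^sup>2) (at x)" by simp
      have d2: "((\<lambda>x. (1 - r) * ln ((x - r) / (1 - r))) has_real_derivative (1 - r) / (x - r)) (at x)"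
        using x0 r by (auto intro!: derivative_eq_intros)
      have d3: "((\<lambda>x. ln x) has_real_derivative 1 / x) (at x)" using x0 by (auto intro!: derivative_eq_intros)
      show ?thesis unfolding D_def[abs_def]
        by (rule DERIV_cong[OF DERIV_add[OF DERIV_diff[OF d2 d3] d1]]) simp
    qed
    moreover have "(1 - r) / (x - r) - 1 / x - r / x\<^sup>2 = r * (r - x\<^sup>2) / (x\<^sup>2 * (x - r))"
      using x0 by (simp add: divide_simps) (simp add: algebra_simps power2_eq_square)
    moreover have "r * (r - x\<^sup>2) / (x\<^sup>2 * (x - r)) \<le> 0"
    proof -
      have "s0 * s0 \<le> x * x" using sx x0 s0 by (intro mult_mono) auto
      then have "r - x\<^sup>2 \<le> 0" using s0 by (simp add: power2_eq_square)
      then show ?thesis using x0 r by (intro divide_nonpos_nonneg mult_nonneg_nonpos) auto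
    qed
    ultimately show "\<exists>y. (D has_real_derivative y) (at x) \<and> y \<le> 0" by metis
  qed
  moreover have "D 1 = 0" using r by (simp add: D_def)
  ultimately have D: "0 \<le> D c" by simp
  \<comment> \<open>With \<tau> as below, the stationary point of the exponent: it solves
    \<open>l * (1 + 2 * s * \<tau>) = 2 * s * (1 - r)\<close> and
    \<open>r * (1 + 2 * s * \<tau>) = \<tau> * (1 - r) * (1 - 2 * s)\<close>.\<close>
  define s where "s = (1 - r / c) / 2"
  define \<tau> where "\<tau> = c / (1 - c)"
  have s: "0 < s" "s < 1 / 2" using c0 r by (auto simp: s_def)
  have t: "0 < \<tau>" using c0 c1 by (simp add: \<tau>_def)
  have s2: "2 * s = 1 - r / c" unfolding s_def by (simp only: times_divide_eq_right nonzero_mult_div_cancel_left[OF zero_neq_numeral[symmetric]])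
  have e1: "1 - 2 * s = r / c" unfolding s2 by simp
  have e2: "1 + 2 * s * \<tau> = (1 - r) / (1 - c)" unfolding s2 \<tau>_def using c0 c1 by (simp add: field_simps)
  have e3: "\<tau> * l = c - r" unfolding lc \<tau>_def using c0 c1 by simp
  have lnl: "ln l = ln (c - r) + ln (1 - c) - ln c" unfolding lc using c0 c1 by (simp add: ln_div ln_mult)
  have "2 * psi_min l r - (\<tau> * l - r * ln (1 - 2 * s) - (1 - r) * ln (1 + 2 * s * \<tau>)) = D c"
  proof -
    have Dc: "D c = (1 - r) * (ln (c - r) - ln (1 - r)) - ln c + r / c - r"
      using c0 r by (simp add: D_def ln_div field_simps)
    have E: "\<tau> * l - r * ln (1 - 2 * s) - (1 - r) * ln (1 + 2 * s * \<tau>)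
        = (c - r) - r * (ln r - ln c) - (1 - r) * (ln (1 - r) - ln (1 - c))"
      unfolding e1 e2 e3 using c0 c1 r by (simp add: ln_div)
    have P: "2 * psi_min l r = 2 * (- r * ln r - (1 - r) * ln (1 - r)) + ((1 - r) * (ln (c - r) + ln (1 - c) - ln c) + 1 - r + r * ln r - (1 + r - c - r / c))"
      unfolding psi_min_def H_eq[OF r] lnl c(3) by simp
    show ?thesis unfolding Dc E P by (simp add: algebra_simps)
  qed
  then show ?thesis using s t D by (intro exI[of _ s] exI[of _ \<tau>]) auto
qed

lemma psi_max_exponent:
  assumes r: "0 < r" "r \<le> 1" and l: "1 + r \<le> l" and neg: "psi_max l r < 0"
  shows "\<exists>P Q. 0 < P \<and> P < 1 \<and> 0 < Q \<and> Q < 1 \<and>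
    - (P * Q * l) - ln (1 - P) - r * ln (1 - Q) \<le> 2 * psi_max l r"
proof -
  define s0 where "s0 = sqrt r"
  have s0: "0 < s0" "s0 * s0 = r" using r by (auto simp: s0_def)
  have "(1 + s0)\<^sup>2 < l"
  proof (rule ccontr)
    assume "\<not> (1 + s0)\<^sup>2 < l"
    then have "l = (1 + s0)\<^sup>2 \<or> l < (1 + s0)\<^sup>2" by linarith
    then have "psi_max ((1 + s0)\<^sup>2) r \<le> psi_max l r"
      using psi_max_strict_antimono[of r l "(1 + s0)\<^sup>2"] l r by fastforce
    then show False using psi_max_edge_nonneg[OF r, folded s0_def] neg by linarith
  qed
  moreover have "(1 + s0)\<^sup>2 = 1 + r + s0 + r / s0"
    using s0 by (simp add: power2_eq_square field_simps)
  \<comment> \<open>The substitution is now \<open>l = 1 + r + a + r / a\<close>. It gives the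
    spectral edge at \<open>a = s0\<close> and more than \<open>l\<close> at \<open>a = l\<close>,
    so a solution lies between.\<close>
  moreover have "continuous_on {s0..l} (\<lambda>a. 1 + r + a + r / a)"
    using s0 by (auto intro!: continuous_intros)
  moreover have "s0 \<le> l"
  proof -
    have "0 \<le> 1 + s0 + s0 * s0" using s0(1) by (intro add_nonneg_nonneg) auto
    then have "s0 \<le> (1 + s0)\<^sup>2" by (simp add: power2_eq_square algebra_simps)
    then show ?thesis using calculation(1) by linarith
  qed
  moreover have "l \<le> 1 + r + l + r / l" using r l by simp
  ultimately obtain a where a: "s0 \<le> a" "1 + r + a + r / a = l"
    using IVT'[of "\<lambda>a. 1 + r + a + r / a" s0 l l] by auto
  have a0: "0 < a" using a s0 by linarith
  have "s0 * s0 \<le> a * a" using a s0 by (intro mult_mono) auto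
  then have raa: "r \<le> a * a" using s0 by simp
  have la: "l = (1 + a) * (a + r) / a" using a a0 by (simp add: field_simps)
  \<comment> \<open>Stationarity of the exponent in \<open>P\<close> and \<open>Q\<close> means
    \<open>Q * l = 1 / (1 - P)\<close> and \<open>P * l = r / (1 - Q)\<close>. Both hold for these
    values, the two sides being \<open>1 + a\<close> and \<open>a + r\<close>.\<close>
  define P where "P = a / (1 + a)"
  define Q where "Q = a / (a + r)"
  have PQ: "0 < P" "P < 1" "0 < Q" "Q < 1" using a0 r by (auto simp: P_def Q_def)
  have ar: "0 < a + r" using a0 r by simp
  have e1: "1 - P = 1 / (1 + a)" using a0 by (simp add: P_def field_simps)
  have e2: "1 - Q = r / (a + r)" using ar by (simp add: Q_def field_simps)
  have e3: "P * Q * l = a" unfolding la P_def Q_def using a0 ar by (simp add: divide_simps)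
  have lnl: "ln l = ln (1 + a) + ln (a + r) - ln a" unfolding la using a0 ar by (simp add: ln_div ln_mult)
  have "2 * psi_max l r - (- (P * Q * l) - ln (1 - P) - r * ln (1 - Q))
     = (ln (a + r) - ln a) + r * (ln (1 + a) - ln a) - r / a"
  proof -
    have E: "- (P * Q * l) - ln (1 - P) - r * ln (1 - Q) = - a + ln (1 + a) - r * (ln r - ln (a + r))"
      unfolding e1 e2 e3 using a0 ar r by (simp add: ln_div)
    have P: "2 * psi_max l r = (1 + r) * (ln (1 + a) + ln (a + r) - ln a) + 1 + r - r * ln r - (1 + r + a + r / a)"
      unfolding psi_max_def lnl a(2) by simp
    show ?thesis unfolding E P by (simp add: algebra_simps)
  qed
  moreover have "r / (a + r) \<le> ln (a + r) - ln a"
    using ln_diff_bounds(2)[of a "a + r"] a0 r by simp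
  moreover have "r * (1 / (1 + a)) \<le> r * (ln (1 + a) - ln a)"
    using ln_diff_bounds(2)[of a "1 + a"] a0 r by (intro mult_left_mono) auto
  \<comment> \<open>After clearing denominators this is \<open>r \<le> a * a\<close>: the parameter
    belongs to an \<open>l\<close> beyond the spectral edge.\<close>
  moreover have "r / a \<le> r / (a + r) + r * (1 / (1 + a))"
  proof -
    have "r / a - r / (a + r) = r * (r / (a * (a + r)))" using a0 ar by (simp add: field_simps)
    also have "r / (a * (a + r)) \<le> 1 / (1 + a)"
      using raa a0 ar by (simp add: divide_simps) (simp add: algebra_simps)
    then have "r * (r / (a * (a + r))) \<le> r * (1 / (1 + a))" using r by (intro mult_left_mono) auto
    finally show ?thesis by linarith
  qed
  ultimately have "- (P * Q * l) - ln (1 - P) - r * ln (1 - Q) \<le> 2 * psi_max l r" by linarith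
  then show ?thesis using PQ by blast
qed

text \<open>One term of the binomial expansion of \<open>(p + (1 - p)) ^ N\<close> is at most 1. Any
  fixed \<open>p\<close> is allowed; taking the limit of \<open>K / N\<close> gives the entropy rate
  without Stirling's formula.\<close>

lemma binomial_le_exp:
  assumes "K \<le> N" "0 < p" "p < 1"
  shows "real (N choose K) \<le> exp (- (real K * ln p) - (real N - real K) * ln (1 - p))"
proof -
  have "real (N choose K) * p ^ K * (1 - p) ^ (N - K) \<le> (\<Sum>i\<le>N. real (N choose i) * p ^ i * (1 - p) ^ (N - i))"
    using assms by (intro member_le_sum) auto
  also have "\<dots> = 1" using binomial_ring[of p "1 - p" N] by simp
  finally have "real (N choose K) * (p ^ K * (1 - p) ^ (N - K)) \<le> 1" by (simp add: mult.assoc)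
  moreover have "p ^ K * (1 - p) ^ (N - K) = exp (real K * ln p + (real N - real K) * ln (1 - p))"
    using assms by (simp add: exp_add exp_of_nat_mult of_nat_diff[symmetric] del: of_nat_diff)
  ultimately have "real (N choose K) * exp (real K * ln p + (real N - real K) * ln (1 - p)) \<le> 1" by simp
  then have "real (N choose K) \<le> 1 / exp (real K * ln p + (real N - real K) * ln (1 - p))"
    by (simp add: pos_le_divide_eq)
  also have "\<dots> = exp (- (real K * ln p + (real N - real K) * ln (1 - p)))"
    by (simp only: exp_minus inverse_eq_divide)
  finally show ?thesis by simp
qed

lemma exp_tendsto_0_of_ratio:
  assumes n: "filterlim n at_top sequentially" and f: "(\<lambda>j. f j / real (n j)) \<longlonglongrightarrow> c" and c: "c < 0"
  shows "(\<lambda>j. exp (f j)) \<longlonglongrightarrow> 0"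
proof -
  have n': "filterlim (\<lambda>j. real (n j)) at_top sequentially"
    by (rule filterlim_compose[OF filterlim_real_sequentially n])
  have "filterlim (\<lambda>j. f j / real (n j) * real (n j)) at_bot sequentially"
    by (rule filterlim_tendsto_neg_mult_at_bot[OF f c n'])
  moreover have "\<forall>\<^sub>F j in sequentially. f j / real (n j) * real (n j) = f j"
    using eventually_gt_at_top[of 0] filterlim_at_top_dense[THEN iffD1, OF n'] 
    by (auto elim!: eventually_mono dest!: spec[of _ 0])
  ultimately have "filterlim f at_bot sequentially"
    by (rule filterlim_cong[THEN iffD1, OF refl refl, rotated])
  then show ?thesis by (rule filterlim_compose[OF exp_at_bot])
qed

section \<open>Strong equivalence as a random event\<close>

text \<open>The null space property. It is stated for functions on all index pairs, whatever the
  size of the matrix, so that matrices are points of one product space with its topology and Borel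
  sets.\<close>

definition nsp :: "nat \<Rightarrow> nat \<Rightarrow> nat \<Rightarrow> (nat \<times> nat \<Rightarrow> real) \<Rightarrow> bool" where
  "nsp k n N a \<longleftrightarrow> (\<forall>x. (\<forall>i<n. (\<Sum>j<N. a (i, j) * x j) = 0) \<longrightarrow> (\<exists>j<N. x j \<noteq> 0) \<longrightarrow>
     (\<forall>S\<subseteq>{..<N}. card S \<le> k \<longrightarrow> (\<Sum>j\<in>S. \<bar>x j\<bar>) < (\<Sum>j\<in>{..<N} - S. \<bar>x j\<bar>)))"

lemma mult_mat_vec_eq_iff:
  fixes A :: "real mat"
  assumes "A \<in> carrier_mat n N" "z \<in> carrier_vec N" "x \<in> carrier_vec N"
  shows "A *\<^sub>v z = A *\<^sub>v x \<longleftrightarrow> (\<forall>i<n. (\<Sum>j<N. index_mat A (i, j) * (vec_index z j - vec_index x j)) = 0)"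
proof -
  have "vec_index (A *\<^sub>v y) i = (\<Sum>j<N. index_mat A (i, j) * vec_index y j)" if "i < n" "y \<in> carrier_vec N" for i y
    using assms(1) that by (auto simp: scalar_prod_def lessThan_atLeast0)
  then show ?thesis using assms
    by (auto simp: Matrix.vec_eq_iff right_diff_distrib sum_subtractf)
qed

text \<open>A kernel vector is its part on \<open>S\<close> minus the negated rest, and these two
  vectors have the same image: the sparse one is the unique minimiser only if it is strictly
  shorter. Conversely, the triangle inequality on the support of \<open>x\<close> shows that adding
  a nonzero kernel vector increases the \<open>l1\<close> norm.\<close>

lemma strong_equiv_iff_nsp:
  assumes A: "A \<in> carrier_mat n N"
  shows "strong_equiv k A \<longleftrightarrow> nsp k n N (index_mat A)"
proof
  assume strong: "strong_equiv k A"
  show "nsp k n N (index_mat A)" unfolding nsp_def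
  proof (intro allI impI)
    fix x :: "nat \<Rightarrow> real" and S
    assume ker: "\<forall>i<n. (\<Sum>j<N. index_mat A (i, j) * x j) = 0" and nz: "\<exists>j<N. x j \<noteq> 0"
      and S: "S \<subseteq> {..<N}" "card S \<le> k"
    define v where "v = Matrix.vec N (\<lambda>j. if j \<in> S then x j else 0)"
    define z where "z = Matrix.vec N (\<lambda>j. if j \<in> S then 0 else - x j)"
    have carr: "v \<in> carrier_vec N" "z \<in> carrier_vec N" by (simp_all add: v_def z_def)
    have finS: "finite S" using S(1) finite_subset by blast
    have "sparse k v"
    proof -
      have "{i. i < dim_vec v \<and> vec_index v i \<noteq> 0} \<subseteq> S" by (auto simp: v_def split: if_splits)
      then show ?thesis using card_mono[OF finS] S(2) unfolding sparse_def by (meson order_trans)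
    qed
    then have sol: "l1_solutions A (A *\<^sub>v v) = {v}"
      using strong carr A by (simp add: strong_equiv_def)
    have "A *\<^sub>v z = A *\<^sub>v v"
    proof -
      have "(\<Sum>j<N. index_mat A (i, j) * (vec_index z j - vec_index v j)) = - (\<Sum>j<N. index_mat A (i, j) * x j)" for i
        unfolding sum_negf[symmetric] by (intro sum.cong) (auto simp: v_def z_def)
      then show ?thesis unfolding mult_mat_vec_eq_iff[OF A carr(2,1)] using ker by simp
    qed
    have "z \<noteq> v"
    proof
      assume eq: "z = v"
      obtain j where j: "j < N" "x j \<noteq> 0" using nz by auto
      have "vec_index z j = vec_index v j" using eq by simp
      then show False using j by (auto simp: v_def z_def split: if_splits)
    qed
    have l1v: "l1_norm v = (\<Sum>j\<in>S. \<bar>x j\<bar>)"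
    proof -
      have "l1_norm v = (\<Sum>j<N. if j \<in> S then \<bar>x j\<bar> else 0)"
        unfolding l1_norm_def by (intro sum.cong) (auto simp: v_def)
      also have "\<dots> = (\<Sum>j\<in>{..<N} \<inter> S. \<bar>x j\<bar>)" by (simp add: sum.inter_restrict)
      finally show ?thesis using S(1) by (simp add: Int_absorb1)
    qed
    have l1z: "l1_norm z = (\<Sum>j\<in>{..<N} - S. \<bar>x j\<bar>)"
    proof -
      have "l1_norm z = (\<Sum>j<N. if j \<in> - S then \<bar>x j\<bar> else 0)"
        unfolding l1_norm_def by (intro sum.cong) (auto simp: z_def)
      also have "\<dots> = (\<Sum>j\<in>{..<N} \<inter> - S. \<bar>x j\<bar>)" by (simp add: sum.inter_restrict)
      finally show ?thesis by (simp add: Diff_eq)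
    qed
    show "(\<Sum>j\<in>S. \<bar>x j\<bar>) < (\<Sum>j\<in>{..<N} - S. \<bar>x j\<bar>)"
    proof (rule ccontr)
      assume "\<not> ?thesis"
      then have le: "l1_norm z \<le> l1_norm v" by (simp add: l1v l1z)
      have "v \<in> l1_solutions A (A *\<^sub>v v)" by (simp add: sol)
      then have "z \<in> l1_solutions A (A *\<^sub>v v)"
        using le carr A \<open>A *\<^sub>v z = A *\<^sub>v v\<close> unfolding l1_solutions_def by fastforce
      then show False using sol \<open>z \<noteq> v\<close> by simp
    qed
  qed
next
  assume nsp: "nsp k n N (index_mat A)"
  show "strong_equiv k A" unfolding strong_equiv_def
  proof (intro ballI impI)
    fix x :: "real Matrix.vec" assume x: "x \<in> carrier_vec (dim_col A)" "sparse k x"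
    have xN: "x \<in> carrier_vec N" using x A by simp
    define S where "S = {j. j < N \<and> vec_index x j \<noteq> 0}"
    have dx: "dim_vec x = N" using xN by auto
    have S: "S \<subseteq> {..<N}" "finite S" by (auto simp: S_def)
    have cS: "card S \<le> k" using x(2) unfolding sparse_def dx S_def .
    have less: "l1_norm x < l1_norm z" if z: "z \<in> carrier_vec N" "A *\<^sub>v z = A *\<^sub>v x" "z \<noteq> x" for z
    proof -
      define v where "v j = vec_index z j - vec_index x j" for j
      have "\<forall>i<n. (\<Sum>j<N. index_mat A (i, j) * v j) = 0"
        using mult_mat_vec_eq_iff[OF A z(1) xN] z(2) by (simp add: v_def)
      moreover have "\<exists>j<N. v j \<noteq> 0"
      proof (rule ccontr)
        assume "\<not> ?thesis"
        then have "z = x" using z(1) xN by (intro Matrix.eq_vecI) (auto simp: v_def)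
        then show False using z(3) by simp
      qed
      ultimately have v: "(\<Sum>j\<in>S. \<bar>v j\<bar>) < (\<Sum>j\<in>{..<N} - S. \<bar>v j\<bar>)"
        using nsp S(1) cS unfolding nsp_def by blast
      have split: "(\<Sum>j<N. f j) = (\<Sum>j\<in>S. f j) + (\<Sum>j\<in>{..<N} - S. f j)" for f :: "nat \<Rightarrow> real"
        using S(1) by (simp add: add.commute sum.subset_diff)
      have x0: "vec_index x j = 0" if "j \<in> {..<N} - S" for j using that by (auto simp: S_def)
      have "l1_norm x = (\<Sum>j\<in>S. \<bar>vec_index x j\<bar>)"
        unfolding l1_norm_def using xN by (simp add: split x0)
      also have "\<dots> \<le> (\<Sum>j\<in>S. \<bar>vec_index z j\<bar> + \<bar>v j\<bar>)"
        by (intro sum_mono) (auto simp: v_def)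
      also have "\<dots> = (\<Sum>j\<in>S. \<bar>vec_index z j\<bar>) + (\<Sum>j\<in>S. \<bar>v j\<bar>)" by (rule sum.distrib)
      also have "\<dots> < (\<Sum>j\<in>S. \<bar>vec_index z j\<bar>) + (\<Sum>j\<in>{..<N} - S. \<bar>v j\<bar>)" using v by simp
      also have "(\<Sum>j\<in>{..<N} - S. \<bar>v j\<bar>) = (\<Sum>j\<in>{..<N} - S. \<bar>vec_index z j\<bar>)"
        by (intro sum.cong refl) (simp add: v_def x0)
      also have "(\<Sum>j\<in>S. \<bar>vec_index z j\<bar>) + \<dots> = l1_norm z"
        unfolding l1_norm_def using z(1) by (simp add: split)
      finally show ?thesis .
    qed
    have le: "l1_norm x \<le> l1_norm z" if "z \<in> carrier_vec N" "A *\<^sub>v z = A *\<^sub>v x" for z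
      using less[OF that] by (cases "z = x") auto
    have dim: "dim_col A = N" using A by simp
    show "l1_solutions A (A *\<^sub>v x) = {x}"
    proof
      show "{x} \<subseteq> l1_solutions A (A *\<^sub>v x)"
        unfolding l1_solutions_def dim using le xN by auto
      show "l1_solutions A (A *\<^sub>v x) \<subseteq> {x}"
      proof
        fix z assume "z \<in> l1_solutions A (A *\<^sub>v x)"
        then have z: "z \<in> carrier_vec N" "A *\<^sub>v z = A *\<^sub>v x" "l1_norm z \<le> l1_norm x"
          using xN unfolding l1_solutions_def dim by auto
        then show "z \<in> {x}" using less[OF z(1,2)] by (cases "z = x") auto
      qed
    qed
  qed
qed

text \<open>The tube lemma: projection along a compact factor is a closed map.\<close>

lemma closed_projection_compact:
  fixes U :: "('a::topological_space \<times> 'b::topological_space) set"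
  assumes "closed U" "compact C"
  shows "closed {a. \<exists>x\<in>C. (a, x) \<in> U}"
proof -
  have comp: "compact_space (top_of_set C)"
    using assms(2) by (simp add: compact_space_subtopology compactin_euclidean_iff)
  have "closed_map (prod_topology euclidean (top_of_set C)) euclidean fst"
    by (rule Abstract_Topological_Spaces.closed_map_fst[OF comp])
  moreover have "closedin (prod_topology euclidean (top_of_set C)) (U \<inter> (UNIV \<times> C))"
  proof -
    have "prod_topology euclidean (top_of_set C) = subtopology euclidean (UNIV \<times> C :: ('a \<times> 'b) set)"
      using prod_topology_subtopology(2)[of "euclidean :: 'a topology" "euclidean :: 'b topology" C]
      by (simp only: prod_topology_euclidean topspace_euclidean)
    moreover have "U \<inter> (UNIV \<times> C) = (UNIV \<times> C) \<inter> U" by (rule Int_commute)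
    ultimately show ?thesis using closedin_closed_Int[OF assms(1), of "UNIV \<times> C"] by simp
  qed
  ultimately have "closedin euclidean (fst ` (U \<inter> (UNIV \<times> C)))" unfolding closed_map_def by blast
  moreover have "fst ` (U \<inter> (UNIV \<times> C)) = {a. \<exists>x\<in>C. (a, x) \<in> U}" by force
  ultimately show ?thesis by simp
qed

text \<open>A violating kernel vector may be scaled to \<open>l1\<close> norm 1 and set to zero
  beyond \<open>N\<close>. Such vectors form a compact set by Tychonoff's theorem, lying in the
  kernel is a closed condition on matrix and vector jointly, and only finitely many \<open>S\<close>
  occur.\<close>

lemma closed_not_nsp: "closed {a. \<not> nsp k n N a}"
proof -
  define C where "C S = {x :: nat \<Rightarrow> real. (\<forall>j. x j \<in> (if j < N then {-1..1} else {0})) \<and>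
     (\<Sum>j<N. \<bar>x j\<bar>) = 1 \<and> (\<Sum>j\<in>{..<N} - S. \<bar>x j\<bar>) \<le> (\<Sum>j\<in>S. \<bar>x j\<bar>)}" for S
  define U where "U = {p :: (nat \<times> nat \<Rightarrow> real) \<times> (nat \<Rightarrow> real). \<forall>i<n. (\<Sum>j<N. fst p (i, j) * snd p j) = 0}"
  have coord: "continuous_on UNIV (\<lambda>x :: nat \<Rightarrow> real. \<bar>x j\<bar>)" for j
    by (intro continuous_intros continuous_on_product_coordinates)
  have compC: "compact (C S)" for S
  proof -
    have "compactin (product_topology (\<lambda>_. euclidean) UNIV) (PiE UNIV (\<lambda>j. if j < N then {-1..1} else {0 :: real}))"
      unfolding compactin_PiE by (auto simp: compactin_euclidean_iff)
    then have "compact (PiE UNIV (\<lambda>j. if j < N then {-1..1} else {0 :: real}))"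
      by (simp add: euclidean_product_topology compactin_euclidean_iff)
    moreover have "closed {x :: nat \<Rightarrow> real. (\<Sum>j<N. \<bar>x j\<bar>) = 1}"
      by (intro closed_Collect_eq continuous_on_sum coord continuous_on_const)
    moreover have "closed {x :: nat \<Rightarrow> real. (\<Sum>j\<in>{..<N} - S. \<bar>x j\<bar>) \<le> (\<Sum>j\<in>S. \<bar>x j\<bar>)}"
      by (intro closed_Collect_le continuous_on_sum coord)
    ultimately have "compact (PiE UNIV (\<lambda>j. if j < N then {-1..1} else {0 :: real}) \<inter>
        ({x. (\<Sum>j<N. \<bar>x j\<bar>) = 1} \<inter> {x. (\<Sum>j\<in>{..<N} - S. \<bar>x j\<bar>) \<le> (\<Sum>j\<in>S. \<bar>x j\<bar>)}))"
      by (intro compact_Int_closed closed_Int)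
    moreover have "C S = PiE UNIV (\<lambda>j. if j < N then {-1..1} else {0 :: real}) \<inter>
        ({x. (\<Sum>j<N. \<bar>x j\<bar>) = 1} \<inter> {x. (\<Sum>j\<in>{..<N} - S. \<bar>x j\<bar>) \<le> (\<Sum>j\<in>S. \<bar>x j\<bar>)})"
      by (simp only: C_def PiE_iff extensional_UNIV set_eq_iff mem_Collect_eq Int_iff ball_UNIV UNIV_I simp_thms)
    ultimately show ?thesis by simp
  qed
  have closedU: "closed U"
  proof -
    have c1: "continuous_on UNIV (\<lambda>p :: (nat \<times> nat \<Rightarrow> real) \<times> (nat \<Rightarrow> real). fst p q)" for q
      by (rule continuous_on_compose2[OF continuous_on_product_coordinates[of q] continuous_on_fst[OF continuous_on_id]]) auto
    have c2: "continuous_on UNIV (\<lambda>p :: (nat \<times> nat \<Rightarrow> real) \<times> (nat \<Rightarrow> real). snd p j)" for j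
      by (rule continuous_on_compose2[OF continuous_on_product_coordinates[of j] continuous_on_snd[OF continuous_on_id]]) auto
    have "U = (\<Inter>i\<in>{..<n}. {p. (\<Sum>j<N. fst p (i, j) * snd p j) = 0})" by (auto simp: U_def)
    moreover have "closed {p :: (nat \<times> nat \<Rightarrow> real) \<times> (nat \<Rightarrow> real). (\<Sum>j<N. fst p (i, j) * snd p j) = 0}" for i
      by (intro closed_Collect_eq continuous_on_sum continuous_on_mult c1 c2 continuous_on_const)
    ultimately show ?thesis by auto
  qed
  have "{a. \<not> nsp k n N a} = (\<Union>S\<in>{S. S \<subseteq> {..<N} \<and> card S \<le> k}. {a. \<exists>x\<in>C S. (a, x) \<in> U})"
  proof (intro equalityI subsetI)
    fix a assume "a \<in> {a. \<not> nsp k n N a}"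
    then obtain x S where x: "\<forall>i<n. (\<Sum>j<N. a (i, j) * x j) = 0" "\<exists>j<N. x j \<noteq> 0"
      and S: "S \<subseteq> {..<N}" "card S \<le> k" "(\<Sum>j\<in>{..<N} - S. \<bar>x j\<bar>) \<le> (\<Sum>j\<in>S. \<bar>x j\<bar>)"
      unfolding nsp_def by (auto simp: not_less)
    define r where "r = (\<Sum>j<N. \<bar>x j\<bar>)"
    obtain j0 where j0: "j0 < N" "x j0 \<noteq> 0" using x(2) by auto
    have r: "0 < r" unfolding r_def using j0 by (intro sum_pos2[of _ j0]) auto
    define y where "y j = (if j < N then x j / r else 0)" for j
    have sumy: "(\<Sum>j\<in>R. \<bar>y j\<bar>) = (\<Sum>j\<in>R. \<bar>x j\<bar>) / r" if "R \<subseteq> {..<N}" for R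
      unfolding sum_divide_distrib using that r by (intro sum.cong) (auto simp: y_def)
    have "y \<in> C S" unfolding C_def
    proof (intro CollectI conjI allI)
      fix j
      have "\<bar>x j\<bar> \<le> r" if "j < N" unfolding r_def using that by (intro member_le_sum) auto
      then have "- r \<le> x j" "x j \<le> r" if "j < N" using that by (auto simp: abs_le_iff)
      then show "y j \<in> (if j < N then {-1..1} else {0})" using r by (auto simp: y_def divide_le_eq le_divide_eq)
    next
      show "(\<Sum>j<N. \<bar>y j\<bar>) = 1" using sumy[of "{..<N}"] r by (simp add: r_def)
      show "(\<Sum>j\<in>{..<N} - S. \<bar>y j\<bar>) \<le> (\<Sum>j\<in>S. \<bar>y j\<bar>)"
        using sumy[of "{..<N} - S"] sumy[of S] S r by (simp add: divide_right_mono)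
    qed
    moreover have "(a, y) \<in> U" unfolding U_def
    proof (intro CollectI allI impI)
      fix i assume i: "i < n"
      have "(\<Sum>j<N. a (i, j) * y j) = (\<Sum>j<N. a (i, j) * x j) / r"
        unfolding sum_divide_distrib by (intro sum.cong) (auto simp: y_def)
      then show "(\<Sum>j<N. fst (a, y) (i, j) * snd (a, y) j) = 0" using x(1) i by simp
    qed
    ultimately show "a \<in> (\<Union>S\<in>{S. S \<subseteq> {..<N} \<and> card S \<le> k}. {a. \<exists>x\<in>C S. (a, x) \<in> U})"
      using S by blast
  next
    fix a assume "a \<in> (\<Union>S\<in>{S. S \<subseteq> {..<N} \<and> card S \<le> k}. {a. \<exists>x\<in>C S. (a, x) \<in> U})"
    then obtain S x where S: "S \<subseteq> {..<N}" "card S \<le> k" and x: "x \<in> C S" "(a, x) \<in> U" by blast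
    have "\<exists>j<N. x j \<noteq> 0"
    proof (rule ccontr)
      assume "\<not> ?thesis"
      then have "(\<Sum>j<N. \<bar>x j\<bar>) = 0" by (intro sum.neutral) auto
      then show False using x(1) by (simp add: C_def)
    qed
    moreover have "\<forall>i<n. (\<Sum>j<N. a (i, j) * x j) = 0" using x(2) by (simp add: U_def)
    moreover have "\<not> (\<Sum>j\<in>S. \<bar>x j\<bar>) < (\<Sum>j\<in>{..<N} - S. \<bar>x j\<bar>)" using x(1) by (simp add: C_def)
    ultimately have "\<not> nsp k n N a" unfolding nsp_def using S by blast
    then show "a \<in> {a. \<not> nsp k n N a}" by simp
  qed
  moreover have "finite {S. S \<subseteq> {..<N} \<and> card S \<le> k}" by simp
  ultimately show ?thesis
    using closed_projection_compact[OF closedU compC] by (simp add: closed_UN)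
qed

lemma nsp_cong:
  assumes "\<And>i j. i < n \<Longrightarrow> j < N \<Longrightarrow> a (i, j) = b (i, j)"
  shows "nsp k n N a \<longleftrightarrow> nsp k n N b"
proof -
  have "(\<forall>i<n. (\<Sum>j<N. a (i, j) * x j) = 0) \<longleftrightarrow> (\<forall>i<n. (\<Sum>j<N. b (i, j) * x j) = 0)" for x
    using assms by simp
  then show ?thesis unfolding nsp_def by simp
qed

lemma sets_strong_equiv:
  assumes "gaussian_ensemble M n N A"
  shows "{w \<in> space M. strong_equiv k (A w)} \<in> sets M"
proof -
  have carr: "A w \<in> carrier_mat n N" if "w \<in> space M" for w using assms that by (simp add: gaussian_ensemble_def)
  \<comment> \<open>Extension by zero makes the matrix a random point of the product space. The null
    space property only looks at the entries within range.\<close>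
  define E where "E w p = (if p \<in> {..<n} \<times> {..<N} then index_mat (A w) p else 0)" for w p
  have "E \<in> borel_measurable M"
  proof (rule measurable_coordinatewise_then_product)
    fix p
    show "(\<lambda>w. E w p) \<in> borel_measurable M"
    proof (cases "p \<in> {..<n} \<times> {..<N}")
      case True
      then have "distributed M lborel (\<lambda>w. index_mat (A w) p) (normal_density 0 (1 / sqrt (real n)))"
        using assms unfolding gaussian_ensemble_def by blast
      from distributed_measurable[OF this] show ?thesis using True by (simp add: E_def)
    next
      case False
      then show ?thesis by (simp add: E_def)
    qed
  qed
  moreover have "{a. nsp k n N a} \<in> sets borel"
  proof -
    have "{a. nsp k n N a} = - {a. \<not> nsp k n N a}" by auto
    then show ?thesis using closed_not_nsp[of k n N] by (metis borel_comp borel_closed)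
  qed
  ultimately have "E -` {a. nsp k n N a} \<inter> space M \<in> sets M" by (rule measurable_sets)
  moreover have "E -` {a. nsp k n N a} \<inter> space M = {w \<in> space M. strong_equiv k (A w)}"
  proof -
    have "nsp k n N (E w) \<longleftrightarrow> nsp k n N (index_mat (A w))" for w
      by (rule nsp_cong) (simp add: E_def)
    then show ?thesis using strong_equiv_iff_nsp[OF carr] by auto
  qed
  ultimately show ?thesis by simp
qed

text \<open>Multiplication by \<open>sqrt n\<close> turns variance \<open>1 / n\<close> into 1.
  Bounds on the unscaled matrix therefore reappear as \<open>n * l\<close> and \<open>n * u\<close>
  for the standard Gaussian one.\<close>

lemma distr_gaussian_ensemble:
  assumes ge: "gaussian_ensemble M n N A" and n: "0 < n" and S: "S \<subseteq> {..<N}" "S \<noteq> {}"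
  defines "X \<equiv> \<lambda>w. \<lambda>p\<in>{..<n} \<times> S. sqrt (real n) * index_mat (A w) p"
  shows "X \<in> measurable M (gauss ({..<n} \<times> S))" "distr M (gauss ({..<n} \<times> S)) X = gauss ({..<n} \<times> S)"
proof -
  interpret prob_space M using ge by (simp add: gaussian_ensemble_def)
  define J where "J = {..<n} \<times> S"
  have J: "J \<noteq> {}" "J \<subseteq> {..<n} \<times> {..<N}" using n S by (auto simp: J_def)
  define Y where "Y p w = sqrt (real n) * index_mat (A w) p" for p w
  have dist: "distributed M lborel (Y p) std_normal_density" if "p \<in> J" for p
  proof -
    have "distributed M lborel (\<lambda>w. index_mat (A w) p) (normal_density 0 (1 / sqrt (real n)))"
      using ge that J(2) unfolding gaussian_ensemble_def by blast
    then have "distributed M lborel (\<lambda>w. (index_mat (A w) p - 0) / (1 / sqrt (real n))) std_normal_density"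
      using n by (subst (asm) normal_standard_normal_convert) auto
    then show ?thesis by (simp add: Y_def[abs_def] mult.commute)
  qed
  have rv: "random_variable borel (Y p)" if "p \<in> J" for p
    using distributed_measurable[OF dist[OF that]] by simp
  have "indep_vars (\<lambda>_. borel) (\<lambda>p w. index_mat (A w) p) ({..<n} \<times> {..<N})"
    using ge by (simp add: gaussian_ensemble_def)
  from indep_vars_subset[OF this J(2)] have "indep_vars (\<lambda>_. borel) (\<lambda>p w. index_mat (A w) p) J" .
  from indep_vars_compose2[OF this, of "\<lambda>_ x. sqrt (real n) * x" "\<lambda>_. borel"]
  have "indep_vars (\<lambda>_. borel) Y J" by (simp add: Y_def[abs_def])
  then have "distr M (Pi\<^sub>M J (\<lambda>_. borel)) (\<lambda>w. \<lambda>p\<in>J. Y p w) = (\<Pi>\<^sub>M p\<in>J. distr M borel (Y p))"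
    by (subst (asm) indep_vars_iff_distr_eq_PiM'[OF J(1)]) (use rv in auto)
  also have "\<dots> = gauss J" unfolding gauss_def
  proof (rule PiM_cong[OF refl])
    fix p assume p: "p \<in> J"
    have "distr M borel (Y p) = distr M lborel (Y p)" by (rule distr_cong) auto
    then show "distr M borel (Y p) = std_gauss"
      using distributed_distr_eq_density[OF dist[OF p]] by (simp add: std_gauss_def)
  qed
  also have "distr M (Pi\<^sub>M J (\<lambda>_. borel)) (\<lambda>w. \<lambda>p\<in>J. Y p w) = distr M (gauss J) (\<lambda>w. \<lambda>p\<in>J. Y p w)"
    by (rule distr_cong) (auto simp: sets_gauss)
  finally show "distr M (gauss ({..<n} \<times> S)) X = gauss ({..<n} \<times> S)"
    by (simp add: X_def Y_def J_def)
  have "(\<lambda>w. \<lambda>p\<in>J. Y p w) \<in> measurable M (Pi\<^sub>M J (\<lambda>_. borel))"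
    using rv by (rule measurable_restrict)
  then show "X \<in> measurable M (gauss ({..<n} \<times> S))"
    by (simp add: X_def Y_def[abs_def] J_def measurable_cong_sets[OF refl sets_gauss])
qed

section \<open>The union bound\<close>

text \<open>A vector violating one of the isometry bounds is normalised and padded with zeros to a
  column set of prescribed size. So each union bound runs over sets of a single size, and
  \<open>K1\<close> and \<open>K2\<close> can be chosen independently.\<close>

lemma not_strong_equiv_imp:
  assumes A: "A \<in> carrier_mat n N" and bad: "\<not> strong_equiv k A"
    and lu: "0 < l" "l \<le> u" "(1 + sqrt 2) / 4 * (u / l - 1) < 1"
    and K: "2 * k \<le> K1" "K1 \<le> N" "2 * k \<le> K2" "K2 \<le> N"
  obtains S x where "S \<subseteq> {..<N}" "card S = K1" "(\<Sum>j\<in>S. (x j)\<^sup>2) = 1"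
      "(\<Sum>i<n. (\<Sum>j\<in>S. index_mat A (i, j) * x j)\<^sup>2) \<le> l"
    | S x where "S \<subseteq> {..<N}" "card S = K2" "(\<Sum>j\<in>S. (x j)\<^sup>2) = 1"
      "u \<le> (\<Sum>i<n. (\<Sum>j\<in>S. index_mat A (i, j) * x j)\<^sup>2)"
proof -
  have "\<not> rip_bounds l u (2 * k) {..<n} {..<N} (\<lambda>i j. index_mat A (i, j))"
  proof
    assume rip: "rip_bounds l u (2 * k) {..<n} {..<N} (\<lambda>i j. index_mat A (i, j))"
    have "nsp k n N (index_mat A)" unfolding nsp_def
    proof (intro allI impI)
      fix x :: "nat \<Rightarrow> real" and S
      assume x: "\<forall>i<n. (\<Sum>j<N. index_mat A (i, j) * x j) = 0" "\<exists>j<N. x j \<noteq> 0"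
        and S: "S \<subseteq> {..<N}" "card S \<le> k"
      show "(\<Sum>j\<in>S. \<bar>x j\<bar>) < (\<Sum>j\<in>{..<N} - S. \<bar>x j\<bar>)"
        by (rule rip_imp_null_space_property[OF rip lu(1,2,3) _ S]) (use x in auto)
    qed
    then show False using bad strong_equiv_iff_nsp[OF A] by simp
  qed
  then obtain T x where T: "T \<subseteq> {..<N}" "card T \<le> 2 * k"
    and x: "\<not> (l * (\<Sum>j\<in>T. (x j)\<^sup>2) \<le> (\<Sum>i<n. (\<Sum>j\<in>T. index_mat A (i, j) * x j)\<^sup>2) \<and>
        (\<Sum>i<n. (\<Sum>j\<in>T. index_mat A (i, j) * x j)\<^sup>2) \<le> u * (\<Sum>j\<in>T. (x j)\<^sup>2))"
    unfolding rip_bounds_def by blast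
  define q where "q = (\<Sum>j\<in>T. (x j)\<^sup>2)"
  define m where "m = (\<Sum>i<n. (\<Sum>j\<in>T. index_mat A (i, j) * x j)\<^sup>2)"
  have finT: "finite T" using T(1) finite_subset by blast
  have m0: "0 \<le> m" by (simp add: m_def sum_nonneg)
  have "q \<noteq> 0"
  proof
    assume "q = 0"
    then have "\<forall>j\<in>T. x j = 0" using finT by (simp add: q_def sum_nonneg_eq_0_iff)
    then show False using x by simp
  qed
  then have q: "0 < q" by (simp add: q_def sum_nonneg less_le)
  define y where "y j = (if j \<in> T then x j / sqrt q else 0)" for j
  have y: "(\<Sum>j\<in>S. (y j)\<^sup>2) = 1" "(\<Sum>i<n. (\<Sum>j\<in>S. index_mat A (i, j) * y j)\<^sup>2) = m / q"
    if S: "T \<subseteq> S" "finite S" for S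
  proof -
    have "(\<Sum>j\<in>S. (y j)\<^sup>2) = (\<Sum>j\<in>T. (y j)\<^sup>2)"
      using S by (intro sum.mono_neutral_right) (auto simp: y_def)
    also have "\<dots> = q / q" unfolding q_def sum_divide_distrib
      using q by (intro sum.cong) (auto simp: y_def power_divide q_def)
    finally show "(\<Sum>j\<in>S. (y j)\<^sup>2) = 1" using q by simp
    have "(\<Sum>j\<in>S. index_mat A (i, j) * y j) = (\<Sum>j\<in>T. index_mat A (i, j) * x j) / sqrt q" for i
    proof -
      have "(\<Sum>j\<in>S. index_mat A (i, j) * y j) = (\<Sum>j\<in>T. index_mat A (i, j) * y j)"
        using S by (intro sum.mono_neutral_right) (auto simp: y_def)
      then show ?thesis by (simp add: y_def sum_divide_distrib)
    qed
    then have "(\<Sum>j\<in>S. index_mat A (i, j) * y j)\<^sup>2 = (\<Sum>j\<in>T. index_mat A (i, j) * x j)\<^sup>2 / q" for i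
      using q by (simp add: power_divide)
    then show "(\<Sum>i<n. (\<Sum>j\<in>S. index_mat A (i, j) * y j)\<^sup>2) = m / q"
      by (simp only: m_def sum_divide_distrib)
  qed
  have ext: "\<exists>S. T \<subseteq> S \<and> S \<subseteq> {..<N} \<and> card S = K" if "2 * k \<le> K" "K \<le> N" for K
    using exists_subset_between[of T K "{..<N}"] T that by auto
  from x consider "m < l * q" | "u * q < m" unfolding m_def q_def by linarith
  then show thesis
  proof cases
    case 1
    obtain S where S: "T \<subseteq> S" "S \<subseteq> {..<N}" "card S = K1" using ext[OF K(1,2)] by blast
    have "finite S" using S(2) finite_subset by blast
    moreover have "m / q \<le> l" using 1 q by (simp add: divide_le_eq)
    ultimately show thesis using that(1)[of S y] S y[of S] by simp
  next
    case 2
    obtain S where S: "T \<subseteq> S" "S \<subseteq> {..<N}" "card S = K2" using ext[OF K(3,4)] by blast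
    have "finite S" using S(2) finite_subset by blast
    moreover have "u \<le> m / q" using 2 q by (simp add: le_divide_eq)
    ultimately show thesis using that(2)[of S y] S y[of S] by simp
  qed
qed

definition min_bound :: "real \<Rightarrow> real \<Rightarrow> real \<Rightarrow> nat \<Rightarrow> nat \<Rightarrow> nat \<Rightarrow> real" where
  "min_bound l s \<tau> n N K = real (N choose K) * (tail_const (\<tau> * (real n * l)) *
      ((1 / sqrt (1 - 2 * s)) ^ K * (1 / sqrt (1 + 2 * s * \<tau>)) ^ (n + 1 - K)))"

definition max_bound :: "real \<Rightarrow> real \<Rightarrow> real \<Rightarrow> nat \<Rightarrow> nat \<Rightarrow> nat \<Rightarrow> real" where
  "max_bound u P Q n N K = real (N choose K) * (tail_const (P * Q * (real n * u)) * exp (- (P * Q * (real n * u))) *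
      ((1 / sqrt (1 - P)) ^ n * (1 / sqrt (1 - Q)) ^ K))"

lemma prob_strong_equiv_ge:
  assumes ge: "gaussian_ensemble M n N A" and n: "0 < n"
    and lu: "0 < l" "l \<le> u" "(1 + sqrt 2) / 4 * (u / l - 1) < 1"
    and K: "2 * k \<le> K1" "K1 \<le> N" "2 * k \<le> K2" "K2 \<le> N" "K1 \<le> n" "0 < K1" "0 < K2"
    and min_par: "0 < s" "s < 1 / 2" "0 < \<tau>" and max_par: "0 < P" "P < 1" "0 < Q" "Q < 1"
  shows "1 - (min_bound l s \<tau> n N K1 + max_bound u P Q n N K2)
    \<le> measure M {w \<in> space M. strong_equiv k (A w)}"
proof -
  interpret prob_space M using ge by (simp add: gaussian_ensemble_def)
  define F where "F K = {S. S \<subseteq> {..<N} \<and> card S = K}" for K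
  have F: "finite (F K)" "card (F K) = N choose K" for K
    using n_subsets[of "{..<N}" K] by (simp_all add: F_def)
  have FD: "S \<subseteq> {..<N}" "finite S" "card S = K" if "S \<in> F K" for S K
    using that finite_subset[of S "{..<N}"] by (auto simp: F_def)
  define X where "X S w = (\<lambda>p\<in>{..<n} \<times> S. sqrt (real n) * index_mat (A w) p)" for S w
  define b1 where "b1 = tail_const (\<tau> * (real n * l)) * ((1 / sqrt (1 - 2 * s)) ^ K1 * (1 / sqrt (1 + 2 * s * \<tau>)) ^ (n + 1 - K1))"
  define b2 where "b2 = tail_const (P * Q * (real n * u)) * exp (- (P * Q * (real n * u))) * ((1 / sqrt (1 - P)) ^ n * (1 / sqrt (1 - Q)) ^ K2)"
  have b0: "0 \<le> b1" "0 \<le> b2"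
    using tail_const_pos min_par max_par by (auto simp: b1_def b2_def less_imp_le)
  define G1 where "G1 S p \<longleftrightarrow> p \<in> borel_measurable (gauss ({..<n} \<times> S)) \<and> (\<integral>\<^sup>+G. p G \<partial>gauss ({..<n} \<times> S)) \<le> ennreal b1 \<and>
    (\<forall>G x. (\<Sum>j\<in>S. (x j)\<^sup>2) = 1 \<longrightarrow> (\<Sum>i\<in>{..<n}. (\<Sum>j\<in>S. G (i, j) * x j)\<^sup>2) \<le> real n * l \<longrightarrow> 1 \<le> p G)" for S :: "nat set" and p :: "(nat \<times> nat \<Rightarrow> real) \<Rightarrow> ennreal"
  have "\<forall>S\<in>F K1. \<exists>p. G1 S p"
  proof
    fix S assume S: "S \<in> F K1"
    have "card S \<le> card {..<n}" "0 < real n * l" using FD(3)[OF S] K(5) n lu(1) by simp_all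
    from gauss_min_singular_value[OF finite_lessThan[of n] FD(2)[OF S] this(1) min_par this(2)]
    show "\<exists>p. G1 S p" unfolding G1_def FD(3)[OF S] card_lessThan b1_def Bex_def .
  qed
  from bchoice[OF this] obtain p1 where P1: "\<forall>S\<in>F K1. G1 S (p1 S)" by (rule exE)
  have p1: "p1 S \<in> borel_measurable (gauss ({..<n} \<times> S))"
    "(\<integral>\<^sup>+G. p1 S G \<partial>gauss ({..<n} \<times> S)) \<le> ennreal b1"
    "(\<Sum>j\<in>S. (x j)\<^sup>2) = 1 \<Longrightarrow> (\<Sum>i\<in>{..<n}. (\<Sum>j\<in>S. G (i, j) * x j)\<^sup>2) \<le> real n * l \<Longrightarrow> 1 \<le> p1 S G"
    if "S \<in> F K1" for S G x
    using bspec[OF P1 that] unfolding G1_def by blast+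
  define G2 where "G2 S p \<longleftrightarrow> p \<in> borel_measurable (gauss ({..<n} \<times> S)) \<and> (\<integral>\<^sup>+G. p G \<partial>gauss ({..<n} \<times> S)) \<le> ennreal b2 \<and>
    (\<forall>G x. (\<Sum>j\<in>S. (x j)\<^sup>2) = 1 \<longrightarrow> real n * u \<le> (\<Sum>i\<in>{..<n}. (\<Sum>j\<in>S. G (i, j) * x j)\<^sup>2) \<longrightarrow> 1 \<le> p G)" for S :: "nat set" and p :: "(nat \<times> nat \<Rightarrow> real) \<Rightarrow> ennreal"
  have "\<forall>S\<in>F K2. \<exists>p. G2 S p"
  proof
    fix S assume S: "S \<in> F K2"
    have "0 < real n * u" using n lu by simp
    from gauss_max_singular_value[OF finite_lessThan[of n] FD(2)[OF S] max_par this]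
    show "\<exists>p. G2 S p" unfolding G2_def FD(3)[OF S] card_lessThan b2_def Bex_def .
  qed
  from bchoice[OF this] obtain p2 where P2: "\<forall>S\<in>F K2. G2 S (p2 S)" by (rule exE)
  have p2: "p2 S \<in> borel_measurable (gauss ({..<n} \<times> S))"
    "(\<integral>\<^sup>+G. p2 S G \<partial>gauss ({..<n} \<times> S)) \<le> ennreal b2"
    "(\<Sum>j\<in>S. (x j)\<^sup>2) = 1 \<Longrightarrow> real n * u \<le> (\<Sum>i\<in>{..<n}. (\<Sum>j\<in>S. G (i, j) * x j)\<^sup>2) \<Longrightarrow> 1 \<le> p2 S G"
    if "S \<in> F K2" for S G x
    using bspec[OF P2 that] unfolding G2_def by blast+
  have law: "X S \<in> measurable M (gauss ({..<n} \<times> S))" "distr M (gauss ({..<n} \<times> S)) (X S) = gauss ({..<n} \<times> S)"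
    if "S \<in> F K" "0 < K" for S K
  proof -
    have "S \<noteq> {}" using FD(3)[OF that(1)] that(2) by auto
    from distr_gaussian_ensemble[OF ge n FD(1)[OF that(1)] this]
    show "X S \<in> measurable M (gauss ({..<n} \<times> S))" "distr M (gauss ({..<n} \<times> S)) (X S) = gauss ({..<n} \<times> S)"
      unfolding X_def[abs_def] by this+
  qed
  have int: "(\<integral>\<^sup>+w. p (X S w) \<partial>M) = (\<integral>\<^sup>+G. p G \<partial>gauss ({..<n} \<times> S))"
    if "S \<in> F K" "0 < K" "p \<in> borel_measurable (gauss ({..<n} \<times> S))" for S K p
    using nn_integral_distr[OF law(1)[OF that(1,2)], of p] that(3) law(2)[OF that(1,2)] by simp
  define bad where "bad = {w \<in> space M. \<not> strong_equiv k (A w)}"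
  have good: "{w \<in> space M. strong_equiv k (A w)} \<in> sets M" by (rule sets_strong_equiv[OF ge])
  have bad_eq: "bad = space M - {w \<in> space M. strong_equiv k (A w)}" by (auto simp: bad_def)
  have bad: "bad \<in> sets M" unfolding bad_eq using good by auto
  \<comment> \<open>The functions \<open>p1\<close> and \<open>p2\<close> replace the indicators of
    the events that some \<open>x\<close> supported on \<open>S\<close> is stretched too little or
    too much. Integrating this inequality is the union bound.\<close>
  have pt: "indicator bad w \<le> (\<Sum>S\<in>F K1. p1 S (X S w)) + (\<Sum>S\<in>F K2. p2 S (X S w))" if w: "w \<in> space M" for w
  proof (cases "w \<in> bad")
    case True
    have carr: "A w \<in> carrier_mat n N" using ge w by (simp add: gaussian_ensemble_def)
    have scale: "(\<Sum>i\<in>{..<n}. (\<Sum>j\<in>S. X S w (i, j) * x j)\<^sup>2) = real n * (\<Sum>i<n. (\<Sum>j\<in>S. index_mat (A w) (i, j) * x j)\<^sup>2)" for S x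
    proof -
      have "(\<Sum>j\<in>S. X S w (i, j) * x j) = sqrt (real n) * (\<Sum>j\<in>S. index_mat (A w) (i, j) * x j)" if "i < n" for i
        unfolding sum_distrib_left using that by (intro sum.cong) (auto simp: X_def)
      then have "(\<Sum>j\<in>S. X S w (i, j) * x j)\<^sup>2 = real n * (\<Sum>j\<in>S. index_mat (A w) (i, j) * x j)\<^sup>2" if "i < n" for i
        using that by (simp only: power_mult_distrib real_sqrt_pow2 of_nat_0_le_iff)
      then show ?thesis unfolding sum_distrib_left[of "real n" _ "{..<n}"] by (intro sum.cong) auto
    qed
    have nb: "\<not> strong_equiv k (A w)" using True by (simp add: bad_def)
    have "1 \<le> (\<Sum>S\<in>F K1. p1 S (X S w)) + (\<Sum>S\<in>F K2. p2 S (X S w))"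
    proof (cases rule: not_strong_equiv_imp[OF carr nb lu K(1-4)])
      case (1 S x)
      then have S: "S \<in> F K1" by (simp add: F_def)
      have "1 \<le> p1 S (X S w)"
        using 1(4) n by (intro p1(3)[OF S 1(3)]) (simp add: scale)
      also have "\<dots> \<le> (\<Sum>S\<in>F K1. p1 S (X S w))" using S F(1) by (intro member_le_sum) auto
      finally show ?thesis by (rule order_trans) simp
    next
      case (2 S x)
      then have S: "S \<in> F K2" by (simp add: F_def)
      have "1 \<le> p2 S (X S w)"
        using 2(4) n by (intro p2(3)[OF S 2(3)]) (simp add: scale)
      also have "\<dots> \<le> (\<Sum>S\<in>F K2. p2 S (X S w))" using S F(1) by (intro member_le_sum) auto
      finally show ?thesis by (rule order_trans) simp
    qed
    then show ?thesis using True by simp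
  qed simp
  have m1: "(\<lambda>w. p1 S (X S w)) \<in> borel_measurable M" if "S \<in> F K1" for S
    by (rule measurable_compose[OF law(1)[OF that K(6)] p1(1)[OF that]])
  have m2: "(\<lambda>w. p2 S (X S w)) \<in> borel_measurable M" if "S \<in> F K2" for S
    by (rule measurable_compose[OF law(1)[OF that K(7)] p2(1)[OF that]])
  have "emeasure M bad = (\<integral>\<^sup>+w. indicator bad w \<partial>M)" using bad by simp
  also have "\<dots> \<le> (\<integral>\<^sup>+w. (\<Sum>S\<in>F K1. p1 S (X S w)) + (\<Sum>S\<in>F K2. p2 S (X S w)) \<partial>M)"
    by (rule nn_integral_mono) (rule pt)
  also have "\<dots> = (\<Sum>S\<in>F K1. (\<integral>\<^sup>+w. p1 S (X S w) \<partial>M)) + (\<Sum>S\<in>F K2. (\<integral>\<^sup>+w. p2 S (X S w) \<partial>M))"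
    using m1 m2 by (simp add: nn_integral_add nn_integral_sum)
  also have "\<dots> \<le> (\<Sum>S\<in>F K1. ennreal b1) + (\<Sum>S\<in>F K2. ennreal b2)"
    by (intro add_mono sum_mono) (use int K p1 p2 in auto)
  also have "\<dots> = ennreal (min_bound l s \<tau> n N K1 + max_bound u P Q n N K2)"
    using b0 unfolding min_bound_def max_bound_def b1_def[symmetric] b2_def[symmetric]
    by (simp add: F ennreal_plus ennreal_mult ennreal_of_nat_eq_real_of_nat)
  finally have "ennreal (measure M bad) \<le> ennreal (min_bound l s \<tau> n N K1 + max_bound u P Q n N K2)"
    unfolding emeasure_eq_measure .
  moreover have "0 \<le> min_bound l s \<tau> n N K1 + max_bound u P Q n N K2"
    using b0 unfolding min_bound_def max_bound_def b1_def[symmetric] b2_def[symmetric] by simp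
  ultimately have "measure M bad \<le> min_bound l s \<tau> n N K1 + max_bound u P Q n N K2"
    by (simp only: ennreal_le_iff)
  moreover have "measure M bad = 1 - measure M {w \<in> space M. strong_equiv k (A w)}"
    unfolding bad_eq by (rule prob_compl[OF good])
  ultimately show ?thesis by simp
qed

section \<open>Exponential rates of the two union bounds\<close>

lemma power_inv_sqrt_eq_exp: "0 < x \<Longrightarrow> (1 / sqrt x) ^ m = exp (- (real m / 2) * ln x)"
proof -
  assume x: "0 < x"
  have "1 / sqrt x = exp (- (ln x / 2))" using x by (simp add: ln_sqrt[symmetric] exp_minus inverse_eq_divide)
  then show ?thesis by (simp add: exp_of_nat_mult[symmetric])
qed

lemma tail_const_eq_exp: "tail_const t = exp (ln (sqrt (2 * pi)) + (t / 2 + sqrt t + 1 / 2))"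
proof -
  have "0 < sqrt (2 * pi)" by simp
  then show ?thesis unfolding tail_const_def exp_add[of "ln (sqrt (2 * pi))"] by (simp only: exp_ln)
qed

context
  fixes \<delta> \<nu> :: real and n N K :: "nat \<Rightarrow> nat"
  assumes \<delta>: "0 < \<delta>" "\<delta> < 1" and \<nu>: "0 < \<nu>" "\<nu> \<le> 1"
    and n: "filterlim n at_top sequentially"
    and nN: "(\<lambda>j. real (n j) / real (N j)) \<longlonglongrightarrow> \<delta>"
    and Kn: "(\<lambda>j. real (K j) / real (n j)) \<longlonglongrightarrow> \<nu>"
begin

lemma n_at_top: "filterlim (\<lambda>j. real (n j)) at_top sequentially"
  by (rule filterlim_compose[OF filterlim_real_sequentially n])

lemma eventually_n_pos: "\<forall>\<^sub>F j in sequentially. 0 < n j"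
  using filterlim_at_top_dense[THEN iffD1, OF n_at_top, rule_format, of 0] by simp

lemma N_over_n: "(\<lambda>j. real (N j) / real (n j)) \<longlonglongrightarrow> 1 / \<delta>"
  using tendsto_divide[OF tendsto_const[of 1] nN] \<delta> by simp

lemma inv_n: "(\<lambda>j. c / real (n j)) \<longlonglongrightarrow> 0"
  by (rule real_tendsto_divide_at_top[OF tendsto_const n_at_top])

lemma sqrt_n_over_n: "(\<lambda>j. sqrt (c * real (n j)) / real (n j)) \<longlonglongrightarrow> 0"
proof -
  have "filterlim (\<lambda>j. sqrt (real (n j))) at_top sequentially"
    by (rule filterlim_compose[OF sqrt_at_top n_at_top])
  then have "(\<lambda>j. sqrt c / sqrt (real (n j))) \<longlonglongrightarrow> 0"
    by (rule real_tendsto_divide_at_top[OF tendsto_const])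
  moreover have "sqrt c / sqrt (real m) = sqrt (c * real m) / real m" for m :: nat
    by (cases "m = 0") (simp_all add: real_sqrt_mult field_simps)
  ultimately show ?thesis by simp
qed

lemma eventually_K_le_N: "\<forall>\<^sub>F j in sequentially. K j \<le> N j"
proof -
  have "(\<lambda>j. real (K j) / real (n j) - real (N j) / real (n j)) \<longlonglongrightarrow> \<nu> - 1 / \<delta>"
    by (intro tendsto_diff Kn N_over_n)
  moreover have "\<nu> - 1 / \<delta> < 0"
  proof -
    have "1 < 1 / \<delta>" using \<delta> by simp
    then show ?thesis using \<nu> by linarith
  qed
  ultimately have "\<forall>\<^sub>F j in sequentially. real (K j) / real (n j) - real (N j) / real (n j) < 0"
    by (rule order_tendstoD)
  with eventually_n_pos show ?thesis
    by eventually_elim (simp add: field_simps)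
qed

lemma eventually_K_pos: "\<forall>\<^sub>F j in sequentially. 0 < K j"
proof -
  have "\<forall>\<^sub>F j in sequentially. 0 < real (K j) / real (n j)" using Kn \<nu>(1) by (rule order_tendstoD)
  then show ?thesis by eventually_elim (simp add: zero_less_divide_iff)
qed

text \<open>Up to sign, the limit of the exponent of \<open>binomial_le_exp\<close> per row, as
  \<open>K / n\<close> tends to \<nu> and \<open>N / n\<close> to
  \<open>1 / \<delta>\<close>.\<close>

lemma entropy_rate:
  "\<nu> * ln (\<nu> * \<delta>) + (1 / \<delta> - \<nu>) * ln (1 - \<nu> * \<delta>) = - H (\<nu> * \<delta>) / \<delta>"
proof -
  have p: "0 < \<nu> * \<delta>" "\<nu> * \<delta> < 1" using prod_bounds[OF \<delta> \<nu>] by auto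
  show ?thesis unfolding H_eq[OF p] using \<delta> by (simp add: field_simps)
qed

text \<open>All factors are written as exponentials, and the total exponent \<open>f\<close> is
  divided by \<open>n\<close>. From \<open>tail_const\<close> only \<open>\<tau> * l / 2\<close>
  survives; the square root, the constants and the one additional row vanish in the limit. They are
  the literal zeros in \<open>L\<close>.\<close>

lemma min_bound_tendsto_0:
  assumes par: "0 < s" "s < 1 / 2" "0 < \<tau>" and l: "0 < l" and \<nu>1: "\<nu> < 1"
    and neg: "H (\<nu> * \<delta>) / \<delta> + (\<tau> * l - \<nu> * ln (1 - 2 * s) - (1 - \<nu>) * ln (1 + 2 * s * \<tau>)) / 2 < 0"
  shows "(\<lambda>j. min_bound l s \<tau> (n j) (N j) (K j)) \<longlonglongrightarrow> 0"
proof -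
  define p where "p = \<nu> * \<delta>"
  have p: "0 < p" "p < 1" using prod_bounds[OF \<delta> \<nu>] by (auto simp: p_def)
  define c0 where "c0 = ln (sqrt (2 * pi)) + 1 / 2"
  define f where "f j = (- (real (K j) * ln p) - (real (N j) - real (K j)) * ln (1 - p))
      + (c0 + \<tau> * (real (n j) * l) / 2 + sqrt (\<tau> * (real (n j) * l)))
      + (- (real (K j) / 2) * ln (1 - 2 * s) + - ((real (n j) + 1 - real (K j)) / 2) * ln (1 + 2 * s * \<tau>))" for j
  define L where "L = (- (\<nu> * ln p) - (1 / \<delta> - \<nu>) * ln (1 - p)) + (0 + \<tau> * l / 2 + 0)
      + (- (\<nu> / 2) * ln (1 - 2 * s) + - ((1 + 0 - \<nu>) / 2) * ln (1 + 2 * s * \<tau>))"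
  have "(\<lambda>j. (- (real (K j) / real (n j) * ln p) - (real (N j) / real (n j) - real (K j) / real (n j)) * ln (1 - p))
      + (c0 / real (n j) + \<tau> * l / 2 + sqrt (\<tau> * l * real (n j)) / real (n j))
      + (- (real (K j) / real (n j) / 2) * ln (1 - 2 * s) + - ((1 + 1 / real (n j) - real (K j) / real (n j)) / 2) * ln (1 + 2 * s * \<tau>))) \<longlonglongrightarrow> L"
    unfolding L_def by (intro tendsto_intros Kn N_over_n inv_n sqrt_n_over_n) auto
  moreover have "\<forall>\<^sub>F j in sequentially. (- (real (K j) / real (n j) * ln p) - (real (N j) / real (n j) - real (K j) / real (n j)) * ln (1 - p))
      + (c0 / real (n j) + \<tau> * l / 2 + sqrt (\<tau> * l * real (n j)) / real (n j))
      + (- (real (K j) / real (n j) / 2) * ln (1 - 2 * s) + - ((1 + 1 / real (n j) - real (K j) / real (n j)) / 2) * ln (1 + 2 * s * \<tau>)) = f j / real (n j)"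
    using eventually_n_pos
  proof eventually_elim
    case (elim j)
    have e: "\<tau> * (real (n j) * l) = \<tau> * l * real (n j)" by simp
    show ?case unfolding f_def e using elim by (simp add: field_simps)
  qed
  ultimately have lim: "(\<lambda>j. f j / real (n j)) \<longlonglongrightarrow> L" by (rule Lim_transform_eventually)
  have "L = - (\<nu> * ln p + (1 / \<delta> - \<nu>) * ln (1 - p)) + (\<tau> * l - \<nu> * ln (1 - 2 * s) - (1 - \<nu>) * ln (1 + 2 * s * \<tau>)) / 2"
    unfolding L_def using \<delta> by (simp add: field_simps)
  then have "L = H p / \<delta> + (\<tau> * l - \<nu> * ln (1 - 2 * s) - (1 - \<nu>) * ln (1 + 2 * s * \<tau>)) / 2" using entropy_rate by (simp add: p_def)
  then have "L < 0" using neg by (simp add: p_def)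
  from exp_tendsto_0_of_ratio[OF n lim this] have lim0: "(\<lambda>j. exp (f j)) \<longlonglongrightarrow> 0" .
  have ev: "\<forall>\<^sub>F j in sequentially. K j \<le> n j"
  proof -
    have "\<forall>\<^sub>F j in sequentially. real (K j) / real (n j) < 1" using Kn \<nu>1 by (rule order_tendstoD)
    with eventually_n_pos show ?thesis by eventually_elim (simp add: divide_less_eq)
  qed
  have "\<forall>\<^sub>F j in sequentially. min_bound l s \<tau> (n j) (N j) (K j) \<le> exp (f j)"
    using eventually_K_le_N ev
  proof eventually_elim
    case (elim j)
    have pos: "0 < 1 - 2 * s" "0 < 1 + 2 * s * \<tau>" using par by (auto simp: add_pos_pos)
    have e1: "tail_const (\<tau> * (real (n j) * l)) = exp (c0 + \<tau> * (real (n j) * l) / 2 + sqrt (\<tau> * (real (n j) * l)))"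
      unfolding tail_const_eq_exp c0_def by (rule arg_cong[of _ _ exp]) simp
    have e2: "real (n j + 1 - K j) = real (n j) + 1 - real (K j)" using elim by simp
    have "min_bound l s \<tau> (n j) (N j) (K j) \<le> exp (- (real (K j) * ln p) - (real (N j) - real (K j)) * ln (1 - p))
       * (exp (c0 + \<tau> * (real (n j) * l) / 2 + sqrt (\<tau> * (real (n j) * l)))
       * (exp (- (real (K j) / 2) * ln (1 - 2 * s)) * exp (- ((real (n j) + 1 - real (K j)) / 2) * ln (1 + 2 * s * \<tau>))))"
      unfolding min_bound_def e1 power_inv_sqrt_eq_exp[OF pos(1)] power_inv_sqrt_eq_exp[OF pos(2)] e2
      using binomial_le_exp[OF elim(1) p] by (intro mult_right_mono) auto
    also have "\<dots> = exp (f j)" unfolding f_def exp_add[symmetric] by (simp only: add.assoc)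
    finally show ?case .
  qed
  moreover have "\<forall>\<^sub>F j in sequentially. 0 \<le> min_bound l s \<tau> (n j) (N j) (K j)"
    using par tail_const_pos by (auto simp: min_bound_def less_imp_le)
  ultimately show ?thesis by (intro tendsto_sandwich[OF _ _ tendsto_const lim0])
qed

text \<open>As for the lower bound. The contribution \<open>P * Q * u / 2\<close> of
  \<open>tail_const\<close> uses up half of the Chernoff gain \<open>P * Q * u\<close>, so that one
  half is left in the rate.\<close>

lemma max_bound_tendsto_0:
  assumes par: "0 < P" "P < 1" "0 < Q" "Q < 1" and u: "0 < u"
    and neg: "H (\<nu> * \<delta>) / \<delta> + (- (P * Q * u) - ln (1 - P) - \<nu> * ln (1 - Q)) / 2 < 0"
  shows "(\<lambda>j. max_bound u P Q (n j) (N j) (K j)) \<longlonglongrightarrow> 0"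
proof -
  define p where "p = \<nu> * \<delta>"
  have p: "0 < p" "p < 1" using prod_bounds[OF \<delta> \<nu>] by (auto simp: p_def)
  define c0 where "c0 = ln (sqrt (2 * pi)) + 1 / 2"
  define f where "f j = (- (real (K j) * ln p) - (real (N j) - real (K j)) * ln (1 - p))
      + ((c0 + P * Q * (real (n j) * u) / 2 + sqrt (P * Q * (real (n j) * u))) + - (P * Q * (real (n j) * u)))
      + (- (real (n j) / 2) * ln (1 - P) + - (real (K j) / 2) * ln (1 - Q))" for j
  define L where "L = (- (\<nu> * ln p) - (1 / \<delta> - \<nu>) * ln (1 - p)) + ((0 + P * Q * u / 2 + 0) + - (P * Q * u))
      + (- (1 / 2) * ln (1 - P) + - (\<nu> / 2) * ln (1 - Q))"
  have "(\<lambda>j. (- (real (K j) / real (n j) * ln p) - (real (N j) / real (n j) - real (K j) / real (n j)) * ln (1 - p))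
      + ((c0 / real (n j) + P * Q * u / 2 + sqrt (P * Q * u * real (n j)) / real (n j)) + - (P * Q * u))
      + (- (1 / 2) * ln (1 - P) + - (real (K j) / real (n j) / 2) * ln (1 - Q))) \<longlonglongrightarrow> L"
    unfolding L_def by (intro tendsto_intros Kn N_over_n inv_n sqrt_n_over_n) auto
  moreover have "\<forall>\<^sub>F j in sequentially. (- (real (K j) / real (n j) * ln p) - (real (N j) / real (n j) - real (K j) / real (n j)) * ln (1 - p))
      + ((c0 / real (n j) + P * Q * u / 2 + sqrt (P * Q * u * real (n j)) / real (n j)) + - (P * Q * u))
      + (- (1 / 2) * ln (1 - P) + - (real (K j) / real (n j) / 2) * ln (1 - Q)) = f j / real (n j)"
    using eventually_n_pos
  proof eventually_elim
    case (elim j)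
    have e: "P * Q * (real (n j) * u) = P * Q * u * real (n j)" by simp
    show ?case unfolding f_def e using elim by (simp add: field_simps)
  qed
  ultimately have lim: "(\<lambda>j. f j / real (n j)) \<longlonglongrightarrow> L" by (rule Lim_transform_eventually)
  have "L = - (\<nu> * ln p + (1 / \<delta> - \<nu>) * ln (1 - p)) + (- (P * Q * u) - ln (1 - P) - \<nu> * ln (1 - Q)) / 2"
    unfolding L_def using \<delta> by (simp add: field_simps)
  then have "L = H p / \<delta> + (- (P * Q * u) - ln (1 - P) - \<nu> * ln (1 - Q)) / 2" using entropy_rate by (simp add: p_def)
  then have "L < 0" using neg by (simp add: p_def)
  from exp_tendsto_0_of_ratio[OF n lim this] have lim0: "(\<lambda>j. exp (f j)) \<longlonglongrightarrow> 0" .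
  have "\<forall>\<^sub>F j in sequentially. max_bound u P Q (n j) (N j) (K j) \<le> exp (f j)"
    using eventually_K_le_N
  proof eventually_elim
    case (elim j)
    have pos: "0 < 1 - P" "0 < 1 - Q" using par by auto
    have e1: "tail_const (P * Q * (real (n j) * u)) = exp (c0 + P * Q * (real (n j) * u) / 2 + sqrt (P * Q * (real (n j) * u)))"
      unfolding tail_const_eq_exp c0_def by (rule arg_cong[of _ _ exp]) simp
    have "max_bound u P Q (n j) (N j) (K j) \<le> exp (- (real (K j) * ln p) - (real (N j) - real (K j)) * ln (1 - p))
       * (exp (c0 + P * Q * (real (n j) * u) / 2 + sqrt (P * Q * (real (n j) * u))) * exp (- (P * Q * (real (n j) * u)))
       * (exp (- (real (n j) / 2) * ln (1 - P)) * exp (- (real (K j) / 2) * ln (1 - Q))))"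
      unfolding max_bound_def e1 power_inv_sqrt_eq_exp[OF pos(1)] power_inv_sqrt_eq_exp[OF pos(2)]
      using binomial_le_exp[OF elim p] by (intro mult_right_mono) auto
    also have "\<dots> = exp (f j)" unfolding f_def exp_add[symmetric] by (simp only: add.assoc)
    finally show ?case .
  qed
  moreover have "\<forall>\<^sub>F j in sequentially. 0 \<le> max_bound u P Q (n j) (N j) (K j)"
    using par tail_const_pos by (auto simp: max_bound_def less_imp_le)
  ultimately show ?thesis by (intro tendsto_sandwich[OF _ _ tendsto_const lim0])
qed

end

lemma nat_floor_ratio:
  assumes n: "filterlim n at_top sequentially" and "0 \<le> \<nu>"
  shows "(\<lambda>j. real (nat \<lfloor>\<nu> * real (n j)\<rfloor>) / real (n j)) \<longlonglongrightarrow> \<nu>"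
proof (rule tendsto_sandwich)
  have n': "filterlim (\<lambda>j. real (n j)) at_top sequentially"
    by (rule filterlim_compose[OF filterlim_real_sequentially n])
  have pos: "\<forall>\<^sub>F j in sequentially. 0 < real (n j)"
    using filterlim_at_top_dense[THEN iffD1, OF n', rule_format, of 0] .
  have fl: "real (nat \<lfloor>\<nu> * real m\<rfloor>) = of_int \<lfloor>\<nu> * real m\<rfloor>" for m using assms(2) by simp
  show "\<forall>\<^sub>F j in sequentially. \<nu> - 1 / real (n j) \<le> real (nat \<lfloor>\<nu> * real (n j)\<rfloor>) / real (n j)"
    using pos
  proof eventually_elim
    case (elim j)
    have "\<nu> * real (n j) - 1 \<le> of_int \<lfloor>\<nu> * real (n j)\<rfloor>" by linarith
    then have "(\<nu> * real (n j) - 1) / real (n j) \<le> of_int \<lfloor>\<nu> * real (n j)\<rfloor> / real (n j)"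
      using elim by (intro divide_right_mono) auto
    then show ?case using elim unfolding fl by (simp add: diff_divide_distrib)
  qed
  show "\<forall>\<^sub>F j in sequentially. real (nat \<lfloor>\<nu> * real (n j)\<rfloor>) / real (n j) \<le> \<nu>"
    using pos
  proof eventually_elim
    case (elim j)
    have "of_int \<lfloor>\<nu> * real (n j)\<rfloor> \<le> \<nu> * real (n j)" by simp
    then show ?case using elim unfolding fl by (simp add: divide_le_eq)
  qed
  have "(\<lambda>j. 1 / real (n j)) \<longlonglongrightarrow> 0" by (rule real_tendsto_divide_at_top[OF tendsto_const n'])
  from tendsto_diff[OF tendsto_const[of \<nu>] this] show "(\<lambda>j. \<nu> - 1 / real (n j)) \<longlonglongrightarrow> \<nu>" by simp
qed simp

theorem theorem3p5:
  fixes \<epsilon> \<delta> \<rho> :: real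
    and k n N :: "nat \<Rightarrow> nat"
    and M :: "nat \<Rightarrow> 'w measure"
    and A :: "nat \<Rightarrow> 'w \<Rightarrow> real mat"
  assumes "0 < \<epsilon>"
    and "0 < \<delta>" "\<delta> < 1"
    and "0 < \<rho>" "\<rho> < 1 / 2"
    and "filterlim n at_top sequentially"
    and "(\<lambda>j. real (n j) / real (N j)) \<longlonglongrightarrow> \<delta>"
    and "(\<lambda>j. real (k j) / real (n j)) \<longlonglongrightarrow> \<rho>"
    and "\<And>j. gaussian_ensemble (M j) (n j) (N j) (A j)"
    and "\<rho> < (1 - \<epsilon>) * rho_S_FL \<delta>"
  shows "(\<lambda>j. measure (M j) {w \<in> space (M j). strong_equiv (k j) (A j w)}) \<longlonglongrightarrow> 1"
proof -
  note \<delta> = assms(2,3) and n = assms(6) and nN = assms(7)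
  have "0 < \<epsilon> * rho_S_FL \<delta>" using rho_S_FL_root(1)[OF \<delta>] assms(1) by simp
  then have "\<rho> < rho_S_FL \<delta>" using assms(10) by (simp add: left_diff_distrib)
  from below_rho_S_FL[OF \<delta> assms(4) this] obtain \<nu> where \<nu>: "2 * \<rho> \<le> \<nu>" "\<nu> \<le> 1"
    and gap: "lambda_max \<delta> \<nu> < gap_ratio * lambda_min \<delta> (2 * \<rho>)" .
  define \<nu>1 where "\<nu>1 = 2 * \<rho>"
  have \<nu>1: "0 < \<nu>1" "\<nu>1 < 1" "\<nu>1 \<le> 1" using assms(4,5) by (simp_all add: \<nu>1_def)
  have \<nu>0: "0 < \<nu>" using \<nu> \<nu>1 by (simp add: \<nu>1_def)
  define a where "a = lambda_max \<delta> \<nu>"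
  define b where "b = lambda_min \<delta> \<nu>1"
  have a: "1 + \<nu> < a" using lambda_max(1)[OF \<delta> \<nu>0 \<nu>(2)] by (simp add: a_def)
  have b: "0 < b" "b < 1 - \<nu>1" using lambda_min[OF \<delta> \<nu>1(1,2)] by (auto simp: b_def)
  have g: "2 \<le> gap_ratio" by (rule gap_ratio_ge_2[OF \<delta>])
  \<comment> \<open>This strict inequality is the room for \<open>l\<close> slightly below
    \<open>lambda_min\<close> and \<open>u\<close> slightly above \<open>lambda_max\<close> with
    \<open>u / l\<close> still below \<open>gap_ratio\<close>. The first two make both rates
    negative, the third is the condition of Foucart and Lai.\<close>
  have ab: "a / gap_ratio < b" using gap g by (simp add: a_def b_def \<nu>1_def divide_less_eq mult.commute)
  obtain l where l: "a / gap_ratio < l" "l < b" using dense[OF ab] by auto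
  have l0: "0 < l"
  proof -
    have "0 < a / gap_ratio" using a \<nu>0 g by (intro divide_pos_pos) linarith+
    then show ?thesis using l(1) by linarith
  qed
  have "a < gap_ratio * l" using l(1) g by (simp add: divide_less_eq mult.commute)
  then obtain u where u: "a < u" "u < gap_ratio * l" using dense by blast
  have u0: "0 < u" "1 + \<nu> \<le> u" using u(1) a \<nu>0 by linarith+
  have lu: "l \<le> u" using l(2) b u0 \<nu>0 \<nu>1 by linarith
  have ratio: "(1 + sqrt 2) / 4 * (u / l - 1) < 1"
  proof -
    have "u / l < gap_ratio" using u(2) l0 by (simp add: divide_less_eq)
    then have "u / l - 1 < 4 / (1 + sqrt 2)" by (simp add: gap_ratio_def[OF \<delta>])
    then have "(1 + sqrt 2) / 4 * (u / l - 1) < (1 + sqrt 2) / 4 * (4 / (1 + sqrt 2))"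
      by (intro mult_strict_left_mono) (auto simp: add_pos_pos)
    also have "\<dots> = 1" by (simp add: add_pos_pos less_imp_neq[symmetric])
    finally show ?thesis .
  qed
  have "F_min \<delta> l \<nu>1 < 0"
    using lambda_min_greater_iff(1)[OF \<delta> \<nu>1(1,2) l0] l b by (simp add: b_def)
  then have Fl: "H (\<nu>1 * \<delta>) / \<delta> + psi_min l \<nu>1 < 0"
    using \<delta> by (simp add: F_min_def[OF \<delta>] field_simps)
  have "0 < H (\<nu>1 * \<delta>) / \<delta>" using H_pos[of "\<nu>1 * \<delta>"] prod_bounds[OF \<delta> \<nu>1(1,3)] \<delta> by simp
  then have "psi_min l \<nu>1 < 0" using Fl by linarith
  then obtain s \<tau> where st: "0 < s" "s < 1 / 2" "0 < \<tau>"
    "\<tau> * l - \<nu>1 * ln (1 - 2 * s) - (1 - \<nu>1) * ln (1 + 2 * s * \<tau>) \<le> 2 * psi_min l \<nu>1"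
    using psi_min_exponent[OF \<nu>1(1,2) l0] l b by auto
  have "F_max \<delta> u \<nu> < 0"
    using lambda_max_greater_iff(2)[OF \<delta> \<nu>0 \<nu>(2) u0(2)] u by (simp add: a_def)
  then have Fu: "H (\<nu> * \<delta>) / \<delta> + psi_max u \<nu> < 0"
    using \<delta> by (simp add: F_max_def[OF \<delta>] field_simps)
  have "0 < H (\<nu> * \<delta>) / \<delta>" using H_pos[of "\<nu> * \<delta>"] prod_bounds[OF \<delta> \<nu>0 \<nu>(2)] \<delta> by simp
  then have "psi_max u \<nu> < 0" using Fu by linarith
  then obtain P Q where PQ: "0 < P" "P < 1" "0 < Q" "Q < 1"
    "- (P * Q * u) - ln (1 - P) - \<nu> * ln (1 - Q) \<le> 2 * psi_max u \<nu>"
    using psi_max_exponent[OF \<nu>0 \<nu>(2) u0(2)] by auto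
  define K1 where "K1 j = 2 * k j" for j
  \<comment> \<open>If \<open>\<nu> = 2 * \<rho>\<close>, then the floor may fall short of
    \<open>2 * k j\<close>. The maximum keeps the column sets large enough and does not change the
    limit \<nu>.\<close>
  define K2 where "K2 j = max (2 * k j) (nat \<lfloor>\<nu> * real (n j)\<rfloor>)" for j
  have K1: "(\<lambda>j. real (K1 j) / real (n j)) \<longlonglongrightarrow> \<nu>1"
    using tendsto_mult_left[OF assms(8), of 2] by (simp add: K1_def \<nu>1_def)
  have K2: "(\<lambda>j. real (K2 j) / real (n j)) \<longlonglongrightarrow> \<nu>"
  proof -
    have "(\<lambda>j. max (real (K1 j) / real (n j)) (real (nat \<lfloor>\<nu> * real (n j)\<rfloor>) / real (n j))) \<longlonglongrightarrow> max \<nu>1 \<nu>"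
      using \<nu>0 by (intro tendsto_max K1 nat_floor_ratio[OF n]) simp
    moreover have "max (x / real m) (y / real m) = max x y / real m" for x y and m :: nat
      by (simp add: max_divide_distrib_right)
    ultimately show ?thesis using \<nu>(1) by (simp add: K1_def K2_def \<nu>1_def of_nat_max max_absorb2)
  qed
  have half: "h + c / 2 < 0" if "c \<le> 2 * p" "h + p < 0" for h c p :: real
    using that by linarith
  have lim1: "(\<lambda>j. min_bound l s \<tau> (n j) (N j) (K1 j)) \<longlonglongrightarrow> 0"
    by (rule min_bound_tendsto_0[OF \<delta> \<nu>1(1,3) n nN K1 st(1,2,3) l0 \<nu>1(2) half[OF st(4) Fl]])
  have lim2: "(\<lambda>j. max_bound u P Q (n j) (N j) (K2 j)) \<longlonglongrightarrow> 0"
    by (rule max_bound_tendsto_0[OF \<delta> \<nu>0 \<nu>(2) n nN K2 PQ(1,2,3,4) u0(1) half[OF PQ(5) Fu]])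
  have ev1: "\<forall>\<^sub>F j in sequentially. K1 j \<le> n j"
  proof -
    have "\<forall>\<^sub>F j in sequentially. real (K1 j) / real (n j) < 1" using K1 \<nu>1(2) by (rule order_tendstoD)
    with eventually_n_pos[OF \<delta> \<nu>1(1,3) n nN K1] show ?thesis
      by eventually_elim (simp add: divide_less_eq)
  qed
  have lower: "\<forall>\<^sub>F j in sequentially. 1 - (min_bound l s \<tau> (n j) (N j) (K1 j) + max_bound u P Q (n j) (N j) (K2 j))
     \<le> measure (M j) {w \<in> space (M j). strong_equiv (k j) (A j w)}"
    using eventually_n_pos[OF \<delta> \<nu>1(1,3) n nN K1] ev1
      eventually_K_le_N[OF \<delta> \<nu>1(1,3) n nN K1] eventually_K_le_N[OF \<delta> \<nu>0 \<nu>(2) n nN K2]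
      eventually_K_pos[OF \<delta> \<nu>1(1,3) n nN K1] eventually_K_pos[OF \<delta> \<nu>0 \<nu>(2) n nN K2]
  proof eventually_elim
    case (elim j)
    show ?case
      using elim by (intro prob_strong_equiv_ge[OF assms(9) _ l0 lu ratio _ _ _ _ _ _ _ st(1,2,3) PQ(1,2,3,4)])
        (auto simp: K1_def K2_def)
  qed
  have upper: "\<forall>\<^sub>F j in sequentially. measure (M j) {w \<in> space (M j). strong_equiv (k j) (A j w)} \<le> 1"
    using assms(9) by (intro always_eventually allI prob_space.prob_le_1) (simp add: gaussian_ensemble_def)
  have lim: "(\<lambda>j. 1 - (min_bound l s \<tau> (n j) (N j) (K1 j) + max_bound u P Q (n j) (N j) (K2 j))) \<longlonglongrightarrow> 1"
    using tendsto_diff[OF tendsto_const[of 1] tendsto_add[OF lim1 lim2]] by simp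
  show ?thesis by (rule tendsto_sandwich[OF lower upper lim tendsto_const])
qed

end
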